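(* Let $X$ be an $\mathbb R^n$-valued continuous semimartingale, $\hat X_t=(\varphi(t),X_t)$ and $\hat{\mathbb X}$ the signature of $\hat X$. For a market of $d$ stocks, consider the class of Sig-market models $$dS_t=\operatorname{diag}(S_t)\big(a(\hat X_{[0,t]})\,dt+\Sigma\,dB_t\big),\qquad a(\hat X_{[0,t]})_i=\sum_{0\le|I|\le N}\alpha^{(i)}_I\langle e_I,\hat{\mathbb X}_t\rangle,$$ where $N\ge0$, $\alpha^{(i)}_I\in\mathbb R$, $\Sigma$ is a constant $d\times m$ matrix (with $\Sigma\Sigma^{\mathsf T}$ invertible), and $B$ is an $m$-dimensional Brownian motion, $m\ge d$. Then the growth-optimal portfolio is, for any auxiliary portfolio, a signature portfolio of type II, and it is a signature portfolio of type I for any constant and deterministic auxiliary portfolio $\tau$.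
   Context: Fix $T>0$ and a filtered probability space $(\Omega,\mathcal F,(\mathcal F_t)_{t\in[0,T]},\mathbb P)$; $\varphi:[0,T]\to\mathbb R$ is continuous and strictly increasing. For a word $I=(i_1,\dots,i_k)$ in the letters $\{1,\dots,n+1\}$, $|I|=k$, $\langle e_I,\hat{\mathbb X}_t\rangle=\int_{0\le u_1\le\dots\le u_k\le t}\circ d\hat X^{i_1}_{u_1}\cdots\circ d\hat X^{i_k}_{u_k}$ is the iterated Stratonovich integral (equal to $1$ for the empty word). A linear function on the signature is $L(\hat{\mathbb X}_t)=\sum_{0\le|I|\le M}l_I\langle e_I,\hat{\mathbb X}_t\rangle$ with $M\in\mathbb N$ and constants $l_I\in\mathbb R$. The price process $S$ is a $d$-dimensional positive continuous semimartingale. A portfolio is a vector $\pi=(\pi^1,\dots,\pi^d)$ of predictable processes with $\sum_i\pi^i_t\equiv1$, integrable with respect to $R$, $R^i_t=\int_0^tdS^i_u/S^i_u$. An auxiliary portfolio $\tau$ is a uniformly bounded portfolio. A portfolio is a signature portfolio with auxiliary portfolio $\tau$ if there are linear functions on the signature $L^1,\dots,L^d$ with type I: $\pi^i_t=\tau^i_t\big(L^i(\hat{\mathbb X}_t)+1-\sum_{j=1}^d\tau^j_tL^j(\hat{\mathbb X}_t)\big)$; type II: $\pi^i_t=L^i(\hat{\mathbb X}_t)+\tau^i_t\big(1-\sum_{j=1}^dL^j(\hat{\mathbb X}_t)\big)$. In a market $dS_t=\operatorname{diag}(S_t)(a_tdt+\Sigma_tdB_t)$ the growth rate of a portfolio $\pi$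 is $g^\pi_t=\pi_t^{\mathsf T}a_t-\frac12\pi_t^{\mathsf T}\Sigma_t\Sigma_t^{\mathsf T}\pi_t$, and the growth-optimal portfolio is the portfolio with maximal growth rate.
   Formalization: For type I, the constant deterministic auxiliary portfolio τ is additionally required to have all components nonzero; if some τ^i = 0, type I forces π^i = 0, which the growth-optimal portfolio need not satisfy. *)

theory Defs
  imports "HOL-Probability.Probability"
begin

section \<open>Filtered probability spaces and processes on [0,T]\<close>

text \<open>A process is a function of time and outcome; only times in \<open>{0..T}\<close> matter. A filtration
  on \<open>[0,T]\<close> is identified with its constant extension to the whole real line. Completeness and
  right-continuity of the filtration are not required.\<close>

definition filtered_prob_space :: "'w measure \<Rightarrow> (real \<Rightarrow> 'w measure) \<Rightarrow> real \<Rightarrow> bool" where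
  "filtered_prob_space M F T \<longleftrightarrow>
     prob_space M \<and> 0 < T \<and> filtration (space M) F \<and> (\<forall>t. subalgebra M (F t))"

definition continuous_adapted ::
  "'w measure \<Rightarrow> (real \<Rightarrow> 'w measure) \<Rightarrow> real \<Rightarrow> (real \<Rightarrow> 'w \<Rightarrow> 'b::topological_space) \<Rightarrow> bool" where
  "continuous_adapted M F T X \<longleftrightarrow>
     (\<forall>t\<in>{0..T}. X t \<in> borel_measurable (F t)) \<and>
     (\<forall>\<omega>\<in>space M. continuous_on {0..T} (\<lambda>t. X t \<omega>))"

definition predictable_sigma ::
  "'w measure \<Rightarrow> (real \<Rightarrow> 'w measure) \<Rightarrow> real \<Rightarrow> (real \<times> 'w) measure" where
  "predictable_sigma M F T = sigma ({0..T} \<times> space M)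
     ({{0} \<times> A | A. A \<in> sets (F 0)} \<union>
      {{s<..t} \<times> A | s t A. 0 \<le> s \<and> s \<le> t \<and> t \<le> T \<and> A \<in> sets (F s)})"

definition predictable ::
  "'w measure \<Rightarrow> (real \<Rightarrow> 'w measure) \<Rightarrow> real \<Rightarrow> (real \<Rightarrow> 'w \<Rightarrow> real) \<Rightarrow> bool" where
  "predictable M F T H \<longleftrightarrow> (\<lambda>(t, \<omega>). H t \<omega>) \<in> borel_measurable (predictable_sigma M F T)"


section \<open>Continuous semimartingales\<close>

definition martingale ::
  "'w measure \<Rightarrow> (real \<Rightarrow> 'w measure) \<Rightarrow> real \<Rightarrow> (real \<Rightarrow> 'w \<Rightarrow> real) \<Rightarrow> bool" where
  "martingale M F T X \<longleftrightarrow>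
     (\<forall>t\<in>{0..T}. X t \<in> borel_measurable (F t) \<and> integrable M (X t)) \<and>
     (\<forall>s\<in>{0..T}. \<forall>t\<in>{s..T}. AE \<omega> in M. real_cond_exp M (F s) (X t) \<omega> = X s \<omega>)"

definition continuous_local_martingale ::
  "'w measure \<Rightarrow> (real \<Rightarrow> 'w measure) \<Rightarrow> real \<Rightarrow> (real \<Rightarrow> 'w \<Rightarrow> real) \<Rightarrow> bool" where
  "continuous_local_martingale M F T X \<longleftrightarrow>
     continuous_adapted M F T X \<and>
     (\<exists>\<sigma> :: nat \<Rightarrow> 'w \<Rightarrow> real.
        (\<forall>n. stopping_time F (\<sigma> n)) \<and>
        (\<forall>n. \<forall>\<omega>\<in>space M. 0 \<le> \<sigma> n \<omega> \<and> \<sigma> n \<omega> \<le> \<sigma> (Suc n) \<omega>) \<and>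
        (AE \<omega> in M. \<exists>n. T \<le> \<sigma> n \<omega>) \<and>
        (\<forall>n. martingale M F T (\<lambda>t \<omega>. X (min t (\<sigma> n \<omega>)) \<omega> - X 0 \<omega>)))"

definition partition_of :: "real \<Rightarrow> nat \<Rightarrow> (nat \<Rightarrow> real) \<Rightarrow> bool" where
  "partition_of t n p \<longleftrightarrow> p 0 = 0 \<and> p n = t \<and> (\<forall>k<n. p k \<le> p (Suc k))"

definition finite_variation :: "real \<Rightarrow> (real \<Rightarrow> real) \<Rightarrow> bool" where
  "finite_variation T a \<longleftrightarrow>
     (\<exists>K. \<forall>n p. partition_of T n p \<longrightarrow> (\<Sum>k<n. \<bar>a (p (Suc k)) - a (p k)\<bar>) \<le> K)"

definition continuous_finite_variation ::
  "'w measure \<Rightarrow> (real \<Rightarrow> 'w measure) \<Rightarrow> real \<Rightarrow> (real \<Rightarrow> 'w \<Rightarrow> real) \<Rightarrow> bool" where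
  "continuous_finite_variation M F T A \<longleftrightarrow>
     continuous_adapted M F T A \<and> (\<forall>\<omega>\<in>space M. finite_variation T (\<lambda>t. A t \<omega>))"

definition semimartingale_decomposition ::
  "'w measure \<Rightarrow> (real \<Rightarrow> 'w measure) \<Rightarrow> real \<Rightarrow> (real \<Rightarrow> 'w \<Rightarrow> real) \<Rightarrow>
   (real \<Rightarrow> 'w \<Rightarrow> real) \<Rightarrow> (real \<Rightarrow> 'w \<Rightarrow> real) \<Rightarrow> bool" where
  "semimartingale_decomposition M F T X N A \<longleftrightarrow>
     continuous_local_martingale M F T N \<and> continuous_finite_variation M F T A \<and>
     (\<forall>\<omega>\<in>space M. N 0 \<omega> = 0 \<and> A 0 \<omega> = 0) \<and>
     (AE \<omega> in M. \<forall>t\<in>{0..T}. X t \<omega> = X 0 \<omega> + N t \<omega> + A t \<omega>)"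

definition continuous_semimartingale ::
  "'w measure \<Rightarrow> (real \<Rightarrow> 'w measure) \<Rightarrow> real \<Rightarrow> (real \<Rightarrow> 'w \<Rightarrow> real) \<Rightarrow> bool" where
  "continuous_semimartingale M F T X \<longleftrightarrow>
     continuous_adapted M F T X \<and> (\<exists>N A. semimartingale_decomposition M F T X N A)"


section \<open>Stochastic integrals of continuous integrands\<close>

text \<open>For continuous adapted integrands and continuous semimartingales, the Ito integral and the
  quadratic covariation over \<open>[0,t]\<close> are the limits in probability, as the mesh of deterministic
  partitions of \<open>[0,t]\<close> tends to zero, of the usual sums. The limit \<open>Z\<close> is a random variable,
  determined up to null sets.\<close>

definition limit_of_sums ::
  "'w measure \<Rightarrow> real \<Rightarrow> (real \<Rightarrow> real \<Rightarrow> 'w \<Rightarrow> real) \<Rightarrow> ('w \<Rightarrow> real) \<Rightarrow> bool" where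
  "limit_of_sums M t f Z \<longleftrightarrow> Z \<in> borel_measurable M \<and>
     (\<forall>\<epsilon>>0. \<exists>\<delta>>0. \<forall>n p. partition_of t n p \<and> (\<forall>k<n. p (Suc k) - p k < \<delta>) \<longrightarrow>
        measure M {\<omega> \<in> space M. \<epsilon> < \<bar>(\<Sum>k<n. f (p k) (p (Suc k)) \<omega>) - Z \<omega>\<bar>} \<le> \<epsilon>)"

definition has_ito_integral ::
  "'w measure \<Rightarrow> (real \<Rightarrow> 'w \<Rightarrow> real) \<Rightarrow> (real \<Rightarrow> 'w \<Rightarrow> real) \<Rightarrow> real \<Rightarrow> ('w \<Rightarrow> real) \<Rightarrow> bool" where
  "has_ito_integral M Y X t Z \<longleftrightarrow>
     limit_of_sums M t (\<lambda>u v \<omega>. Y u \<omega> * (X v \<omega> - X u \<omega>)) Z"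

definition has_covariation ::
  "'w measure \<Rightarrow> (real \<Rightarrow> 'w \<Rightarrow> real) \<Rightarrow> (real \<Rightarrow> 'w \<Rightarrow> real) \<Rightarrow> real \<Rightarrow> ('w \<Rightarrow> real) \<Rightarrow> bool" where
  "has_covariation M Y X t Z \<longleftrightarrow>
     limit_of_sums M t (\<lambda>u v \<omega>. (Y v \<omega> - Y u \<omega>) * (X v \<omega> - X u \<omega>)) Z"

definition has_stratonovich_integral ::
  "'w measure \<Rightarrow> (real \<Rightarrow> 'w \<Rightarrow> real) \<Rightarrow> (real \<Rightarrow> 'w \<Rightarrow> real) \<Rightarrow> real \<Rightarrow> ('w \<Rightarrow> real) \<Rightarrow> bool" where
  "has_stratonovich_integral M Y X t Z \<longleftrightarrow>
     (\<exists>I C. has_ito_integral M Y X t I \<and> has_covariation M Y X t C \<and>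
            Z \<in> borel_measurable M \<and> (AE \<omega> in M. Z \<omega> = I \<omega> + C \<omega> / 2))"

text \<open>Integrability of a vector of predictable processes with respect to a vector-valued continuous
  semimartingale \<open>R = R\<^sub>0 + N + A\<close>: almost surely, writing \<open>A\<^sup>i = \<integral>\<alpha>\<^sup>i d\<mu>\<close> and
  \<open>[N\<^sup>i,N\<^sup>j] = \<integral>\<gamma>\<^sup>i\<^sup>j d\<mu>\<close> for a dominating measure \<open>\<mu>\<close>, the integrals of \<open>\<bar>h \<bullet> \<alpha>\<bar>\<close> and of
  \<open>h \<bullet> \<gamma> h\<close> against \<open>\<mu>\<close> are finite. This does not depend on \<open>\<mu>\<close>. It is vector integrability, so
  the single components need not be integrable.\<close>

definition path_integrable ::
  "real \<Rightarrow> (real \<Rightarrow> real^'d) \<Rightarrow> (real \<Rightarrow> real^'d) \<Rightarrow> (real \<Rightarrow> real^'d^'d) \<Rightarrow> bool" where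
  "path_integrable T h a c \<longleftrightarrow>
     (\<exists>(\<mu> :: real measure) \<alpha> \<gamma>. sets \<mu> = sets borel \<and> finite_measure \<mu> \<and>
        (\<forall>i. set_integrable \<mu> {0<..T} (\<lambda>u. \<alpha> u $ i) \<and>
             (\<forall>t\<in>{0..T}. a t $ i = (LINT u:{0<..t}|\<mu>. \<alpha> u $ i))) \<and>
        (\<forall>i j. set_integrable \<mu> {0<..T} (\<lambda>u. \<gamma> u $ i $ j) \<and>
             (\<forall>t\<in>{0..T}. c t $ i $ j = (LINT u:{0<..t}|\<mu>. \<gamma> u $ i $ j))) \<and>
        set_integrable \<mu> {0<..T} (\<lambda>u. h u \<bullet> \<alpha> u) \<and>
        set_integrable \<mu> {0<..T} (\<lambda>u. h u \<bullet> (\<gamma> u *v h u)))"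

definition integrable_wrt ::
  "'w measure \<Rightarrow> (real \<Rightarrow> 'w measure) \<Rightarrow> real \<Rightarrow>
   (real \<Rightarrow> 'w \<Rightarrow> real^'d) \<Rightarrow> (real \<Rightarrow> 'w \<Rightarrow> real^'d) \<Rightarrow> bool" where
  "integrable_wrt M F T H R \<longleftrightarrow>
     (\<forall>i. predictable M F T (\<lambda>t \<omega>. H t \<omega> $ i)) \<and>
     (\<exists>(N :: real \<Rightarrow> 'w \<Rightarrow> real^'d) (A :: real \<Rightarrow> 'w \<Rightarrow> real^'d) (C :: real \<Rightarrow> 'w \<Rightarrow> real^'d^'d).
        (\<forall>i. semimartingale_decomposition M F T
               (\<lambda>t \<omega>. R t \<omega> $ i) (\<lambda>t \<omega>. N t \<omega> $ i) (\<lambda>t \<omega>. A t \<omega> $ i)) \<and>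
        (\<forall>i j. continuous_finite_variation M F T (\<lambda>t \<omega>. C t \<omega> $ i $ j) \<and>
           (\<forall>t\<in>{0..T}. has_covariation M (\<lambda>t \<omega>. N t \<omega> $ i) (\<lambda>t \<omega>. N t \<omega> $ j) t
                          (\<lambda>\<omega>. C t \<omega> $ i $ j))) \<and>
        (AE \<omega> in M. path_integrable T (\<lambda>t. H t \<omega>) (\<lambda>t. A t \<omega>) (\<lambda>t. C t \<omega>)))"

definition brownian_motion ::
  "'w measure \<Rightarrow> (real \<Rightarrow> 'w measure) \<Rightarrow> real \<Rightarrow> (real \<Rightarrow> 'w \<Rightarrow> real^'m) \<Rightarrow> bool" where
  "brownian_motion M F T B \<longleftrightarrow>
     continuous_adapted M F T B \<and> (AE \<omega> in M. B 0 \<omega> = 0) \<and>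
     (\<forall>s t. 0 \<le> s \<and> s < t \<and> t \<le> T \<longrightarrow>
        prob_space.indep_set M (sets (F s))
          {(\<lambda>\<omega>. B t \<omega> - B s \<omega>) -` U \<inter> space M | U. U \<in> sets borel} \<and>
        prob_space.indep_vars M (\<lambda>_. borel) (\<lambda>j \<omega>. B t \<omega> $ j - B s \<omega> $ j) UNIV \<and>
        (\<forall>j. distributed M lborel (\<lambda>\<omega>. B t \<omega> $ j - B s \<omega> $ j)
               (normal_density 0 (sqrt (t - s)))))"


section \<open>The signature\<close>

text \<open>The letters are the elements of \<open>'n option\<close>: \<open>None\<close> is the time component \<open>\<phi>(t)\<close> and
  \<open>Some j\<close> the component \<open>j\<close> of \<open>X\<close>. Words are lists of letters.\<close>

definition time_augmented ::
  "(real \<Rightarrow> real) \<Rightarrow> (real \<Rightarrow> 'w \<Rightarrow> real^'n) \<Rightarrow> real \<Rightarrow> 'w \<Rightarrow> real^('n option)" where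
  "time_augmented \<phi> X t \<omega> = (\<chi> l. case l of None \<Rightarrow> \<phi> t | Some j \<Rightarrow> X t \<omega> $ j)"

text \<open>\<open>Sg I t\<close> is the iterated Stratonovich integral over \<open>0 \<le> u\<^sub>1 \<le> \<dots> \<le> u\<^sub>k \<le> t\<close>, whose last
  letter belongs to the outermost integral. Stochastic integrals being defined up to null sets,
  \<open>Sg\<close> is a choice of continuous adapted versions.\<close>

definition is_signature ::
  "'w measure \<Rightarrow> (real \<Rightarrow> 'w measure) \<Rightarrow> real \<Rightarrow> (real \<Rightarrow> 'w \<Rightarrow> real^'l) \<Rightarrow>
   ('l list \<Rightarrow> real \<Rightarrow> 'w \<Rightarrow> real) \<Rightarrow> bool" where
  "is_signature M F T Xh Sg \<longleftrightarrow>
     (\<forall>t\<in>{0..T}. \<forall>\<omega>\<in>space M. Sg [] t \<omega> = 1) \<and>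
     (\<forall>I i. continuous_adapted M F T (Sg (I @ [i])) \<and>
        (\<forall>t\<in>{0..T}. has_stratonovich_integral M (Sg I) (\<lambda>t \<omega>. Xh t \<omega> $ i) t (Sg (I @ [i]) t)))"

definition sig_linear ::
  "('l::finite list \<Rightarrow> real \<Rightarrow> 'w \<Rightarrow> real) \<Rightarrow> nat \<Rightarrow> ('l list \<Rightarrow> real) \<Rightarrow> real \<Rightarrow> 'w \<Rightarrow> real" where
  "sig_linear Sg K l t \<omega> = (\<Sum>I | length I \<le> K. l I * Sg I t \<omega>)"

definition linear_on_signature ::
  "('l::finite list \<Rightarrow> real \<Rightarrow> 'w \<Rightarrow> real) \<Rightarrow> (real \<Rightarrow> 'w \<Rightarrow> real) \<Rightarrow> bool" where
  "linear_on_signature Sg L \<longleftrightarrow> (\<exists>K l. L = sig_linear Sg K l)"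


section \<open>Markets and portfolios\<close>

text \<open>\<open>R\<^sup>i = \<integral> dS\<^sup>i / S\<^sup>i\<close>\<close>

definition return_process ::
  "'w measure \<Rightarrow> (real \<Rightarrow> 'w measure) \<Rightarrow> real \<Rightarrow>
   (real \<Rightarrow> 'w \<Rightarrow> real^'d) \<Rightarrow> (real \<Rightarrow> 'w \<Rightarrow> real^'d) \<Rightarrow> bool" where
  "return_process M F T S R \<longleftrightarrow> continuous_adapted M F T R \<and>
     (\<forall>i. \<forall>t\<in>{0..T}.
        has_ito_integral M (\<lambda>t \<omega>. 1 / S t \<omega> $ i) (\<lambda>t \<omega>. S t \<omega> $ i) t (\<lambda>\<omega>. R t \<omega> $ i))"

text \<open>\<open>dS = diag(S) (a dt + Sig dB)\<close> with a constant matrix \<open>Sig\<close>. The equation is required almost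
  surely for each \<open>t\<close>; for continuous \<open>S\<close> this is the same as indistinguishability.\<close>

definition solves_market_sde ::
  "'w measure \<Rightarrow> real \<Rightarrow> (real \<Rightarrow> 'w \<Rightarrow> real^'d) \<Rightarrow> real^'m^'d \<Rightarrow>
   (real \<Rightarrow> 'w \<Rightarrow> real^'m) \<Rightarrow> (real \<Rightarrow> 'w \<Rightarrow> real^'d) \<Rightarrow> bool" where
  "solves_market_sde M T a Sig B S \<longleftrightarrow>
     (\<forall>t\<in>{0..T}. \<forall>i. \<exists>Z :: 'm \<Rightarrow> 'w \<Rightarrow> real.
        (\<forall>j. has_ito_integral M (\<lambda>t \<omega>. S t \<omega> $ i) (\<lambda>t \<omega>. B t \<omega> $ j) t (Z j)) \<and>
        (AE \<omega> in M. S t \<omega> $ i = S 0 \<omega> $ i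
            + (LINT u:{0..t}|lborel. S u \<omega> $ i * a u \<omega> $ i)
            + (\<Sum>j\<in>UNIV. Sig $ i $ j * Z j \<omega>)))"

definition sig_drift ::
  "('l::finite list \<Rightarrow> real \<Rightarrow> 'w \<Rightarrow> real) \<Rightarrow> nat \<Rightarrow> ('d \<Rightarrow> 'l list \<Rightarrow> real) \<Rightarrow>
   real \<Rightarrow> 'w \<Rightarrow> real^'d" where
  "sig_drift Sg K \<alpha> t \<omega> = (\<chi> i. sig_linear Sg K (\<alpha> i) t \<omega>)"

definition portfolio ::
  "'w measure \<Rightarrow> (real \<Rightarrow> 'w measure) \<Rightarrow> real \<Rightarrow>
   (real \<Rightarrow> 'w \<Rightarrow> real^'d) \<Rightarrow> (real \<Rightarrow> 'w \<Rightarrow> real^'d) \<Rightarrow> bool" where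
  "portfolio M F T R \<pi> \<longleftrightarrow>
     integrable_wrt M F T \<pi> R \<and> (\<forall>t\<in>{0..T}. \<forall>\<omega>\<in>space M. (\<Sum>i\<in>UNIV. \<pi> t \<omega> $ i) = 1)"

definition auxiliary_portfolio ::
  "'w measure \<Rightarrow> (real \<Rightarrow> 'w measure) \<Rightarrow> real \<Rightarrow>
   (real \<Rightarrow> 'w \<Rightarrow> real^'d) \<Rightarrow> (real \<Rightarrow> 'w \<Rightarrow> real^'d) \<Rightarrow> bool" where
  "auxiliary_portfolio M F T R \<tau> \<longleftrightarrow>
     portfolio M F T R \<tau> \<and> (\<exists>K. \<forall>t\<in>{0..T}. \<forall>\<omega>\<in>space M. \<forall>i. \<bar>\<tau> t \<omega> $ i\<bar> \<le> K)"

definition sig_portfolio_I ::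
  "'w measure \<Rightarrow> (real \<Rightarrow> 'w measure) \<Rightarrow> real \<Rightarrow> (real \<Rightarrow> 'w \<Rightarrow> real^'d) \<Rightarrow>
   ('l::finite list \<Rightarrow> real \<Rightarrow> 'w \<Rightarrow> real) \<Rightarrow>
   (real \<Rightarrow> 'w \<Rightarrow> real^'d) \<Rightarrow> (real \<Rightarrow> 'w \<Rightarrow> real^'d) \<Rightarrow> bool" where
  "sig_portfolio_I M F T R Sg \<tau> \<pi> \<longleftrightarrow> portfolio M F T R \<pi> \<and>
     (\<exists>L. (\<forall>i. linear_on_signature Sg (L i)) \<and>
        (\<forall>t\<in>{0..T}. \<forall>\<omega>\<in>space M. \<forall>i.
           \<pi> t \<omega> $ i = \<tau> t \<omega> $ i * (L i t \<omega> + 1 - (\<Sum>j\<in>UNIV. \<tau> t \<omega> $ j * L j t \<omega>))))"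

definition sig_portfolio_II ::
  "'w measure \<Rightarrow> (real \<Rightarrow> 'w measure) \<Rightarrow> real \<Rightarrow> (real \<Rightarrow> 'w \<Rightarrow> real^'d) \<Rightarrow>
   ('l::finite list \<Rightarrow> real \<Rightarrow> 'w \<Rightarrow> real) \<Rightarrow>
   (real \<Rightarrow> 'w \<Rightarrow> real^'d) \<Rightarrow> (real \<Rightarrow> 'w \<Rightarrow> real^'d) \<Rightarrow> bool" where
  "sig_portfolio_II M F T R Sg \<tau> \<pi> \<longleftrightarrow> portfolio M F T R \<pi> \<and>
     (\<exists>L. (\<forall>i. linear_on_signature Sg (L i)) \<and>
        (\<forall>t\<in>{0..T}. \<forall>\<omega>\<in>space M. \<forall>i.
           \<pi> t \<omega> $ i = L i t \<omega> + \<tau> t \<omega> $ i * (1 - (\<Sum>j\<in>UNIV. L j t \<omega>))))"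

definition growth_rate ::
  "(real \<Rightarrow> 'w \<Rightarrow> real^'d) \<Rightarrow> real^'m^'d \<Rightarrow> (real \<Rightarrow> 'w \<Rightarrow> real^'d) \<Rightarrow> real \<Rightarrow> 'w \<Rightarrow> real" where
  "growth_rate a Sig \<pi> t \<omega> =
     \<pi> t \<omega> \<bullet> a t \<omega> - (1/2) * (\<pi> t \<omega> \<bullet> ((Sig ** transpose Sig) *v \<pi> t \<omega>))"

definition dt_prod :: "'w measure \<Rightarrow> real \<Rightarrow> (real \<times> 'w) measure" where
  "dt_prod M T = restrict_space lborel {0..T} \<Otimes>\<^sub>M M"

text \<open>Growth rates are compared, and the growth-optimal portfolio is unique, up to null sets of
  \<open>dt \<otimes> P\<close> on \<open>[0,T] \<times> \<Omega>\<close>.\<close>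

definition growth_optimal ::
  "'w measure \<Rightarrow> (real \<Rightarrow> 'w measure) \<Rightarrow> real \<Rightarrow> (real \<Rightarrow> 'w \<Rightarrow> real^'d) \<Rightarrow>
   (real \<Rightarrow> 'w \<Rightarrow> real^'d) \<Rightarrow> real^'m^'d \<Rightarrow> (real \<Rightarrow> 'w \<Rightarrow> real^'d) \<Rightarrow> bool" where
  "growth_optimal M F T R a Sig \<pi> \<longleftrightarrow> portfolio M F T R \<pi> \<and>
     (\<forall>\<rho>. portfolio M F T R \<rho> \<longrightarrow>
        (AE (t, \<omega>) in dt_prod M T. growth_rate a Sig \<rho> t \<omega> \<le> growth_rate a Sig \<pi> t \<omega>))"

end

theory Submission
  imports Defs
begin

text \<open>For a fixed drift vector the growth rate is a strictly concave quadratic function of the portfolio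
  weights, so its maximiser over the hyperplane of weights with sum \<open>1\<close> is an affine function of the
  drift. With a drift that is linear on the signature the maximiser is therefore linear on the signature
  as well. Its weights \<open>L\<^sup>i\<close> sum to \<open>1\<close>, so they represent it as a portfolio of type II for every \<open>\<tau>\<close>,
  while \<open>L\<^sup>i / c\<^sup>i\<close> represents it as one of type I for a constant \<open>\<tau> = c\<close>.

  What remains is that this process may be used as a portfolio, that is, that it is integrable with
  respect to \<open>R\<close>. This rests on the decomposition \<open>R = \<integral> a dt + \<Sigma> B\<close>, the associativity
  \<open>\<integral> S\<^sup>-\<^sup>1 d(\<integral> S dB) = B\<close> of the Ito integral. Along a uniform partition, the difference of the two sides is
  the limit of sums over refinements whose integrands \<open>S\<^sub>r / S\<^sub>u - 1\<close> are uniformly small with high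
  probability, and such sums are small by the \<open>L\<^sup>2\<close> bound for martingale differences.\<close>

section \<open>Convergence in probability along fine partitions\<close>

text \<open>The definitions give a stochastic integral only as a limit in probability of sums,
  separately for each time, so associativity has to be obtained from the sums themselves. Two grids
  are needed: a coarse one with \<open>n\<close> steps, on which \<open>S\<close> is divided out,
  and a refinement with \<open>m\<close> steps inside each coarse step, on which the integrals of
  \<open>S\<close> against \<open>B\<close> are approximated. No interchange of limits occurs. The
  bad event for the ratios is taken over all \<open>m\<close> at once, and the second moment bound
  depends on the elapsed time but not on the number of points, so for each large \<open>n\<close> a
  single \<open>m\<close>, chosen after \<open>n\<close>, suffices.

  Integrability asks for explicit processes \<open>N\<close>, \<open>A\<close> and \<open>C\<close>,
  which is why \<open>R\<close> has to be identified. Its drift and covariation have continuous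
  densities in time, so every process with continuous adapted components turns out to be integrable.
  Optimality holds at every time and outcome; null sets of \<open>dt_prod\<close> come in only when
  an arbitrary optimal portfolio is compared with the constructed one.\<close>

text \<open>A general filter lets fine partitions, sequences of uniform grids and refinements share
  one calculus. As in \<open>limit_of_sums\<close>, one threshold serves for the deviation and for
  its probability. Measurability is asked only eventually, because sums over points outside
  \<open>{0..T}\<close> need not be measurable.\<close>

definition conv_prob ::
  "'w measure \<Rightarrow> ('i \<Rightarrow> 'w \<Rightarrow> real) \<Rightarrow> ('w \<Rightarrow> real) \<Rightarrow> 'i filter \<Rightarrow> bool" where
  "conv_prob M f Z G \<longleftrightarrow> Z \<in> borel_measurable M \<and>
     (\<forall>\<epsilon>>0. \<forall>\<^sub>F x in G. f x \<in> borel_measurable M \<and>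
        measure M {\<omega> \<in> space M. \<epsilon> < \<bar>f x \<omega> - Z \<omega>\<bar>} \<le> \<epsilon>)"

lemma conv_probD:
  "conv_prob M f Z G \<Longrightarrow> 0 < \<epsilon> \<Longrightarrow>
     \<forall>\<^sub>F x in G. f x \<in> borel_measurable M \<and> measure M {\<omega> \<in> space M. \<epsilon> < \<bar>f x \<omega> - Z \<omega>\<bar>} \<le> \<epsilon>"
  by (simp add: conv_prob_def)

lemma conv_prob_filterlim:
  assumes "conv_prob M f Z G" "filterlim g G H"
  shows "conv_prob M (\<lambda>x. f (g x)) Z H"
  using assms unfolding conv_prob_def filterlim_iff by auto

lemma conv_prob_measurable: "conv_prob M f Z G \<Longrightarrow> Z \<in> borel_measurable M"
  by (simp add: conv_prob_def)

context finite_measure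
begin

lemma conv_prob_const: "Z \<in> borel_measurable M \<Longrightarrow> conv_prob M (\<lambda>_. Z) Z G"
  by (simp add: conv_prob_def)

lemma conv_prob_add:
  assumes f: "conv_prob M f Z G" and g: "conv_prob M g W G"
  shows "conv_prob M (\<lambda>x \<omega>. f x \<omega> + g x \<omega>) (\<lambda>\<omega>. Z \<omega> + W \<omega>) G"
  unfolding conv_prob_def
proof (intro conjI allI impI)
  have [measurable]: "Z \<in> borel_measurable M" "W \<in> borel_measurable M"
    using f g by (auto simp: conv_prob_def)
  show "(\<lambda>\<omega>. Z \<omega> + W \<omega>) \<in> borel_measurable M"
    by measurable
  fix \<epsilon> :: real assume "0 < \<epsilon>"
  then have "\<epsilon>/2 > 0" by simp
  with f g have "\<forall>\<^sub>F x in G. f x \<in> borel_measurable M \<and> measure M {\<omega> \<in> space M. \<epsilon>/2 < \<bar>f x \<omega> - Z \<omega>\<bar>} \<le> \<epsilon>/2"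
    "\<forall>\<^sub>F x in G. g x \<in> borel_measurable M \<and> measure M {\<omega> \<in> space M. \<epsilon>/2 < \<bar>g x \<omega> - W \<omega>\<bar>} \<le> \<epsilon>/2"
    unfolding conv_prob_def by blast+
  then show "\<forall>\<^sub>F x in G. (\<lambda>\<omega>. f x \<omega> + g x \<omega>) \<in> borel_measurable M \<and>
      measure M {\<omega> \<in> space M. \<epsilon> < \<bar>f x \<omega> + g x \<omega> - (Z \<omega> + W \<omega>)\<bar>} \<le> \<epsilon>"
  proof eventually_elim
    case (elim x)
    then have [measurable]: "f x \<in> borel_measurable M" "g x \<in> borel_measurable M" by auto
    let ?A = "{\<omega> \<in> space M. \<epsilon>/2 < \<bar>f x \<omega> - Z \<omega>\<bar>}" and ?B = "{\<omega> \<in> space M. \<epsilon>/2 < \<bar>g x \<omega> - W \<omega>\<bar>}"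
    have "measure M {\<omega> \<in> space M. \<epsilon> < \<bar>f x \<omega> + g x \<omega> - (Z \<omega> + W \<omega>)\<bar>} \<le> measure M (?A \<union> ?B)"
      by (intro finite_measure_mono) (auto simp: abs_if split: if_splits)
    also have "\<dots> \<le> measure M ?A + measure M ?B"
      by (intro measure_Un_le) auto
    also have "\<dots> \<le> \<epsilon>" using elim by simp
    finally show ?case by simp
  qed
qed

text \<open>The sets \<open>?A n\<close> decrease to the empty set because \<open>V\<close> is real
  valued. This is how weights without a uniform bound, such as \<open>1 / Y\<close>, enter limits in
  probability.\<close>

lemma measure_large_values_small:
  fixes V :: "'a \<Rightarrow> real"
  assumes [measurable]: "V \<in> borel_measurable M" and "\<epsilon> > 0"
  obtains C where "C > 0" "measure M {\<omega> \<in> space M. C < \<bar>V \<omega>\<bar>} \<le> \<epsilon>"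
proof -
  let ?A = "\<lambda>n. {\<omega> \<in> space M. real n < \<bar>V \<omega>\<bar>}"
  have "(\<lambda>n. measure M (?A n)) \<longlonglongrightarrow> measure M (\<Inter>n. ?A n)"
    by (intro finite_Lim_measure_decseq) (auto simp: decseq_def)
  moreover have "(\<Inter>n. ?A n) = {}"
  proof (intro equals0I)
    fix \<omega> assume "\<omega> \<in> (\<Inter>n. ?A n)"
    moreover obtain n :: nat where "\<bar>V \<omega>\<bar> < n" using reals_Archimedean2 by blast
    ultimately have "real n < \<bar>V \<omega>\<bar>" by blast
    with \<open>\<bar>V \<omega>\<bar> < n\<close> show False by simp
  qed
  ultimately have "(\<lambda>n. measure M (?A n)) \<longlonglongrightarrow> 0" by simp
  then have "\<forall>\<^sub>F n in sequentially. measure M (?A n) < \<epsilon>"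
    using \<open>\<epsilon> > 0\<close> by (rule order_tendstoD)
  with eventually_gt_at_top[of 0] obtain n where "n > 0" "measure M (?A n) < \<epsilon>"
    by (metis (no_types, lifting) eventually_conj eventually_happens sequentially_bot)
  then show ?thesis by (intro that[of "real n"]) auto
qed

lemma conv_prob_mult:
  assumes f: "conv_prob M f Z G" and V [measurable]: "V \<in> borel_measurable M"
  shows "conv_prob M (\<lambda>x \<omega>. V \<omega> * f x \<omega>) (\<lambda>\<omega>. V \<omega> * Z \<omega>) G"
  unfolding conv_prob_def
proof (intro conjI allI impI)
  have [measurable]: "Z \<in> borel_measurable M"
    using f by (auto simp: conv_prob_def)
  show "(\<lambda>\<omega>. V \<omega> * Z \<omega>) \<in> borel_measurable M"
    by measurable
  fix \<epsilon> :: real assume \<epsilon>: "0 < \<epsilon>"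
  then obtain C where C: "C > 0" "measure M {\<omega> \<in> space M. C < \<bar>V \<omega>\<bar>} \<le> \<epsilon>/2"
    using measure_large_values_small[OF V, of "\<epsilon>/2"] by auto
  \<comment> \<open>The first bound leaves half of \<epsilon> for the event that \<open>V\<close>
    exceeds \<open>C\<close>; the second makes \<open>C * \<delta>\<close> at most \<epsilon> off
    both events.\<close>
  define \<delta> where "\<delta> = min (\<epsilon>/2) (\<epsilon>/C)"
  have \<delta>: "\<delta> > 0" "\<delta> \<le> \<epsilon>/2" "C * \<delta> \<le> \<epsilon>"
    using \<epsilon> C by (auto simp: \<delta>_def min_def field_simps)
  have "\<forall>\<^sub>F x in G. f x \<in> borel_measurable M \<and> measure M {\<omega> \<in> space M. \<delta> < \<bar>f x \<omega> - Z \<omega>\<bar>} \<le> \<delta>"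
    using f \<delta> unfolding conv_prob_def by blast
  then show "\<forall>\<^sub>F x in G. (\<lambda>\<omega>. V \<omega> * f x \<omega>) \<in> borel_measurable M \<and>
      measure M {\<omega> \<in> space M. \<epsilon> < \<bar>V \<omega> * f x \<omega> - V \<omega> * Z \<omega>\<bar>} \<le> \<epsilon>"
  proof eventually_elim
    case (elim x)
    then have [measurable]: "f x \<in> borel_measurable M" by auto
    let ?A = "{\<omega> \<in> space M. C < \<bar>V \<omega>\<bar>}" and ?B = "{\<omega> \<in> space M. \<delta> < \<bar>f x \<omega> - Z \<omega>\<bar>}"
    have "\<bar>V \<omega> * f x \<omega> - V \<omega> * Z \<omega>\<bar> \<le> \<epsilon>" if "\<bar>V \<omega>\<bar> \<le> C" "\<bar>f x \<omega> - Z \<omega>\<bar> \<le> \<delta>" for \<omega>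
    proof -
      have "\<bar>V \<omega> * f x \<omega> - V \<omega> * Z \<omega>\<bar> = \<bar>V \<omega>\<bar> * \<bar>f x \<omega> - Z \<omega>\<bar>"
        by (simp add: abs_mult[symmetric] algebra_simps)
      also have "\<dots> \<le> C * \<delta>" using that by (intro mult_mono) auto
      finally show ?thesis using \<delta> by simp
    qed
    then have "measure M {\<omega> \<in> space M. \<epsilon> < \<bar>V \<omega> * f x \<omega> - V \<omega> * Z \<omega>\<bar>} \<le> measure M (?A \<union> ?B)"
      by (intro finite_measure_mono) (auto simp: not_le[symmetric])
    also have "\<dots> \<le> measure M ?A + measure M ?B"
      by (intro measure_Un_le) auto
    also have "\<dots> \<le> \<epsilon>" using elim C \<delta> by simp
    finally show ?case by simp
  qed
qed

lemma conv_prob_cmult: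
  assumes "conv_prob M f Z G"
  shows "conv_prob M (\<lambda>x \<omega>. c * f x \<omega>) (\<lambda>\<omega>. c * Z \<omega>) G"
  using conv_prob_mult[OF assms, of "\<lambda>_. c"] by simp

lemma conv_prob_diff:
  assumes "conv_prob M f Z G" "conv_prob M g W G"
  shows "conv_prob M (\<lambda>x \<omega>. f x \<omega> - g x \<omega>) (\<lambda>\<omega>. Z \<omega> - W \<omega>) G"
  using conv_prob_add[OF assms(1) conv_prob_cmult[OF assms(2), of "-1"]] by simp

lemma conv_prob_sum:
  assumes "\<And>a. a \<in> A \<Longrightarrow> conv_prob M (f a) (Z a) G"
  shows "conv_prob M (\<lambda>x \<omega>. \<Sum>a\<in>A. f a x \<omega>) (\<lambda>\<omega>. \<Sum>a\<in>A. Z a \<omega>) G"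
  using assms
  by (induction A rule: infinite_finite_induct) (simp_all add: conv_prob_const conv_prob_add)

lemma conv_prob_AE_unique:
  assumes "conv_prob M f Z G" "conv_prob M f W G" "G \<noteq> bot"
  shows "AE \<omega> in M. Z \<omega> = W \<omega>"
proof -
  have c: "conv_prob M (\<lambda>x \<omega>. 0) (\<lambda>\<omega>. Z \<omega> - W \<omega>) G"
    using conv_prob_diff[OF assms(1,2)] by simp
  then have [measurable]: "(\<lambda>\<omega>. Z \<omega> - W \<omega>) \<in> borel_measurable M"
    by (simp add: conv_prob_def)
  let ?D = "\<lambda>\<epsilon>. {\<omega> \<in> space M. \<epsilon> < \<bar>Z \<omega> - W \<omega>\<bar>}"
  have [measurable]: "?D \<epsilon> \<in> sets M" for \<epsilon> by measurable
  have le: "measure M (?D \<epsilon>) \<le> \<epsilon>" if "\<epsilon> > 0" for \<epsilon>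
    using c that \<open>G \<noteq> bot\<close> by (auto simp: conv_prob_def abs_minus_commute[of "W _"])
  have z: "measure M (?D \<epsilon>) = 0" if "\<epsilon> > 0" for \<epsilon>
  proof (rule ccontr)
    assume "measure M (?D \<epsilon>) \<noteq> 0"
    then have pos: "measure M (?D \<epsilon>) > 0" by (simp add: zero_less_measure_iff)
    \<comment> \<open>A smaller threshold enlarges the set, while \<open>le\<close> bounds its
      measure by the threshold. Half of the supposed measure is therefore a contradictory
      threshold.\<close>
    define \<delta> where "\<delta> = min \<epsilon> (measure M (?D \<epsilon>) / 2)"
    have "measure M (?D \<epsilon>) \<le> measure M (?D \<delta>)"
      by (intro finite_measure_mono) (auto simp: \<delta>_def)
    also have "\<dots> \<le> \<delta>" using pos that by (intro le) (auto simp: \<delta>_def)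
    finally show False using pos by (auto simp: \<delta>_def min_def split: if_splits)
  qed
  have "AE \<omega> in M. \<forall>n. \<omega> \<notin> ?D (1 / real (Suc n))"
    unfolding AE_all_countable
  proof
    fix n show "AE \<omega> in M. \<omega> \<notin> ?D (1 / real (Suc n))"
      using z[of "1 / real (Suc n)"]
      by (intro AE_not_in) (auto simp: null_sets_def emeasure_eq_measure)
  qed
  with AE_space[of M] show ?thesis
  proof eventually_elim
    case (elim \<omega>)
    show ?case
    proof (rule ccontr)
      assume "Z \<omega> \<noteq> W \<omega>"
      then have "\<bar>Z \<omega> - W \<omega>\<bar> > 0" by simp
      then obtain n where "inverse (real (Suc n)) < \<bar>Z \<omega> - W \<omega>\<bar>"
        using reals_Archimedean by blast
      with elim show False by (auto simp: inverse_eq_divide)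
    qed
  qed
qed

text \<open>The deviation events need not decrease in \<open>n\<close>. They are enclosed in the
  events \<open>?A n\<close> of a deviation at some index from \<open>n\<close> on, which do
  decrease, and to the empty set.\<close>

lemma conv_prob_pointwise:
  assumes f [measurable]: "\<And>n. f n \<in> borel_measurable M" and Z [measurable]: "Z \<in> borel_measurable M"
    and lim: "\<And>\<omega>. \<omega> \<in> space M \<Longrightarrow> (\<lambda>n. f n \<omega>) \<longlonglongrightarrow> Z \<omega>"
  shows "conv_prob M f Z sequentially"
  unfolding conv_prob_def
proof (intro conjI allI impI Z)
  fix \<epsilon> :: real assume "0 < \<epsilon>"
  let ?A = "\<lambda>n. {\<omega> \<in> space M. \<exists>k\<ge>n. \<epsilon> < \<bar>f k \<omega> - Z \<omega>\<bar>}"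
  have "(\<lambda>n. measure M (?A n)) \<longlonglongrightarrow> measure M (\<Inter>n. ?A n)"
    by (intro finite_Lim_measure_decseq) (auto simp: decseq_def intro: order_trans)
  moreover have "(\<Inter>n. ?A n) = {}"
  proof (intro equals0I)
    fix \<omega> assume *: "\<omega> \<in> (\<Inter>n. ?A n)"
    then have "(\<lambda>n. f n \<omega>) \<longlonglongrightarrow> Z \<omega>" by (auto intro: lim)
    with \<open>0 < \<epsilon>\<close> obtain n where "\<forall>k\<ge>n. \<bar>f k \<omega> - Z \<omega>\<bar> < \<epsilon>"
      by (auto simp: LIMSEQ_iff)
    moreover have "\<omega> \<in> ?A n" using * by blast
    ultimately show False by force
  qed
  ultimately have "(\<lambda>n. measure M (?A n)) \<longlonglongrightarrow> 0" by simp
  then have "\<forall>\<^sub>F n in sequentially. measure M (?A n) < \<epsilon>"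
    using \<open>\<epsilon> > 0\<close> by (rule order_tendstoD)
  then show "\<forall>\<^sub>F n in sequentially. f n \<in> borel_measurable M \<and>
      measure M {\<omega> \<in> space M. \<epsilon> < \<bar>f n \<omega> - Z \<omega>\<bar>} \<le> \<epsilon>"
  proof eventually_elim
    case (elim n)
    have "measure M {\<omega> \<in> space M. \<epsilon> < \<bar>f n \<omega> - Z \<omega>\<bar>} \<le> measure M (?A n)"
      by (intro finite_measure_mono) auto
    with elim show ?case by simp
  qed
qed

text \<open>Serves to insert the market equation, which is known only almost surely at each time,
  into the sums over a finite grid.\<close>

lemma conv_prob_AE_cong:
  assumes f: "conv_prob M f Z G"
    and g: "\<forall>\<^sub>F x in G. g x \<in> borel_measurable M \<and> (AE \<omega> in M. g x \<omega> = f x \<omega>)"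
    and W [measurable]: "W \<in> borel_measurable M" and ZW: "AE \<omega> in M. W \<omega> = Z \<omega>"
  shows "conv_prob M g W G"
  unfolding conv_prob_def
proof (intro conjI allI impI W)
  fix \<epsilon> :: real assume "0 < \<epsilon>"
  then have "\<forall>\<^sub>F x in G. f x \<in> borel_measurable M \<and> measure M {\<omega> \<in> space M. \<epsilon> < \<bar>f x \<omega> - Z \<omega>\<bar>} \<le> \<epsilon>"
    using f unfolding conv_prob_def by blast
  with g show "\<forall>\<^sub>F x in G. g x \<in> borel_measurable M \<and> measure M {\<omega> \<in> space M. \<epsilon> < \<bar>g x \<omega> - W \<omega>\<bar>} \<le> \<epsilon>"
  proof eventually_elim
    case (elim x)
    have [measurable]: "f x \<in> borel_measurable M" "g x \<in> borel_measurable M" "Z \<in> borel_measurable M"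
      using elim f by (auto simp: conv_prob_def)
    have "measure M {\<omega> \<in> space M. \<epsilon> < \<bar>g x \<omega> - W \<omega>\<bar>} = measure M {\<omega> \<in> space M. \<epsilon> < \<bar>f x \<omega> - Z \<omega>\<bar>}"
      using elim ZW by (intro measure_eq_AE) auto
    with elim show ?case by simp
  qed
qed

lemma prob_gt_le_second_moment:
  assumes [measurable]: "f \<in> borel_measurable M" and int: "integrable M (\<lambda>\<omega>. (f \<omega>)\<^sup>2)" and "\<epsilon> > 0"
  shows "measure M {\<omega> \<in> space M. \<epsilon> < \<bar>f \<omega>\<bar>} \<le> (\<integral>\<omega>. (f \<omega>)\<^sup>2 \<partial>M) / \<epsilon>\<^sup>2"
proof -
  have "measure M {\<omega> \<in> space M. \<epsilon> < \<bar>f \<omega>\<bar>} \<le> measure M {\<omega> \<in> space M. \<epsilon>\<^sup>2 \<le> (f \<omega>)\<^sup>2}"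
    using \<open>\<epsilon> > 0\<close> by (intro finite_measure_mono) (auto simp: abs_le_square_iff[symmetric])
  also have "\<dots> \<le> (\<integral>\<omega>. (f \<omega>)\<^sup>2 \<partial>M) / \<epsilon>\<^sup>2"
    using int \<open>\<epsilon> > 0\<close> by (intro integral_Markov_inequality_measure[where A="{}"]) auto
  finally show ?thesis .
qed

lemma conv_prob_L2:
  assumes Z: "Z \<in> borel_measurable M"
    and f: "\<forall>\<^sub>F x in G. f x \<in> borel_measurable M \<and> integrable M (\<lambda>\<omega>. (f x \<omega> - Z \<omega>)\<^sup>2) \<and>
            (\<integral>\<omega>. (f x \<omega> - Z \<omega>)\<^sup>2 \<partial>M) \<le> c x"
    and c: "(c \<longlongrightarrow> 0) G"
  shows "conv_prob M f Z G"
  unfolding conv_prob_def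
proof (intro conjI allI impI Z)
  fix \<epsilon> :: real assume "0 < \<epsilon>"
  \<comment> \<open>The Chebyshev bound divides by \<open>\<epsilon>\<^sup>2\<close>, which leaves
    exactly \<epsilon>.\<close>
  then have "\<forall>\<^sub>F x in G. c x < \<epsilon> * \<epsilon>\<^sup>2" by (intro order_tendstoD[OF c]) simp
  with f show "\<forall>\<^sub>F x in G. f x \<in> borel_measurable M \<and> measure M {\<omega> \<in> space M. \<epsilon> < \<bar>f x \<omega> - Z \<omega>\<bar>} \<le> \<epsilon>"
  proof eventually_elim
    case (elim x)
    have "measure M {\<omega> \<in> space M. \<epsilon> < \<bar>f x \<omega> - Z \<omega>\<bar>} \<le> (\<integral>\<omega>. (f x \<omega> - Z \<omega>)\<^sup>2 \<partial>M) / \<epsilon>\<^sup>2"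
      using elim Z \<open>0 < \<epsilon>\<close> by (intro prob_gt_le_second_moment) auto
    also have "\<dots> \<le> \<epsilon>" using elim \<open>0 < \<epsilon>\<close> by (simp add: divide_le_eq)
    finally show ?case using elim by simp
  qed
qed

end

section \<open>Partitions of small mesh\<close>

text \<open>The mesh limit of \<open>limit_of_sums\<close> as a filter, so that passing to a
  sequence of grids is a \<open>filterlim\<close> statement. In a pair \<open>(n, p)\<close> the
  values of \<open>p\<close> beyond \<open>n\<close> are unconstrained.\<close>

definition fine_partitions :: "real \<Rightarrow> (nat \<times> (nat \<Rightarrow> real)) filter" where
  "fine_partitions t =
     (INF \<delta>\<in>{0<..}. principal {(n, p). partition_of t n p \<and> (\<forall>k<n. p (Suc k) - p k < \<delta>)})"

lemma eventually_fine_partitions: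
  "eventually P (fine_partitions t) \<longleftrightarrow>
     (\<exists>\<delta>>0. \<forall>n p. partition_of t n p \<and> (\<forall>k<n. p (Suc k) - p k < \<delta>) \<longrightarrow> P (n, p))"
  unfolding fine_partitions_def
proof (subst eventually_INF_base, goal_cases)
  case (2 a b)
  then show ?case by (intro bexI[of _ "min a b"]) (auto simp: less_imp_le)
qed (auto simp: eventually_principal)

text \<open>The assumption supplies the measurability of the sums, which \<open>conv_prob\<close>
  records and \<open>limit_of_sums\<close> does not.\<close>

lemma conv_prob_iff_limit_of_sums:
  assumes "\<And>n p. partition_of t n p \<Longrightarrow> (\<lambda>\<omega>. \<Sum>k<n. f (p k) (p (Suc k)) \<omega>) \<in> borel_measurable M"
  shows "conv_prob M (\<lambda>(n, p) \<omega>. \<Sum>k<n. f (p k) (p (Suc k)) \<omega>) Z (fine_partitions t) \<longleftrightarrow>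
         limit_of_sums M t f Z"
  using assms unfolding conv_prob_def limit_of_sums_def eventually_fine_partitions
  by (auto 0 3)

lemma filterlim_uniform_partition:
  assumes "0 \<le> t"
  shows "filterlim (\<lambda>n. (n, \<lambda>k. t * real k / real n)) (fine_partitions t) sequentially"
  unfolding filterlim_iff eventually_fine_partitions
proof (intro allI impI, elim exE conjE)
  fix P and \<delta> :: real
  assume "\<delta> > 0" and P: "\<forall>n p. partition_of t n p \<and> (\<forall>k<n. p (Suc k) - p k < \<delta>) \<longrightarrow> P (n, p)"
  have "(\<lambda>n. t / real n) \<longlonglongrightarrow> 0" by real_asymp
  then have "\<forall>\<^sub>F n in sequentially. t / real n < \<delta>" using \<open>\<delta> > 0\<close> by (rule order_tendstoD)
  with eventually_gt_at_top[of 0] show "\<forall>\<^sub>F n in sequentially. P (n, \<lambda>k. t * real k / real n)"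
  proof eventually_elim
    case (elim n)
    then show ?case using assms
      by (intro P[rule_format])
         (auto simp: partition_of_def divide_right_mono mult_left_mono diff_divide_distrib[symmetric] algebra_simps)
  qed
qed

section \<open>Martingale differences and Brownian increments\<close>

lemma partition_of_mono:
  assumes "partition_of t n p" "j \<le> k" "k \<le> n"
  shows "p j \<le> p k"
  using assms(2,3)
proof (induction k rule: dec_induct)
  case (step k)
  then have "p j \<le> p k" "p k \<le> p (Suc k)" using assms(1) by (auto simp: partition_of_def)
  then show ?case by simp
qed simp

lemma partition_of_bounds:
  assumes "partition_of t n p" "k \<le> n"
  shows "0 \<le> p k" "p k \<le> t"
  using partition_of_mono[OF assms(1), of 0 k] partition_of_mono[OF assms(1), of k n] assms
  by (auto simp: partition_of_def)

lemma partition_of_sum: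
  assumes "partition_of t n p"
  shows "(\<Sum>k<n. p (Suc k) - p k) = t"
  using assms by (simp add: sum_lessThan_telescope partition_of_def)

context prob_space
begin

text \<open>\<open>brownian_motion\<close> states independence for families of events. Preimages
  under \<open>f\<close> after \<open>D\<close> are preimages under \<open>D\<close>, so
  \<open>V\<close> and this composition are independent variables and the expectation factorises. A
  general \<open>f\<close> covers a coordinate of an increment as well as a product of two
  coordinates.\<close>

lemma indep_set_expectation_mult:
  fixes D :: "'a \<Rightarrow> 'b::topological_space" and V :: "'a \<Rightarrow> real" and f :: "'b \<Rightarrow> real"
  assumes indep: "indep_set (sets G) {D -` U \<inter> space M | U. U \<in> sets borel}"
    and G: "subalgebra M G" and D: "D \<in> borel_measurable M" and f: "f \<in> borel_measurable borel"
    and V: "V \<in> borel_measurable G" "integrable M V" and fD: "integrable M (\<lambda>\<omega>. f (D \<omega>))"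
  shows "integrable M (\<lambda>\<omega>. V \<omega> * f (D \<omega>))"
    and "(\<integral>\<omega>. V \<omega> * f (D \<omega>) \<partial>M) = (\<integral>\<omega>. V \<omega> \<partial>M) * (\<integral>\<omega>. f (D \<omega>) \<partial>M)"
proof -
  have VG: "sigma_sets (space M) {V -` A \<inter> space M | A. A \<in> sets borel} \<subseteq> sets G"
    using sets.sigma_sets_subset[of "{V -` A \<inter> space M | A. A \<in> sets borel}" G] G V(1)
    by (auto simp: subalgebra_def measurable_def)
  \<comment> \<open>The preimages under \<open>D\<close> already form a sigma-algebra, so generating
    from a subfamily does not lead out of it.\<close>
  have eq: "sets (vimage_algebra (space M) D borel) = {D -` U \<inter> space M | U. U \<in> sets borel}"
    by (simp add: sets_vimage_algebra2)
  have "{(\<lambda>\<omega>. f (D \<omega>)) -` A \<inter> space M | A. A \<in> sets borel} \<subseteq> sets (vimage_algebra (space M) D borel)"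
    unfolding eq
  proof (safe, goal_cases)
    case (1 _ A)
    then have "f -` A \<in> sets borel" using f by (metis measurable_sets_borel)
    then show ?case by (intro exI[of _ "f -` A"]) auto
  qed
  then have fDG: "sigma_sets (space M) {(\<lambda>\<omega>. f (D \<omega>)) -` A \<inter> space M | A. A \<in> sets borel} \<subseteq>
      {D -` U \<inter> space M | U. U \<in> sets borel}"
    unfolding eq[symmetric] using sets.sigma_sets_subset[of _ "vimage_algebra (space M) D borel"]
    by simp
  have "indep_var borel V borel (\<lambda>\<omega>. f (D \<omega>))"
    unfolding indep_var_eq
  proof (intro conjI)
    show "indep_set (sigma_sets (space M) {V -` A \<inter> space M | A. A \<in> sets borel})
      (sigma_sets (space M) {(\<lambda>\<omega>. f (D \<omega>)) -` A \<inter> space M | A. A \<in> sets borel})"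
      unfolding indep_sets2_eq
    proof (intro conjI ballI)
      show "sigma_sets (space M) {V -` A \<inter> space M | A. A \<in> sets borel} \<subseteq> events"
        using VG indep_setD_ev1[OF indep] by (rule order_trans)
      show "sigma_sets (space M) {(\<lambda>\<omega>. f (D \<omega>)) -` A \<inter> space M | A. A \<in> sets borel} \<subseteq> events"
        using fDG indep_setD_ev2[OF indep] by (rule order_trans)
    qed (intro indep_setD[OF indep] subsetD[OF VG] subsetD[OF fDG])
  qed (use V fD in auto)
  from indep_var_integrable[OF this V(2) fD] indep_var_lebesgue_integral[OF this V(2) fD]
  show "integrable M (\<lambda>\<omega>. V \<omega> * f (D \<omega>))"
    "(\<integral>\<omega>. V \<omega> * f (D \<omega>) \<partial>M) = (\<integral>\<omega>. V \<omega> \<partial>M) * (\<integral>\<omega>. f (D \<omega>) \<partial>M)"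
    by auto
qed

text \<open>Orthogonality of martingale differences. \<open>centered\<close> expresses a conditional
  mean of zero through test functions; it removes the cross term of each new square, since the past
  sum times \<open>h n\<close> is measurable for \<open>G n\<close>. Each weight then costs at most
  \<open>\<eta>\<^sup>2\<close>, whatever the number of terms.\<close>

lemma martingale_difference_second_moment:
  fixes G :: "nat \<Rightarrow> 'a measure" and h \<xi> :: "nat \<Rightarrow> 'a \<Rightarrow> real"
  assumes GM: "\<And>l. l \<le> N \<Longrightarrow> subalgebra M (G l)"
    and GG: "\<And>l. l < N \<Longrightarrow> subalgebra (G (Suc l)) (G l)"
    and h: "\<And>l. l < N \<Longrightarrow> h l \<in> borel_measurable (G l)"
    and h_le: "\<And>l \<omega>. l < N \<Longrightarrow> \<omega> \<in> space M \<Longrightarrow> \<bar>h l \<omega>\<bar> \<le> \<eta>"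
    and \<xi>: "\<And>l. l < N \<Longrightarrow> \<xi> l \<in> borel_measurable (G (Suc l))"
    and \<xi>2: "\<And>l. l < N \<Longrightarrow> integrable M (\<lambda>\<omega>. (\<xi> l \<omega>)\<^sup>2)"
    and centered: "\<And>l V. l < N \<Longrightarrow> V \<in> borel_measurable (G l) \<Longrightarrow> integrable M V \<Longrightarrow>
      integrable M (\<lambda>\<omega>. V \<omega> * \<xi> l \<omega>) \<and> (\<integral>\<omega>. V \<omega> * \<xi> l \<omega> \<partial>M) = 0"
  shows "integrable M (\<lambda>\<omega>. (\<Sum>l<N. h l \<omega> * \<xi> l \<omega>)\<^sup>2) \<and>
    (\<integral>\<omega>. (\<Sum>l<N. h l \<omega> * \<xi> l \<omega>)\<^sup>2 \<partial>M) \<le> \<eta>\<^sup>2 * (\<Sum>l<N. \<integral>\<omega>. (\<xi> l \<omega>)\<^sup>2 \<partial>M)"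
proof -
  define S where "S n \<omega> = (\<Sum>l<n. h l \<omega> * \<xi> l \<omega>)" for n \<omega>
  have "S n \<in> borel_measurable (G n) \<and> integrable M (\<lambda>\<omega>. (S n \<omega>)\<^sup>2) \<and>
    (\<integral>\<omega>. (S n \<omega>)\<^sup>2 \<partial>M) \<le> \<eta>\<^sup>2 * (\<Sum>l<n. \<integral>\<omega>. (\<xi> l \<omega>)\<^sup>2 \<partial>M)" if "n \<le> N" for n
    using that
  proof (induction n)
    case 0
    then show ?case by (simp add: S_def[abs_def])
  next
    case (Suc n)
    then have n: "n < N" "n \<le> N"
      and IH: "S n \<in> borel_measurable (G n)" "integrable M (\<lambda>\<omega>. (S n \<omega>)\<^sup>2)"
        "(\<integral>\<omega>. (S n \<omega>)\<^sup>2 \<partial>M) \<le> \<eta>\<^sup>2 * (\<Sum>l<n. \<integral>\<omega>. (\<xi> l \<omega>)\<^sup>2 \<partial>M)" by auto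
    have S_Suc: "S (Suc n) = (\<lambda>\<omega>. S n \<omega> + h n \<omega> * \<xi> n \<omega>)"
      by (simp add: S_def fun_eq_iff)
    have [measurable]: "S n \<in> borel_measurable M" "h n \<in> borel_measurable M" "\<xi> n \<in> borel_measurable M"
      using measurable_from_subalg[OF GM[OF n(2)]] measurable_from_subalg[OF GM[OF Suc.prems]]
        IH(1) h[OF n(1)] \<xi>[OF n(1)] by auto
    have m: "S (Suc n) \<in> borel_measurable (G (Suc n))"
      using measurable_from_subalg[OF GG[OF n(1)]] IH(1) h[OF n(1)] \<xi>[OF n(1)]
      unfolding S_Suc by (intro borel_measurable_add borel_measurable_times) auto
    have "integrable M (S n)"
      by (rule square_integrable_imp_integrable) (use IH(2) in auto)
    then have "integrable M (\<lambda>\<omega>. \<eta> * S n \<omega>)" by simp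
    have "\<bar>S n \<omega> * h n \<omega>\<bar> \<le> \<bar>\<eta> * S n \<omega>\<bar>" if "\<omega> \<in> space M" for \<omega>
    proof -
      have "\<bar>h n \<omega>\<bar> \<le> \<bar>\<eta>\<bar>" using h_le[OF n(1) that] by simp
      then have "\<bar>S n \<omega>\<bar> * \<bar>h n \<omega>\<bar> \<le> \<bar>S n \<omega>\<bar> * \<bar>\<eta>\<bar>" by (rule mult_left_mono) simp
      then show ?thesis by (simp add: abs_mult mult.commute)
    qed
    \<comment> \<open>Only the bound on \<open>h n\<close> makes this product integrable, as a test
      function for \<open>centered\<close> has to be.\<close>
    then have "integrable M (\<lambda>\<omega>. S n \<omega> * h n \<omega>)"
      by (intro Bochner_Integration.integrable_bound[OF \<open>integrable M (\<lambda>\<omega>. \<eta> * S n \<omega>)\<close>]) auto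
    then have int: "integrable M (\<lambda>\<omega>. 2 * (S n \<omega> * h n \<omega>))" by simp
    have cross: "integrable M (\<lambda>\<omega>. 2 * (S n \<omega> * h n \<omega>) * \<xi> n \<omega>) \<and>
        (\<integral>\<omega>. 2 * (S n \<omega> * h n \<omega>) * \<xi> n \<omega> \<partial>M) = 0"
      using IH(1) h[OF n(1)] int by (intro centered n) auto
    have le: "(h n \<omega> * \<xi> n \<omega>)\<^sup>2 \<le> \<eta>\<^sup>2 * (\<xi> n \<omega>)\<^sup>2" if "\<omega> \<in> space M" for \<omega>
    proof -
      have "(h n \<omega>)\<^sup>2 \<le> \<eta>\<^sup>2"
        using h_le[OF n(1) that] by (meson abs_ge_zero abs_le_square_iff abs_ge_self order_trans)
      then show ?thesis by (simp add: power_mult_distrib mult_right_mono)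
    qed
    have last: "integrable M (\<lambda>\<omega>. (h n \<omega> * \<xi> n \<omega>)\<^sup>2)"
    proof (rule Bochner_Integration.integrable_bound)
      show "integrable M (\<lambda>\<omega>. \<eta>\<^sup>2 * (\<xi> n \<omega>)\<^sup>2)" using \<xi>2[OF n(1)] by simp
    qed (use le in auto)
    have "(\<integral>\<omega>. (h n \<omega> * \<xi> n \<omega>)\<^sup>2 \<partial>M) \<le> (\<integral>\<omega>. \<eta>\<^sup>2 * (\<xi> n \<omega>)\<^sup>2 \<partial>M)"
      using last \<xi>2[OF n(1)] le by (intro integral_mono) auto
    then have last_le: "(\<integral>\<omega>. (h n \<omega> * \<xi> n \<omega>)\<^sup>2 \<partial>M) \<le> \<eta>\<^sup>2 * (\<integral>\<omega>. (\<xi> n \<omega>)\<^sup>2 \<partial>M)" by simp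
    have sq: "(\<lambda>\<omega>. (S (Suc n) \<omega>)\<^sup>2) =
        (\<lambda>\<omega>. (S n \<omega>)\<^sup>2 + 2 * (S n \<omega> * h n \<omega>) * \<xi> n \<omega> + (h n \<omega> * \<xi> n \<omega>)\<^sup>2)"
      by (auto simp: S_Suc fun_eq_iff power2_eq_square algebra_simps)
    have "(\<integral>\<omega>. (S (Suc n) \<omega>)\<^sup>2 \<partial>M) = (\<integral>\<omega>. (S n \<omega>)\<^sup>2 \<partial>M) + (\<integral>\<omega>. (h n \<omega> * \<xi> n \<omega>)\<^sup>2 \<partial>M)"
      unfolding sq using IH(2) cross last by simp
    also have "\<dots> \<le> \<eta>\<^sup>2 * (\<Sum>l<Suc n. \<integral>\<omega>. (\<xi> l \<omega>)\<^sup>2 \<partial>M)"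
      using IH(3) last_le by (simp add: distrib_left)
    finally show ?case using m IH(2) cross last by (simp add: sq)
  qed
  then show ?thesis by (simp add: S_def)
qed

end

section \<open>Filtered spaces and the increments of Brownian motion\<close>

locale filtered_space = prob_space M for M :: "'w measure" +
  fixes F :: "real \<Rightarrow> 'w measure" and T :: real
  assumes filtered: "filtered_prob_space M F T"
begin

lemma T_pos: "0 < T"
  using filtered by (simp add: filtered_prob_space_def)

lemma subalg: "subalgebra M (F t)"
  using filtered by (simp add: filtered_prob_space_def)

lemma space_F: "space (F t) = space M"
  using subalg by (simp add: subalgebra_def)

lemma subalg_mono: "s \<le> t \<Longrightarrow> subalgebra (F t) (F s)"
  using filtered filtration.sets_F_mono[of "space M" F s t]
  by (auto simp: filtered_prob_space_def subalgebra_def space_F)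

lemma measurable_F_mono: "f \<in> measurable (F s) N \<Longrightarrow> s \<le> t \<Longrightarrow> f \<in> measurable (F t) N"
  using measurable_from_subalg subalg_mono by blast

lemma measurable_F_M: "f \<in> measurable (F s) N \<Longrightarrow> f \<in> measurable M N"
  using measurable_from_subalg subalg by blast

end

locale brownian = filtered_space M F T for M :: "'w measure" and F T +
  fixes B :: "real \<Rightarrow> 'w \<Rightarrow> real^'m"
  assumes bm: "brownian_motion M F T B"
begin

lemma B_adapted: "t \<in> {0..T} \<Longrightarrow> B t \<in> borel_measurable (F t)"
  using bm by (simp add: brownian_motion_def continuous_adapted_def)

lemma B_component_adapted:
  assumes "t \<in> {0..T}" "t \<le> u"
  shows "(\<lambda>\<omega>. B t \<omega> $ j) \<in> borel_measurable (F u)"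
  using measurable_F_mono[OF B_adapted[OF assms(1)] assms(2)]
  by (rule borel_measurable_continuous_on[rotated]) (intro continuous_intros)

lemma B_component_measurable: "t \<in> {0..T} \<Longrightarrow> (\<lambda>\<omega>. B t \<omega> $ j) \<in> borel_measurable M"
  using measurable_F_M[OF B_component_adapted[of t t]] by simp

lemma B_continuous: "\<omega> \<in> space M \<Longrightarrow> continuous_on {0..T} (\<lambda>t. B t \<omega> $ j)"
  using bm by (intro continuous_intros) (auto simp: brownian_motion_def continuous_adapted_def)

lemma increment_centered:
  fixes f :: "real^'m \<Rightarrow> real" and V :: "'w \<Rightarrow> real"
  assumes st: "0 \<le> s" "s \<le> t" "t \<le> T"
    and f: "f \<in> borel_measurable borel"
    and int: "integrable M (\<lambda>\<omega>. f (B t \<omega> - B s \<omega>))" "(\<integral>\<omega>. f (B t \<omega> - B s \<omega>) \<partial>M) = 0"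
    and V: "V \<in> borel_measurable (F s)" "integrable M V"
  shows "integrable M (\<lambda>\<omega>. V \<omega> * f (B t \<omega> - B s \<omega>)) \<and> (\<integral>\<omega>. V \<omega> * f (B t \<omega> - B s \<omega>) \<partial>M) = 0"
proof (cases "s = t")
  case True
  \<comment> \<open>Partitions may repeat points, whereas independence is given only for
    \<open>s < t\<close>. Here the increment vanishes, so \<open>f\<close> of it is a constant with
    mean zero, hence zero.\<close>
  with int(2) show ?thesis by (simp add: prob_space)
next
  case False
  with st bm have "indep_set (sets (F s)) {(\<lambda>\<omega>. B t \<omega> - B s \<omega>) -` U \<inter> space M | U. U \<in> sets borel}"
    by (auto simp: brownian_motion_def)
  moreover have "(\<lambda>\<omega>. B t \<omega> - B s \<omega>) \<in> borel_measurable M"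
    using st measurable_F_M[OF B_adapted] by (intro borel_measurable_diff) auto
  ultimately show ?thesis
    using indep_set_expectation_mult[OF _ subalg _ f V int(1)] int(2) by simp
qed

text \<open>The fourth moment is there because products of increments appear squared in the second
  moment argument for the covariation.\<close>

lemma increment_moments:
  assumes st: "0 \<le> s" "s \<le> t" "t \<le> T"
  shows "integrable M (\<lambda>\<omega>. (B t \<omega> $ j - B s \<omega> $ j) ^ k)"
    and "(\<integral>\<omega>. (B t \<omega> $ j - B s \<omega> $ j) \<partial>M) = 0"
    and "(\<integral>\<omega>. (B t \<omega> $ j - B s \<omega> $ j) ^ 2 \<partial>M) = t - s"
    and "(\<integral>\<omega>. (B t \<omega> $ j - B s \<omega> $ j) ^ 4 \<partial>M) = 3 * (t - s)\<^sup>2"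
proof -
  have "integrable M (\<lambda>\<omega>. (B t \<omega> $ j - B s \<omega> $ j) ^ k) \<and> (\<integral>\<omega>. (B t \<omega> $ j - B s \<omega> $ j) \<partial>M) = 0 \<and>
    (\<integral>\<omega>. (B t \<omega> $ j - B s \<omega> $ j) ^ 2 \<partial>M) = t - s \<and>
    (\<integral>\<omega>. (B t \<omega> $ j - B s \<omega> $ j) ^ 4 \<partial>M) = 3 * (t - s)\<^sup>2"
  proof (cases "s = t")
    case False
    with st bm have d: "distributed M lborel (\<lambda>\<omega>. B t \<omega> $ j - B s \<omega> $ j) (normal_density 0 (sqrt (t - s)))"
      by (auto simp: brownian_motion_def)
    have pos: "sqrt (t - s) > 0" using False st by simp
    note I = distributed_integral[OF d, symmetric]
    have "integrable M (\<lambda>\<omega>. (B t \<omega> $ j - B s \<omega> $ j) ^ k)"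
      using integrable_normal_moment[OF pos, of 0 k] by (subst distributed_integrable[OF d, symmetric]) auto
    moreover have "(\<integral>\<omega>. (B t \<omega> $ j - B s \<omega> $ j) \<partial>M) = 0"
      using integral_normal_moment_nz_1[OF pos, of 0] I[of "\<lambda>x. x"] by simp
    moreover have "(\<integral>\<omega>. (B t \<omega> $ j - B s \<omega> $ j) ^ 2 \<partial>M) = t - s"
      using integral_normal_moment_even[OF pos, of 0 1] I[of "\<lambda>x. x ^ 2"] st by simp
    moreover have "(\<integral>\<omega>. (B t \<omega> $ j - B s \<omega> $ j) ^ 4 \<partial>M) = 3 * (t - s)\<^sup>2"
      using integral_normal_moment_even[OF pos, of 0 2] I[of "\<lambda>x. x ^ 4"] st
      by (simp add: fact_numeral power_divide)
    ultimately show ?thesis by blast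
  qed (use st in \<open>cases k; simp\<close>)
  then show "integrable M (\<lambda>\<omega>. (B t \<omega> $ j - B s \<omega> $ j) ^ k)"
    "(\<integral>\<omega>. (B t \<omega> $ j - B s \<omega> $ j) \<partial>M) = 0"
    "(\<integral>\<omega>. (B t \<omega> $ j - B s \<omega> $ j) ^ 2 \<partial>M) = t - s"
    "(\<integral>\<omega>. (B t \<omega> $ j - B s \<omega> $ j) ^ 4 \<partial>M) = 3 * (t - s)\<^sup>2" by auto
qed

lemma increment_product_expectation:
  assumes st: "0 \<le> s" "s \<le> t" "t \<le> T"
  shows "integrable M (\<lambda>\<omega>. (B t \<omega> $ a - B s \<omega> $ a) * (B t \<omega> $ b - B s \<omega> $ b))"
    and "(\<integral>\<omega>. (B t \<omega> $ a - B s \<omega> $ a) * (B t \<omega> $ b - B s \<omega> $ b) \<partial>M) = (if a = b then t - s else 0)"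
proof -
  have "integrable M (\<lambda>\<omega>. (B t \<omega> $ a - B s \<omega> $ a) * (B t \<omega> $ b - B s \<omega> $ b)) \<and>
    (\<integral>\<omega>. (B t \<omega> $ a - B s \<omega> $ a) * (B t \<omega> $ b - B s \<omega> $ b) \<partial>M) = (if a = b then t - s else 0)"
  proof (cases "a = b \<or> s = t")
    case True
    then show ?thesis
      using increment_moments(1)[OF st, of a 2] increment_moments(3)[OF st, of a] by (auto simp: power2_eq_square)
  next
    case False
    with st bm have "indep_vars (\<lambda>_. borel) (\<lambda>j \<omega>. B t \<omega> $ j - B s \<omega> $ j) UNIV"
      by (auto simp: brownian_motion_def)
    from indep_vars_subset[OF this, of "{a, b}"]
    have i: "indep_vars (\<lambda>_. borel) (\<lambda>j \<omega>. B t \<omega> $ j - B s \<omega> $ j) {a, b}" by simp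
    show ?thesis
      using indep_vars_lebesgue_integral[OF _ i] indep_vars_integrable[OF _ i] False
        increment_moments(1)[OF st, of _ 1] increment_moments(2)[OF st]
      by auto
  qed
  then show "integrable M (\<lambda>\<omega>. (B t \<omega> $ a - B s \<omega> $ a) * (B t \<omega> $ b - B s \<omega> $ b))"
    "(\<integral>\<omega>. (B t \<omega> $ a - B s \<omega> $ a) * (B t \<omega> $ b - B s \<omega> $ b) \<partial>M) = (if a = b then t - s else 0)"
    by auto
qed

text \<open>The constant is 8 = 3 + 3 + 2: the two fourth moments and twice the square of the mean.
  It is the same for \<open>a = b\<close> and for distinct coordinates.\<close>

lemma increment_product_variance:
  fixes a b :: 'm
  assumes st: "0 \<le> s" "s \<le> t" "t \<le> T"
  defines "\<xi> \<equiv> \<lambda>\<omega>. (B t \<omega> $ a - B s \<omega> $ a) * (B t \<omega> $ b - B s \<omega> $ b) - (if a = b then t - s else 0)"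
  shows "integrable M (\<lambda>\<omega>. (\<xi> \<omega>)\<^sup>2)" and "(\<integral>\<omega>. (\<xi> \<omega>)\<^sup>2 \<partial>M) \<le> 8 * (t - s)\<^sup>2"
proof -
  have [measurable]: "(\<lambda>\<omega>. B t \<omega> $ j) \<in> borel_measurable M" "(\<lambda>\<omega>. B s \<omega> $ j) \<in> borel_measurable M" for j
    using st by (auto intro: B_component_measurable)
  let ?W = "\<lambda>\<omega>. (B t \<omega> $ a - B s \<omega> $ a) ^ 4 + (B t \<omega> $ b - B s \<omega> $ b) ^ 4 + 2 * (t - s)\<^sup>2"
  have iW: "integrable M ?W"
    using increment_moments(1)[OF st, of _ 4] by simp
  \<comment> \<open>The right side minus the left side is
    \<open>(x * y + d)\<^sup>2 + (x\<^sup>2 - y\<^sup>2)\<^sup>2\<close>.\<close>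
  have key: "(x * y - d)\<^sup>2 \<le> x ^ 4 + y ^ 4 + 2 * d\<^sup>2" for x y d :: real
  proof -
    have "0 \<le> (x * y + d)\<^sup>2 + (x\<^sup>2 - y\<^sup>2)\<^sup>2" by simp
    then show ?thesis by (simp add: power2_eq_square algebra_simps power4_eq_xxxx)
  qed
  have le: "(\<xi> \<omega>)\<^sup>2 \<le> ?W \<omega>" for \<omega>
    unfolding \<xi>_def
    using key[of "B t \<omega> $ a - B s \<omega> $ a" "B t \<omega> $ b - B s \<omega> $ b" "if a = b then t - s else 0"]
    by (rule order_trans) auto
  show i: "integrable M (\<lambda>\<omega>. (\<xi> \<omega>)\<^sup>2)"
    by (rule Bochner_Integration.integrable_bound[OF iW])
       (use le in \<open>auto simp: \<xi>_def intro!: AE_I2 intro: order_trans abs_ge_self\<close>)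
  have "(\<integral>\<omega>. (\<xi> \<omega>)\<^sup>2 \<partial>M) \<le> (\<integral>\<omega>. ?W \<omega> \<partial>M)"
    using i iW le by (intro integral_mono) auto
  also have "\<dots> = 8 * (t - s)\<^sup>2"
    using increment_moments(1)[OF st, of _ 4] increment_moments(4)[OF st]
    by (simp add: prob_space)
  finally show "(\<integral>\<omega>. (\<xi> \<omega>)\<^sup>2 \<partial>M) \<le> 8 * (t - s)\<^sup>2" .
qed

text \<open>Products of increments minus their means are martingale differences, and the bounds on
  their second moments add up to at most \<open>8 * t\<close> times the mesh.\<close>

lemma brownian_covariation:
  assumes t: "t \<in> {0..T}"
  shows "has_covariation M (\<lambda>t \<omega>. B t \<omega> $ a) (\<lambda>t \<omega>. B t \<omega> $ b) t (\<lambda>\<omega>. if a = b then t else 0)"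
  unfolding has_covariation_def
proof (subst conv_prob_iff_limit_of_sums[symmetric], goal_cases)
  case (1 n p)
  have "p k \<in> {0..T}" if "k \<le> n" for k
    using partition_of_bounds[OF 1 that] t by auto
  then show ?case
    by (intro borel_measurable_sum borel_measurable_times borel_measurable_diff B_component_measurable) auto
next
  case 2
  show ?case
  proof (rule conv_prob_L2[where c="\<lambda>(n, p). \<Sum>k<n. 8 * (p (Suc k) - p k)\<^sup>2"])
    have bound: "(\<Sum>k<n. (p (Suc k) - p k)\<^sup>2) \<le> \<delta> * t"
      if "partition_of t n p" "\<forall>k<n. p (Suc k) - p k < \<delta>" for n p \<delta>
    proof -
      have "(\<Sum>k<n. (p (Suc k) - p k)\<^sup>2) \<le> (\<Sum>k<n. \<delta> * (p (Suc k) - p k))"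
        unfolding power2_eq_square
        using that by (intro sum_mono mult_right_mono) (auto simp: partition_of_def less_imp_le)
      then show ?thesis using partition_of_sum[OF that(1)] by (simp add: sum_distrib_left[symmetric])
    qed
    show "((\<lambda>(n, p). \<Sum>k<n. 8 * (p (Suc k) - p k)\<^sup>2) \<longlongrightarrow> 0) (fine_partitions t)"
    proof (rule tendstoI)
      fix \<epsilon> :: real assume \<epsilon>: "\<epsilon> > 0"
      \<comment> \<open>The added 1 keeps the denominator positive at \<open>t = 0\<close> and makes
        the resulting inequality strict.\<close>
      define \<delta> where "\<delta> = \<epsilon> / (8 * t + 1)"
      have \<delta>: "\<delta> > 0" "8 * (\<delta> * t) < \<epsilon>" using \<epsilon> t by (auto simp: \<delta>_def field_simps)
      show "\<forall>\<^sub>F x in fine_partitions t. dist (case x of (n, p) \<Rightarrow> \<Sum>k<n. 8 * (p (Suc k) - p k)\<^sup>2) 0 < \<epsilon>"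
        unfolding eventually_fine_partitions
      proof (intro exI[of _ \<delta>] conjI \<delta> allI impI)
        fix n p assume "partition_of t n p \<and> (\<forall>k<n. p (Suc k) - p k < \<delta>)"
        then have "(\<Sum>k<n. (p (Suc k) - p k)\<^sup>2) \<le> \<delta> * t" using bound by blast
        with \<delta> show "dist (case (n, p) of (n, p) \<Rightarrow> \<Sum>k<n. 8 * (p (Suc k) - p k)\<^sup>2) 0 < \<epsilon>"
          by (simp add: sum_distrib_left[symmetric] sum_nonneg)
      qed
    qed
    show "\<forall>\<^sub>F x in fine_partitions t.
      (case x of (n, p) \<Rightarrow> \<lambda>\<omega>. \<Sum>k<n. (B (p (Suc k)) \<omega> $ a - B (p k) \<omega> $ a) * (B (p (Suc k)) \<omega> $ b - B (p k) \<omega> $ b)) \<in> borel_measurable M \<and>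
      integrable M (\<lambda>\<omega>. ((case x of (n, p) \<Rightarrow> \<lambda>\<omega>. \<Sum>k<n. (B (p (Suc k)) \<omega> $ a - B (p k) \<omega> $ a) * (B (p (Suc k)) \<omega> $ b - B (p k) \<omega> $ b)) \<omega> - (if a = b then t else 0))\<^sup>2) \<and>
      (\<integral>\<omega>. ((case x of (n, p) \<Rightarrow> \<lambda>\<omega>. \<Sum>k<n. (B (p (Suc k)) \<omega> $ a - B (p k) \<omega> $ a) * (B (p (Suc k)) \<omega> $ b - B (p k) \<omega> $ b)) \<omega> - (if a = b then t else 0))\<^sup>2 \<partial>M)
        \<le> (case x of (n, p) \<Rightarrow> \<Sum>k<n. 8 * (p (Suc k) - p k)\<^sup>2)"
      unfolding eventually_fine_partitions prod.case
    proof (intro exI[of _ 1] conjI[OF zero_less_one] allI impI, elim conjE, intro conjI)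
      fix n p assume p: "partition_of t n p"
      have pk: "0 \<le> p k" "p k \<le> p (Suc k)" "p (Suc k) \<le> T" "p k \<le> T" if "k < n" for k
        using that partition_of_bounds[OF p, of k] partition_of_bounds[OF p, of "Suc k"] t p
        by (auto simp: partition_of_def)
      define \<xi> where "\<xi> k \<omega> = (B (p (Suc k)) \<omega> $ a - B (p k) \<omega> $ a) * (B (p (Suc k)) \<omega> $ b - B (p k) \<omega> $ b)
          - (if a = b then p (Suc k) - p k else 0)" for k \<omega>
      \<comment> \<open>The means add up to the subtracted limit. The factor 1 is the weight
        \<open>h\<close> of \<open>martingale_difference_second_moment\<close>.\<close>
      have eq: "(\<Sum>k<n. (B (p (Suc k)) \<omega> $ a - B (p k) \<omega> $ a) * (B (p (Suc k)) \<omega> $ b - B (p k) \<omega> $ b))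
          - (if a = b then t else 0) = (\<Sum>k<n. 1 * \<xi> k \<omega>)" for \<omega>
        using partition_of_sum[OF p] by (auto simp: \<xi>_def sum_subtractf)
      have "integrable M (\<lambda>\<omega>. (\<Sum>k<n. 1 * \<xi> k \<omega>)\<^sup>2) \<and>
          (\<integral>\<omega>. (\<Sum>k<n. 1 * \<xi> k \<omega>)\<^sup>2 \<partial>M) \<le> 1\<^sup>2 * (\<Sum>k<n. \<integral>\<omega>. (\<xi> k \<omega>)\<^sup>2 \<partial>M)"
      proof (rule martingale_difference_second_moment[where G="\<lambda>k. F (p k)"])
        fix k assume k: "k < n"
        show "\<xi> k \<in> borel_measurable (F (p (Suc k)))"
          unfolding \<xi>_def[abs_def] using pk[OF k]
          by (intro borel_measurable_times borel_measurable_diff B_component_adapted borel_measurable_const) auto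
        show "integrable M (\<lambda>\<omega>. (\<xi> k \<omega>)\<^sup>2)"
          unfolding \<xi>_def using pk[OF k] by (intro increment_product_variance) auto
        fix V :: "'w \<Rightarrow> real" assume V: "V \<in> borel_measurable (F (p k))" "integrable M V"
        have "(\<integral>\<omega>. \<xi> k \<omega> \<partial>M) = 0" "integrable M (\<xi> k)"
          using increment_product_expectation[OF pk(1-3)[OF k], of a b] unfolding \<xi>_def[abs_def]
          by (auto simp: prob_space)
        then show "integrable M (\<lambda>\<omega>. V \<omega> * \<xi> k \<omega>) \<and> (\<integral>\<omega>. V \<omega> * \<xi> k \<omega> \<partial>M) = 0"
          using increment_centered[OF pk(1-3)[OF k],
              of "\<lambda>x. x $ a * x $ b - (if a = b then p (Suc k) - p k else 0)" V] V
          by (simp add: \<xi>_def[abs_def] borel_measurable_continuous_onI continuous_intros)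
      qed (use pk subalg subalg_mono in auto)
      moreover have "(\<Sum>k<n. \<integral>\<omega>. (\<xi> k \<omega>)\<^sup>2 \<partial>M) \<le> (\<Sum>k<n. 8 * (p (Suc k) - p k)\<^sup>2)"
        unfolding \<xi>_def by (intro sum_mono increment_product_variance pk) auto
      ultimately show "integrable M (\<lambda>\<omega>. ((\<Sum>k<n. (B (p (Suc k)) \<omega> $ a - B (p k) \<omega> $ a) * (B (p (Suc k)) \<omega> $ b - B (p k) \<omega> $ b)) - (if a = b then t else 0))\<^sup>2)"
        "(\<integral>\<omega>. ((\<Sum>k<n. (B (p (Suc k)) \<omega> $ a - B (p k) \<omega> $ a) * (B (p (Suc k)) \<omega> $ b - B (p k) \<omega> $ b)) - (if a = b then t else 0))\<^sup>2 \<partial>M)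
          \<le> (\<Sum>k<n. 8 * (p (Suc k) - p k)\<^sup>2)"
        unfolding eq by auto
      show "(\<lambda>\<omega>. \<Sum>k<n. (B (p (Suc k)) \<omega> $ a - B (p k) \<omega> $ a) * (B (p (Suc k)) \<omega> $ b - B (p k) \<omega> $ b)) \<in> borel_measurable M"
        using pk by (intro borel_measurable_sum borel_measurable_times borel_measurable_diff B_component_measurable)
          (auto intro: order_trans)
    qed
  qed simp
qed

text \<open>\<open>B 0\<close> is subtracted because it vanishes only almost surely, while
  \<open>semimartingale_decomposition\<close> wants a martingale part that starts at 0 at every
  outcome. The conditional expectation is checked on indicators of events of \<open>F s\<close>,
  which are test functions for \<open>increment_centered\<close>.\<close>

lemma component_martingale: "martingale M F T (\<lambda>t \<omega>. B t \<omega> $ j - B 0 \<omega> $ j)"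
  unfolding martingale_def
proof (intro conjI ballI)
  fix s assume s: "s \<in> {0..T}"
  show "(\<lambda>\<omega>. B s \<omega> $ j - B 0 \<omega> $ j) \<in> borel_measurable (F s)"
    using s T_pos by (intro borel_measurable_diff B_component_adapted) auto
  show "integrable M (\<lambda>\<omega>. B s \<omega> $ j - B 0 \<omega> $ j)"
    using increment_moments(1)[of 0 s j 1] s by simp
  fix t assume t: "t \<in> {s..T}"
  interpret finite_measure_subalgebra M "F s"
    by unfold_locales (rule subalg)
  show "AE \<omega> in M. real_cond_exp M (F s) (\<lambda>\<omega>. B t \<omega> $ j - B 0 \<omega> $ j) \<omega> = B s \<omega> $ j - B 0 \<omega> $ j"
  proof (rule real_cond_exp_charact)
    show i: "integrable M (\<lambda>\<omega>. B t \<omega> $ j - B 0 \<omega> $ j)" "integrable M (\<lambda>\<omega>. B s \<omega> $ j - B 0 \<omega> $ j)"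
      using increment_moments(1)[of 0 _ j 1] s t by simp_all
    show "(\<lambda>\<omega>. B s \<omega> $ j - B 0 \<omega> $ j) \<in> borel_measurable (F s)"
      using s T_pos by (intro borel_measurable_diff B_component_adapted) auto
    fix A assume A: "A \<in> sets (F s)"
    then have AM: "A \<in> sets M" using subalg by (auto simp: subalgebra_def)
    have "(\<integral>\<omega>. indicator A \<omega> * (B t \<omega> $ j - B s \<omega> $ j) \<partial>M) = 0"
      using increment_centered[of s t "\<lambda>x. x $ j" "indicator A"] s t A AM
        increment_moments(1)[of s t j 1] increment_moments(2)[of s t j]
      by (simp add: less_top[symmetric])
    moreover have "indicator A \<omega> * (B t \<omega> $ j - B s \<omega> $ j) =
        indicator A \<omega> * (B t \<omega> $ j - B 0 \<omega> $ j) - indicator A \<omega> * (B s \<omega> $ j - B 0 \<omega> $ j)" for \<omega>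
      by (simp add: right_diff_distrib[symmetric])
    moreover have ind: "integrable M (\<lambda>\<omega>. indicator A \<omega> * X \<omega>)" if "integrable M X" for X :: "'w \<Rightarrow> real"
      using integrable_real_mult_indicator[OF AM that] by (subst mult.commute)
    ultimately show "(LINT \<omega>:A|M. B t \<omega> $ j - B 0 \<omega> $ j) = (LINT \<omega>:A|M. B s \<omega> $ j - B 0 \<omega> $ j)"
      using Bochner_Integration.integral_diff[OF ind[OF i(1)] ind[OF i(2)]]
      by (simp add: set_lebesgue_integral_def)
  qed
qed

end

section \<open>Riemann sums, predictability and finite variation\<close>

lemma partition_of_integral_sum:
  fixes f :: "real \<Rightarrow> real"
  assumes p: "partition_of t n p" and f: "f integrable_on {0..t}"
  shows "(\<Sum>k<n. integral {p k..p (Suc k)} f) = integral {0..t} f"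
proof -
  have "(\<Sum>k<m. integral {p k..p (Suc k)} f) = integral {0..p m} f" if "m \<le> n" for m
    using that
  proof (induction m)
    case 0
    then show ?case using p by (simp add: partition_of_def)
  next
    case (Suc m)
    have "0 \<le> p m" "p m \<le> p (Suc m)" "p (Suc m) \<le> t"
      using Suc.prems partition_of_bounds[OF p, of m] partition_of_bounds[OF p, of "Suc m"] p
      by (auto simp: partition_of_def)
    then have "integral {0..p m} f + integral {p m..p (Suc m)} f = integral {0..p (Suc m)} f"
      using integrable_subinterval_real[OF f, of 0 "p (Suc m)"]
      by (intro Henstock_Kurzweil_Integration.integral_combine) auto
    with Suc show ?case by simp
  qed
  from this[of n] show ?thesis using p by (simp add: partition_of_def)
qed

lemma uniform_partition:
  assumes "0 \<le> t" "0 < n"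
  shows "partition_of t n (\<lambda>k. t * real k / real n)"
    and "t * real (Suc k) / real n - t * real k / real n = t / real n"
  using assms by (auto simp: partition_of_def divide_right_mono mult_left_mono diff_divide_distrib[symmetric] algebra_simps)

text \<open>On a short step the pair \<open>(v, u)\<close> stays near the diagonal, and uniform
  continuity on the square bounds the error. Freezing only the first argument covers ordinary
  Riemann sums and also sums of a weight at the left end point against the increments of an
  integral.\<close>

lemma riemann_sum_diagonal:
  fixes \<psi> :: "real \<Rightarrow> real \<Rightarrow> real"
  assumes \<psi>: "continuous_on ({0..t} \<times> {0..t}) (\<lambda>(v, u). \<psi> v u)" and t: "0 \<le> t"
  shows "(\<lambda>n. \<Sum>k<n. integral {t * real k / real n..t * real (Suc k) / real n} (\<psi> (t * real k / real n)))
    \<longlonglongrightarrow> integral {0..t} (\<lambda>u. \<psi> u u)"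
proof (rule LIMSEQ_I)
  fix \<epsilon> :: real assume "0 < \<epsilon>"
  define \<eta> where "\<eta> = \<epsilon> / (t + 1)"
  have \<eta>: "\<eta> > 0" "\<eta> * t < \<epsilon>" using \<open>0 < \<epsilon>\<close> t by (auto simp: \<eta>_def field_simps)
  have "uniformly_continuous_on ({0..t} \<times> {0..t}) (\<lambda>(v, u). \<psi> v u)"
    using \<psi> by (intro compact_uniformly_continuous compact_Times compact_Icc)
  with \<eta>(1) obtain \<delta> where \<delta>: "\<delta> > 0" and
    uc: "\<And>x x'. x \<in> {0..t} \<times> {0..t} \<Longrightarrow> x' \<in> {0..t} \<times> {0..t} \<Longrightarrow> dist x' x < \<delta> \<Longrightarrow>
      dist ((\<lambda>(v, u). \<psi> v u) x') ((\<lambda>(v, u). \<psi> v u) x) < \<eta>"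
    unfolding uniformly_continuous_on_def by metis
  have close: "\<bar>\<psi> v u - \<psi> u u\<bar> \<le> \<eta>" if "v \<in> {0..t}" "u \<in> {0..t}" "\<bar>v - u\<bar> < \<delta>" for u v
    using uc[of "(u, u)" "(v, u)"] that by (auto simp: dist_Pair_Pair dist_real_def)
  have cont: "continuous_on {0..t} (\<psi> v)" if "v \<in> {0..t}" for v
  proof -
    have "continuous_on {0..t} (\<lambda>u. (\<lambda>(v, u). \<psi> v u) (v, u))"
      by (rule continuous_on_compose2[OF \<psi>])
         (intro continuous_on_Pair continuous_on_const continuous_on_id, use that in auto)
    then show ?thesis by simp
  qed
  have "continuous_on {0..t} (\<lambda>u. (\<lambda>(v, u). \<psi> v u) (u, u))"
    by (rule continuous_on_compose2[OF \<psi>]) (intro continuous_on_Pair continuous_on_id, auto)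
  then have diag: "continuous_on {0..t} (\<lambda>u. \<psi> u u)" by simp
  have "(\<lambda>n. t / real n) \<longlonglongrightarrow> 0" by real_asymp
  then have "\<forall>\<^sub>F n in sequentially. t / real n < \<delta>" using \<delta> by (rule order_tendstoD)
  with eventually_gt_at_top[of 0]
  have "\<forall>\<^sub>F n in sequentially. norm ((\<Sum>k<n. integral {t * real k / real n..t * real (Suc k) / real n} (\<psi> (t * real k / real n))) - integral {0..t} (\<lambda>u. \<psi> u u)) < \<epsilon>"
  proof eventually_elim
    case (elim n)
    define p where "p k = t * real k / real n" for k
    note part = uniform_partition[OF t elim(1), folded p_def]
    have slice: "\<bar>integral {p k..p (Suc k)} (\<psi> (p k)) - integral {p k..p (Suc k)} (\<lambda>u. \<psi> u u)\<bar> \<le> \<eta> * (p (Suc k) - p k)"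
      if "k < n" for k
    proof -
      have pk: "0 \<le> p k" "p k \<le> p (Suc k)" "p (Suc k) \<le> t"
        using that partition_of_bounds[OF part(1), of k] partition_of_bounds[OF part(1), of "Suc k"] part(1)
        by (auto simp: partition_of_def)
      then have sub: "{p k..p (Suc k)} \<subseteq> {0..t}" and pk0: "p k \<in> {0..t}" by auto
      have c: "continuous_on {p k..p (Suc k)} (\<psi> (p k))" "continuous_on {p k..p (Suc k)} (\<lambda>u. \<psi> u u)"
        using cont[OF pk0] diag sub by (auto intro: continuous_on_subset)
      have "norm (integral {p k..p (Suc k)} (\<lambda>u. \<psi> (p k) u - \<psi> u u)) \<le> \<eta> * (p (Suc k) - p k)"
      proof (rule integral_bound)
        fix u assume u: "u \<in> {p k..p (Suc k)}"
        then have "\<bar>p k - u\<bar> < \<delta>" using part(2)[of k] elim(2) by auto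
        then show "norm (\<psi> (p k) u - \<psi> u u) \<le> \<eta>" using close[of "p k" u] u sub pk0 by auto
      qed (use pk c in \<open>auto intro!: continuous_intros\<close>)
      then show ?thesis
        using c by (simp add: Henstock_Kurzweil_Integration.integral_diff integrable_continuous_real)
    qed
    have "\<bar>(\<Sum>k<n. integral {p k..p (Suc k)} (\<psi> (p k))) - integral {0..t} (\<lambda>u. \<psi> u u)\<bar> =
        \<bar>\<Sum>k<n. integral {p k..p (Suc k)} (\<psi> (p k)) - integral {p k..p (Suc k)} (\<lambda>u. \<psi> u u)\<bar>"
      using partition_of_integral_sum[OF part(1), of "\<lambda>u. \<psi> u u"] diag
      by (simp add: sum_subtractf integrable_continuous_real)
    also have "\<dots> \<le> (\<Sum>k<n. \<eta> * (p (Suc k) - p k))"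
      using slice by (intro order_trans[OF sum_abs] sum_mono) auto
    also have "\<dots> = \<eta> * t"
      using partition_of_sum[OF part(1)] by (simp add: sum_distrib_left[symmetric])
    finally show ?case using \<eta>(2) by (simp add: p_def)
  qed
  then show "\<exists>no. \<forall>n\<ge>no. norm ((\<Sum>k<n. integral {t * real k / real n..t * real (Suc k) / real n} (\<psi> (t * real k / real n))) - integral {0..t} (\<lambda>u. \<psi> u u)) < \<epsilon>"
    by (simp add: eventually_sequentially)
qed

lemma riemann_sum_tendsto:
  fixes f :: "real \<Rightarrow> real"
  assumes f: "continuous_on {0..t} f" and t: "0 \<le> t"
  shows "(\<lambda>n. \<Sum>k<n. t / real n * f (t * real k / real n)) \<longlonglongrightarrow> integral {0..t} f"
proof -
  have "continuous_on ({0..t} \<times> {0..t}) (\<lambda>(v, u::real). f v)"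
    unfolding case_prod_beta by (intro continuous_on_compose2[OF f] continuous_intros) auto
  from riemann_sum_diagonal[OF this t]
  have "(\<lambda>n. \<Sum>k<n. (t * real (Suc k) / real n - t * real k / real n) * f (t * real k / real n)) \<longlonglongrightarrow> integral {0..t} f"
    by (rule Lim_transform_eventually)
      (use t in \<open>auto intro!: always_eventually sum.cong simp: divide_right_mono mult_left_mono\<close>)
  then show ?thesis
  proof (rule Lim_transform_eventually)
    show "\<forall>\<^sub>F n in sequentially. (\<Sum>k<n. (t * real (Suc k) / real n - t * real k / real n) * f (t * real k / real n)) =
      (\<Sum>k<n. t / real n * f (t * real k / real n))"
      using eventually_gt_at_top[of 0] by eventually_elim (simp only: uniform_partition(2)[OF t])
  qed
qed

text \<open>The case \<open>\<psi> v u = y u * a u / y v\<close> of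
  \<open>riemann_sum_diagonal\<close>: on the diagonal the price cancels and \<open>a\<close> is
  left.\<close>

lemma drift_sum_tendsto:
  fixes a y :: "real \<Rightarrow> real"
  assumes y: "continuous_on {0..t} y" "\<And>u. u \<in> {0..t} \<Longrightarrow> 0 < y u"
    and a: "continuous_on {0..t} a" and t: "0 \<le> t"
  defines "D \<equiv> \<lambda>s. integral {0..s} (\<lambda>u. y u * a u)"
  shows "(\<lambda>n. \<Sum>k<n. 1 / y (t * real k / real n) * (D (t * real (Suc k) / real n) - D (t * real k / real n)))
    \<longlonglongrightarrow> integral {0..t} a"
proof -
  have "continuous_on ({0..t} \<times> {0..t}) (\<lambda>(v, u). 1 / y v * (y u * a u))"
    unfolding case_prod_beta
    using y(2) by (intro continuous_intros continuous_on_compose2[OF y(1)] continuous_on_compose2[OF a]) fastforce+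
  from riemann_sum_diagonal[OF this t]
  have lim: "(\<lambda>n. \<Sum>k<n. 1 / y (t * real k / real n) * integral {t * real k / real n..t * real (Suc k) / real n} (\<lambda>u. y u * a u))
    \<longlonglongrightarrow> integral {0..t} (\<lambda>u. 1 / y u * (y u * a u))" by simp
  have "integral {0..t} (\<lambda>u. 1 / y u * (y u * a u)) = integral {0..t} a"
    using y(2) by (intro Henstock_Kurzweil_Integration.integral_cong) force
  moreover have "\<forall>\<^sub>F n in sequentially. (\<Sum>k<n. 1 / y (t * real k / real n) * integral {t * real k / real n..t * real (Suc k) / real n} (\<lambda>u. y u * a u)) =
      (\<Sum>k<n. 1 / y (t * real k / real n) * (D (t * real (Suc k) / real n) - D (t * real k / real n)))"
    using eventually_gt_at_top[of 0]
  proof eventually_elim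
    case (elim n)
    show ?case
    proof (intro sum.cong refl arg_cong2[where f="(*)"])
      fix k assume k: "k \<in> {..<n}"
      define p where "p k = t * real k / real n" for k
      note part = uniform_partition[OF t elim(1), folded p_def]
      have pk: "0 \<le> p k" "p k \<le> p (Suc k)" "p (Suc k) \<le> t"
        using k partition_of_bounds[OF part(1), of k] partition_of_bounds[OF part(1), of "Suc k"] part(1)
        by (auto simp: partition_of_def)
      have "continuous_on {0..p (Suc k)} (\<lambda>u. y u * a u)"
        using y(1) a pk by (intro continuous_intros) (auto intro: continuous_on_subset)
      then have "D (p k) + integral {p k..p (Suc k)} (\<lambda>u. y u * a u) = D (p (Suc k))"
        unfolding D_def using pk
        by (intro Henstock_Kurzweil_Integration.integral_combine integrable_continuous_real) auto
      then show "integral {t * real k / real n..t * real (Suc k) / real n} (\<lambda>u. y u * a u) =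
          D (t * real (Suc k) / real n) - D (t * real k / real n)" by (simp add: p_def)
    qed
  qed
  ultimately show ?thesis using Lim_transform_eventually[OF lim] by simp
qed

lemma lipschitz_finite_variation:
  assumes "\<And>u v. 0 \<le> u \<Longrightarrow> u \<le> v \<Longrightarrow> v \<le> T \<Longrightarrow> \<bar>a v - a u\<bar> \<le> K * (v - u)"
  shows "finite_variation T a"
  unfolding finite_variation_def
proof (intro exI[of _ "K * T"] allI impI)
  fix n p assume p: "partition_of T n p"
  have "(\<Sum>k<n. \<bar>a (p (Suc k)) - a (p k)\<bar>) \<le> (\<Sum>k<n. K * (p (Suc k) - p k))"
  proof (intro sum_mono assms)
    fix k assume "k \<in> {..<n}"
    then show "0 \<le> p k" "p k \<le> p (Suc k)" "p (Suc k) \<le> T"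
      using partition_of_bounds[OF p, of k] partition_of_bounds[OF p, of "Suc k"] p
      by (auto simp: partition_of_def)
  qed
  also have "\<dots> = K * T" using partition_of_sum[OF p] by (simp add: sum_distrib_left[symmetric])
  finally show "(\<Sum>k<n. \<bar>a (p (Suc k)) - a (p k)\<bar>) \<le> K * T" .
qed

text \<open>The shape follows the two kinds of generators of \<open>predictable_sigma\<close>. Time
  0 lies in none of the steps, which are open on the left, and has a term of its own.\<close>

lemma left_step_tendsto:
  fixes y :: "real \<Rightarrow> real"
  assumes y: "continuous_on {0..T} y" and T: "0 < T" and t: "t \<in> {0..T}"
  shows "(\<lambda>n. indicator {0} t * y 0 +
    (\<Sum>k<n. indicator {T * real k / real n<..T * real (Suc k) / real n} t * y (T * real k / real n))) \<longlonglongrightarrow> y t"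
proof (cases "t = 0")
  case True
  have "indicator {T * real k / real n<..T * real (Suc k) / real n} t = (0::real)" for k n
    using T True by (simp add: not_less divide_nonneg_nonneg)
  then show ?thesis using True by simp
next
  case False
  then have "0 < t" "t \<le> T" using t by auto
  show ?thesis
  proof (rule LIMSEQ_I)
    fix \<epsilon> :: real assume "0 < \<epsilon>"
    with y t obtain \<delta> where \<delta>: "\<delta> > 0"
      and close: "\<And>v. v \<in> {0..T} \<Longrightarrow> dist v t < \<delta> \<Longrightarrow> dist (y v) (y t) < \<epsilon>"
      unfolding continuous_on_iff by metis
    have "(\<lambda>n. T / real n) \<longlonglongrightarrow> 0" by real_asymp
    then have "\<forall>\<^sub>F n in sequentially. T / real n < \<delta>" using \<delta> by (rule order_tendstoD)
    with eventually_gt_at_top[of 0]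
    have "\<forall>\<^sub>F n in sequentially. norm (indicator {0} t * y 0 +
      (\<Sum>k<n. indicator {T * real k / real n<..T * real (Suc k) / real n} t * y (T * real k / real n)) - y t) < \<epsilon>"
    proof eventually_elim
      case (elim n)
      \<comment> \<open>The time \<open>t\<close> measured in steps. Since steps are closed on the
        right, a grid point belongs to the step that ends there, which is why \<open>k\<close> is
        the ceiling minus one; as \<open>0 < r\<close>, this subtraction is not truncated.\<close>
      define r where "r = real n * t / T"
      define k where "k = nat \<lceil>r\<rceil> - 1"
      have r: "0 < r" "r \<le> real n"
        using \<open>0 < t\<close> \<open>t \<le> T\<close> T elim(1) by (auto simp: r_def field_simps)
      have k: "real k < r" "r \<le> real k + 1" using r(1) unfolding k_def by linarith+
      have ind: "indicator {T * real j / real n<..T * real (Suc j) / real n} t = (if j = k then 1 else 0 :: real)" for j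
      proof -
        have "t \<in> {T * real j / real n<..T * real (Suc j) / real n} \<longleftrightarrow> real j < r \<and> r \<le> real j + 1"
          using T elim(1) by (auto simp: r_def field_simps)
        also have "\<dots> \<longleftrightarrow> j = k" using k by linarith
        finally have mem: "t \<in> {T * real j / real n<..T * real (Suc j) / real n} \<longleftrightarrow> j = k" .
        show ?thesis unfolding indicator_def mem by simp
      qed
      have "k < n" using k r(2) by linarith
      then have "(\<Sum>j<n. indicator {T * real j / real n<..T * real (Suc j) / real n} t * y (T * real j / real n)) =
          y (T * real k / real n)"
        unfolding ind by (simp add: if_distrib[of "\<lambda>c. c * _"] cong: if_cong)
      moreover have "T * real k / real n < t" "t \<le> T * real k / real n + T / real n"
        using k T elim(1) by (auto simp: r_def field_simps)
      then have "dist (y (T * real k / real n)) (y t) < \<epsilon>"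
        using elim(2) T \<open>t \<le> T\<close> by (intro close) (auto simp: dist_real_def)
      ultimately show ?case using False by (simp add: dist_real_def)
    qed
    then show "\<exists>no. \<forall>n\<ge>no. norm (indicator {0} t * y 0 +
      (\<Sum>k<n. indicator {T * real k / real n<..T * real (Suc k) / real n} t * y (T * real k / real n)) - y t) < \<epsilon>"
      by (simp add: eventually_sequentially)
  qed
qed

section \<open>Integrals and predictability of continuous adapted processes\<close>

context filtered_space
begin

lemma continuous_adapted_component:
  fixes X :: "real \<Rightarrow> 'w \<Rightarrow> real^'n"
  assumes "continuous_adapted M F T X"
  shows "continuous_adapted M F T (\<lambda>t \<omega>. X t \<omega> $ i)"
  unfolding continuous_adapted_def
proof (intro conjI ballI)
  fix t assume "t \<in> {0..T}"
  then have "X t \<in> borel_measurable (F t)" using assms by (simp add: continuous_adapted_def)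
  then show "(\<lambda>\<omega>. X t \<omega> $ i) \<in> borel_measurable (F t)"
    by (rule borel_measurable_continuous_on[rotated]) (intro continuous_intros)
next
  fix \<omega> assume "\<omega> \<in> space M"
  then show "continuous_on {0..T} (\<lambda>t. X t \<omega> $ i)"
    using assms by (intro continuous_intros) (auto simp: continuous_adapted_def)
qed

text \<open>Adaptedness passes to the limit from Riemann sums whose points lie in
  \<open>{0..t}\<close>. A path of \<open>a\<close> is bounded on the compact interval, so its
  integral is Lipschitz in time and has finite variation.\<close>

lemma continuous_adapted_integral:
  fixes a :: "real \<Rightarrow> 'w \<Rightarrow> real"
  assumes a: "continuous_adapted M F T a"
  shows "continuous_finite_variation M F T (\<lambda>t \<omega>. integral {0..t} (\<lambda>u. a u \<omega>))"
  unfolding continuous_finite_variation_def continuous_adapted_def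
proof (intro conjI ballI)
  fix t assume t: "t \<in> {0..T}"
  show "(\<lambda>\<omega>. integral {0..t} (\<lambda>u. a u \<omega>)) \<in> borel_measurable (F t)"
  proof (rule borel_measurable_LIMSEQ_real)
    fix \<omega> assume "\<omega> \<in> space (F t)"
    then have "continuous_on {0..T} (\<lambda>u. a u \<omega>)" using a by (auto simp: continuous_adapted_def space_F)
    then have "continuous_on {0..t} (\<lambda>u. a u \<omega>)" by (rule continuous_on_subset) (use t in auto)
    then show "(\<lambda>n. \<Sum>k<n. t / real n * a (t * real k / real n) \<omega>) \<longlonglongrightarrow> integral {0..t} (\<lambda>u. a u \<omega>)"
      using t by (intro riemann_sum_tendsto) auto
  next
    fix n
    show "(\<lambda>\<omega>. \<Sum>k<n. t / real n * a (t * real k / real n) \<omega>) \<in> borel_measurable (F t)"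
    proof (intro borel_measurable_sum borel_measurable_times borel_measurable_const)
      fix k assume "k \<in> {..<n}"
      then have "t * real k / real n \<in> {0..t}"
        using partition_of_bounds[OF uniform_partition(1)[of t n], of k] t by auto
      then show "a (t * real k / real n) \<in> borel_measurable (F t)"
        using t a by - (rule measurable_F_mono[of "a (t * real k / real n)" "t * real k / real n"],
          auto simp: continuous_adapted_def)
    qed
  qed
next
  fix \<omega> assume "\<omega> \<in> space M"
  then have c: "continuous_on {0..T} (\<lambda>u. a u \<omega>)" using a by (auto simp: continuous_adapted_def)
  then show "continuous_on {0..T} (\<lambda>t. integral {0..t} (\<lambda>u. a u \<omega>))"
    by (intro indefinite_integral_continuous_1 integrable_continuous_real)
  have "compact ((\<lambda>u. a u \<omega>) ` {0..T})"
    by (intro compact_continuous_image c compact_Icc)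
  then obtain K where K: "\<And>u. u \<in> {0..T} \<Longrightarrow> \<bar>a u \<omega>\<bar> \<le> K"
    using compact_imp_bounded bounded_iff by (metis imageI real_norm_def)
  show "finite_variation T (\<lambda>t. integral {0..t} (\<lambda>u. a u \<omega>))"
  proof (rule lipschitz_finite_variation)
    fix u v :: real assume uv: "0 \<le> u" "u \<le> v" "v \<le> T"
    have "continuous_on {0..v} (\<lambda>u. a u \<omega>)" "continuous_on {u..v} (\<lambda>u. a u \<omega>)"
      using c uv by (auto intro: continuous_on_subset)
    then have "integral {0..u} (\<lambda>u. a u \<omega>) + integral {u..v} (\<lambda>u. a u \<omega>) = integral {0..v} (\<lambda>u. a u \<omega>)"
      "norm (integral {u..v} (\<lambda>u. a u \<omega>)) \<le> K * (v - u)"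
      using uv K
      by (intro Henstock_Kurzweil_Integration.integral_combine integrable_continuous_real integral_bound; auto)+
    then show "\<bar>integral {0..v} (\<lambda>u. a u \<omega>) - integral {0..u} (\<lambda>u. a u \<omega>)\<bar> \<le> K * (v - u)"
      by auto
  qed
qed

text \<open>For \<open>0 \<le> c\<close> the set where the product exceeds \<open>c\<close> is a
  rectangle; for negative \<open>c\<close> it contains all times outside \<open>E\<close> and is the
  complement of a rectangle.\<close>

lemma measurable_indicator_times:
  fixes Z :: "'w \<Rightarrow> real"
  assumes E: "\<And>A. A \<in> sets (F s) \<Longrightarrow> E \<times> A \<in> sets P"
    and P: "space P = {0..T} \<times> space M" and Z: "Z \<in> borel_measurable (F s)" and "E \<subseteq> {0..T}"
  shows "(\<lambda>(t, \<omega>). indicator E t * Z \<omega>) \<in> borel_measurable P"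
proof (rule borel_measurableI_greater)
  fix c
  have Zc: "{\<omega> \<in> space M. c < Z \<omega>} \<in> sets (F s)" "{\<omega> \<in> space M. Z \<omega> \<le> c} \<in> sets (F s)"
    using borel_measurable_le[OF Z borel_measurable_const, of c]
      borel_measurable_less[OF borel_measurable_const Z, of c] by (simp_all add: space_F)
  show "{x \<in> space P. c < (case x of (t, \<omega>) \<Rightarrow> indicator E t * Z \<omega>)} \<in> sets P"
  proof (cases "0 \<le> c")
    case True
    then have "{x \<in> space P. c < (case x of (t, \<omega>) \<Rightarrow> indicator E t * Z \<omega>)} = E \<times> {\<omega> \<in> space M. c < Z \<omega>}"
      using \<open>E \<subseteq> {0..T}\<close> by (auto simp: P indicator_def of_bool_def split: if_splits)
    then show ?thesis using E[OF Zc(1)] by simp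
  next
    case False
    then have "{x \<in> space P. c < (case x of (t, \<omega>) \<Rightarrow> indicator E t * Z \<omega>)} = space P - E \<times> {\<omega> \<in> space M. Z \<omega> \<le> c}"
      by (auto simp: P indicator_def of_bool_def split: if_splits)
    then show ?thesis using E[OF Zc(2)] by auto
  qed
qed

lemma space_predictable_sigma: "space (predictable_sigma M F T) = {0..T} \<times> space M"
  and predictable_generators:
    "\<And>A. A \<in> sets (F 0) \<Longrightarrow> {0} \<times> A \<in> sets (predictable_sigma M F T)"
    "\<And>s t A. 0 \<le> s \<Longrightarrow> s \<le> t \<Longrightarrow> t \<le> T \<Longrightarrow> A \<in> sets (F s) \<Longrightarrow> {s<..t} \<times> A \<in> sets (predictable_sigma M F T)"
proof -
  let ?G = "{{0} \<times> A | A. A \<in> sets (F 0)} \<union>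
      {{s<..t} \<times> A | s t A. 0 \<le> s \<and> s \<le> t \<and> t \<le> T \<and> A \<in> sets (F s)}"
  have "A \<subseteq> space M" if "A \<in> sets (F s)" for A s
    using sets.sets_into_space[OF that] by (simp add: space_F)
  then have G: "?G \<subseteq> Pow ({0..T} \<times> space M)"
    using T_pos by fastforce
  show "space (predictable_sigma M F T) = {0..T} \<times> space M"
    unfolding predictable_sigma_def by (rule space_measure_of[OF G])
  have *: "?G \<subseteq> sets (predictable_sigma M F T)"
    unfolding predictable_sigma_def sets_measure_of[OF G] by auto
  show "{0} \<times> A \<in> sets (predictable_sigma M F T)" if "A \<in> sets (F 0)" for A
    using that by (intro subsetD[OF *] UnI1) blast
  show "{s<..t} \<times> A \<in> sets (predictable_sigma M F T)"
    if "0 \<le> s" "s \<le> t" "t \<le> T" "A \<in> sets (F s)" for s t A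
    using that by (intro subsetD[OF *] UnI2) blast
qed

text \<open>The step functions \<open>f n\<close> use values at left end points, which are known
  when the step begins, and they converge at every time and outcome.\<close>

lemma continuous_adapted_predictable:
  assumes Y: "continuous_adapted M F T Y"
  shows "predictable M F T Y"
proof -
  define f where "f n x = indicator {0} (fst x) * Y 0 (snd x) +
    (\<Sum>k<n. indicator {T * real k / real n<..T * real (Suc k) / real n} (fst x) * Y (T * real k / real n) (snd x))"
    for n :: nat and x :: "real \<times> 'w"
  have Ym: "Y t \<in> borel_measurable (F t)" if "t \<in> {0..T}" for t
    using Y that by (simp add: continuous_adapted_def)
  have "(\<lambda>(t, \<omega>). indicator {0} t * Y 0 \<omega>) \<in> borel_measurable (predictable_sigma M F T)"
    using T_pos by (intro measurable_indicator_times[where s=0] space_predictable_sigma predictable_generators Ym) auto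
  moreover have "(\<lambda>(t, \<omega>). indicator {T * real k / real n<..T * real (Suc k) / real n} t * Y (T * real k / real n) \<omega>)
      \<in> borel_measurable (predictable_sigma M F T)" if k: "k < n" for k n
  proof -
    have "partition_of T n (\<lambda>k. T * real k / real n)" using uniform_partition(1)[of T n] T_pos k by simp
    from partition_of_bounds[OF this, of k] partition_of_bounds[OF this, of "Suc k"] this k
    have "0 \<le> T * real k / real n" "T * real k / real n \<le> T * real (Suc k) / real n" "T * real (Suc k) / real n \<le> T"
      by (auto simp: partition_of_def)
    then show ?thesis
      by (intro measurable_indicator_times[where s="T * real k / real n"] space_predictable_sigma predictable_generators Ym) auto
  qed
  ultimately have f: "f n \<in> borel_measurable (predictable_sigma M F T)" for n
    unfolding f_def[abs_def] case_prod_beta by (intro borel_measurable_add borel_measurable_sum) auto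
  have lim: "(\<lambda>n. f n x) \<longlonglongrightarrow> (case x of (t, \<omega>) \<Rightarrow> Y t \<omega>)" if mem: "x \<in> space (predictable_sigma M F T)" for x
  proof -
    obtain t \<omega> where x: "x = (t, \<omega>)" "t \<in> {0..T}" "\<omega> \<in> space M"
      using mem by (auto simp: space_predictable_sigma)
    have "continuous_on {0..T} (\<lambda>t. Y t \<omega>)" using Y x by (auto simp: continuous_adapted_def)
    from left_step_tendsto[OF this T_pos x(2)] show ?thesis by (simp add: f_def x)
  qed
  show ?thesis
    unfolding predictable_def by (rule borel_measurable_LIMSEQ_real[OF lim f])
qed

end

section \<open>Associativity of the Ito integral and the return process\<close>

text \<open>One fine grid serves all coarse end points: its first \<open>k * m\<close> steps
  partition the interval up to the coarse point \<open>k\<close>. Differences of approximations at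
  neighbouring coarse points are then sums over a block of \<open>m\<close> steps.\<close>

lemma filterlim_refined_partition:
  assumes "0 \<le> t" "0 < n"
  shows "filterlim (\<lambda>m. (k * m, \<lambda>l. t * real l / (real n * real m))) (fine_partitions (t * real k / real n)) sequentially"
  unfolding filterlim_iff eventually_fine_partitions
proof (intro allI impI, elim exE conjE)
  fix P and \<delta> :: real
  assume "\<delta> > 0" and P: "\<forall>r p. partition_of (t * real k / real n) r p \<and> (\<forall>k<r. p (Suc k) - p k < \<delta>) \<longrightarrow> P (r, p)"
  have "(\<lambda>m. t / (real n * real m)) \<longlonglongrightarrow> 0" using assms by real_asymp
  then have "\<forall>\<^sub>F m in sequentially. t / (real n * real m) < \<delta>" using \<open>\<delta> > 0\<close> by (rule order_tendstoD)
  with eventually_gt_at_top[of 0] show "\<forall>\<^sub>F m in sequentially. P (k * m, \<lambda>l. t * real l / (real n * real m))"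
  proof eventually_elim
    case (elim m)
    then show ?case using assms
      by (intro P[rule_format])
         (auto simp: partition_of_def divide_right_mono mult_left_mono diff_divide_distrib[symmetric] algebra_simps)
  qed
qed

text \<open>A positive continuous function on a compact interval has a positive minimum
  \<open>y v0\<close>, so uniform continuity with tolerance \<open>\<eta> * y v0\<close> controls
  the ratios of all near pairs at once.\<close>

lemma ratio_eventually_close:
  fixes y :: "real \<Rightarrow> real"
  assumes y: "continuous_on {0..t} y" "\<And>u. u \<in> {0..t} \<Longrightarrow> 0 < y u" and t: "0 \<le> t" and \<eta>: "0 < \<eta>"
  shows "\<forall>\<^sub>F n in sequentially. \<forall>u\<in>{0..t}. \<forall>v\<in>{0..t}. \<bar>u - v\<bar> \<le> t / real n \<longrightarrow> \<bar>y u / y v - 1\<bar> \<le> \<eta>"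
proof -
  obtain v0 where v0: "v0 \<in> {0..t}" "\<And>v. v \<in> {0..t} \<Longrightarrow> y v0 \<le> y v"
    using continuous_attains_inf[of "{0..t}" y] y(1) t by auto
  have "0 < \<eta> * y v0" using \<eta> y(2) v0 by simp
  moreover have "uniformly_continuous_on {0..t} y"
    using y(1) by (intro compact_uniformly_continuous compact_Icc)
  ultimately obtain \<delta> where \<delta>: "\<delta> > 0"
    and uc: "\<And>v u. v \<in> {0..t} \<Longrightarrow> u \<in> {0..t} \<Longrightarrow> dist u v < \<delta> \<Longrightarrow> dist (y u) (y v) < \<eta> * y v0"
    unfolding uniformly_continuous_on_def by metis
  have "(\<lambda>n. t / real n) \<longlonglongrightarrow> 0" by real_asymp
  then have "\<forall>\<^sub>F n in sequentially. t / real n < \<delta>" using \<delta> by (rule order_tendstoD)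
  then show ?thesis
  proof eventually_elim
    case (elim n)
    show ?case
    proof (intro ballI impI)
      fix u v assume uv: "u \<in> {0..t}" "v \<in> {0..t}" "\<bar>u - v\<bar> \<le> t / real n"
      then have "\<bar>y u - y v\<bar> \<le> \<eta> * y v0" using uc[of v u] elim by (simp add: dist_real_def)
      also have "\<dots> \<le> \<eta> * y v" using v0 uv \<eta> by (intro mult_left_mono) auto
      finally have "\<bar>y u - y v\<bar> \<le> \<eta> * y v" .
      moreover have "y u / y v - 1 = (y u - y v) / y v"
        using y(2)[OF uv(2)] by (simp add: field_simps)
      then have "\<bar>y u / y v - 1\<bar> = \<bar>y u - y v\<bar> / y v"
        using y(2)[OF uv(2)] by simp
      ultimately show "\<bar>y u / y v - 1\<bar> \<le> \<eta>" using y(2)[OF uv(2)] by (simp add: divide_le_eq)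
    qed
  qed
qed

context brownian
begin

text \<open>Truncating the integrand at \<open>\<eta>\<close> makes the sum square integrable; it is unchanged off \<open>U\<close>.\<close>

lemma small_integrand_sum:
  fixes p :: "nat \<Rightarrow> real" and H :: "nat \<Rightarrow> 'w \<Rightarrow> real"
  assumes p: "partition_of t N p" and t: "t \<in> {0..T}"
    and H: "\<And>l. l < N \<Longrightarrow> H l \<in> borel_measurable (F (p l))"
    and U: "U \<in> sets M" "\<And>l \<omega>. l < N \<Longrightarrow> \<omega> \<in> space M - U \<Longrightarrow> \<bar>H l \<omega>\<bar> \<le> \<eta>"
    and "0 \<le> \<eta>" "0 < \<epsilon>"
  shows "measure M {\<omega> \<in> space M. \<epsilon> < \<bar>\<Sum>l<N. H l \<omega> * (B (p (Suc l)) \<omega> $ j - B (p l) \<omega> $ j)\<bar>}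
    \<le> measure M U + \<eta>\<^sup>2 * t / \<epsilon>\<^sup>2"
proof -
  have pk: "0 \<le> p k" "p k \<le> p (Suc k)" "p (Suc k) \<le> T" "p k \<le> T" if "k < N" for k
    using that partition_of_bounds[OF p, of k] partition_of_bounds[OF p, of "Suc k"] t p
    by (auto simp: partition_of_def)
  define \<xi> where "\<xi> l \<omega> = B (p (Suc l)) \<omega> $ j - B (p l) \<omega> $ j" for l \<omega>
  define h where "h l \<omega> = (if \<bar>H l \<omega>\<bar> \<le> \<eta> then H l \<omega> else 0)" for l \<omega>
  have h: "h l \<in> borel_measurable (F (p l))" if "l < N" for l
  proof -
    have [measurable]: "H l \<in> borel_measurable (F (p l))" using H that .
    show ?thesis unfolding h_def[abs_def] by measurable
  qed
  have \<xi>: "\<xi> l \<in> borel_measurable (F (p (Suc l)))" if "l < N" for l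
    unfolding \<xi>_def[abs_def] using pk[OF that] by (intro borel_measurable_diff B_component_adapted) auto
  have m2: "integrable M (\<lambda>\<omega>. (\<Sum>l<N. h l \<omega> * \<xi> l \<omega>)\<^sup>2) \<and>
    (\<integral>\<omega>. (\<Sum>l<N. h l \<omega> * \<xi> l \<omega>)\<^sup>2 \<partial>M) \<le> \<eta>\<^sup>2 * (\<Sum>l<N. \<integral>\<omega>. (\<xi> l \<omega>)\<^sup>2 \<partial>M)"
  proof (rule martingale_difference_second_moment[where G="\<lambda>l. F (p l)"])
    fix l assume l: "l < N"
    show "integrable M (\<lambda>\<omega>. (\<xi> l \<omega>)\<^sup>2)"
      unfolding \<xi>_def using pk[OF l] by (intro increment_moments) auto
    show "\<bar>h l \<omega>\<bar> \<le> \<eta>" for \<omega> using \<open>0 \<le> \<eta>\<close> by (simp add: h_def)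
    fix V :: "'w \<Rightarrow> real" assume "V \<in> borel_measurable (F (p l))" "integrable M V"
    then show "integrable M (\<lambda>\<omega>. V \<omega> * \<xi> l \<omega>) \<and> (\<integral>\<omega>. V \<omega> * \<xi> l \<omega> \<partial>M) = 0"
      using increment_centered[OF pk(1-3)[OF l], of "\<lambda>x. x $ j" V]
        increment_moments(1)[OF pk(1-3)[OF l], of j 1] increment_moments(2)[OF pk(1-3)[OF l], of j]
      by (simp add: \<xi>_def borel_measurable_continuous_onI continuous_intros)
  qed (use pk h \<xi> subalg subalg_mono in auto)
  \<comment> \<open>The variances add up to the elapsed time, so the bound does not depend on the
    number \<open>N\<close> of points.\<close>
  have "(\<Sum>l<N. \<integral>\<omega>. (\<xi> l \<omega>)\<^sup>2 \<partial>M) = (\<Sum>l<N. p (Suc l) - p l)"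
    unfolding \<xi>_def using increment_moments(3) pk by (intro sum.cong) auto
  then have m2': "(\<integral>\<omega>. (\<Sum>l<N. h l \<omega> * \<xi> l \<omega>)\<^sup>2 \<partial>M) \<le> \<eta>\<^sup>2 * t"
    using m2 partition_of_sum[OF p] by simp
  have S [measurable]: "(\<lambda>\<omega>. \<Sum>l<N. h l \<omega> * \<xi> l \<omega>) \<in> borel_measurable M"
    by (intro borel_measurable_sum borel_measurable_times measurable_F_M[OF h] measurable_F_M[OF \<xi>]) auto
  let ?A = "{\<omega> \<in> space M. \<epsilon> < \<bar>\<Sum>l<N. h l \<omega> * \<xi> l \<omega>\<bar>}"
  have "measure M {\<omega> \<in> space M. \<epsilon> < \<bar>\<Sum>l<N. H l \<omega> * \<xi> l \<omega>\<bar>} \<le> measure M (U \<union> ?A)"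
  proof (rule finite_measure_mono)
    show "{\<omega> \<in> space M. \<epsilon> < \<bar>\<Sum>l<N. H l \<omega> * \<xi> l \<omega>\<bar>} \<subseteq> U \<union> ?A"
    proof (safe, goal_cases)
      case (1 \<omega>)
      then have "(\<Sum>l<N. H l \<omega> * \<xi> l \<omega>) = (\<Sum>l<N. h l \<omega> * \<xi> l \<omega>)"
        using U(2)[of _ \<omega>] by (intro sum.cong) (auto simp: h_def)
      with 1 show ?case by simp
    qed
  qed (use U(1) in measurable)
  also have "\<dots> \<le> measure M U + measure M ?A"
    using U(1) by (intro measure_Un_le) auto
  also have "measure M ?A \<le> (\<integral>\<omega>. (\<Sum>l<N. h l \<omega> * \<xi> l \<omega>)\<^sup>2 \<partial>M) / \<epsilon>\<^sup>2"
    using m2 \<open>0 < \<epsilon>\<close> by (intro prob_gt_le_second_moment S) auto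
  also have "\<dots> \<le> \<eta>\<^sup>2 * t / \<epsilon>\<^sup>2"
    using m2' by (intro divide_right_mono) auto
  finally show ?thesis by (simp add: \<xi>_def)
qed

text \<open>\<open>Z s\<close> is merely a random variable for each \<open>s\<close>. No path
  property of \<open>Z\<close> is needed, because for each \<open>n\<close> only the finitely many
  values at the coarse points occur.\<close>

lemma ito_integral_chain:
  fixes Y :: "real \<Rightarrow> 'w \<Rightarrow> real" and Z :: "real \<Rightarrow> 'w \<Rightarrow> real"
  assumes Y: "continuous_adapted M F T Y" and pos: "\<And>s \<omega>. s \<in> {0..T} \<Longrightarrow> \<omega> \<in> space M \<Longrightarrow> 0 < Y s \<omega>"
    and t: "t \<in> {0..T}"
    and Z: "\<And>s. s \<in> {0..T} \<Longrightarrow> has_ito_integral M Y (\<lambda>t \<omega>. B t \<omega> $ j) s (Z s)"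
  shows "conv_prob M (\<lambda>n \<omega>. \<Sum>k<n. 1 / Y (t * real k / real n) \<omega> *
      (Z (t * real (Suc k) / real n) \<omega> - Z (t * real k / real n) \<omega>))
    (\<lambda>\<omega>. B t \<omega> $ j - B 0 \<omega> $ j) sequentially"
proof -
  define b where "b s \<omega> = B s \<omega> $ j" for s \<omega>
  define p where "p n k = t * real k / real n" for n k :: nat
  define r where "r n m l = t * real l / (real n * real m)" for n m l :: nat
  \<comment> \<open>\<open>l div m\<close> is the index of the last coarse point at or before the
    fine point \<open>r n m l\<close>. The ratio involves no time after that fine point, so it is an
    admissible weight for the next increment of \<open>b\<close>.\<close>
  define \<rho> where "\<rho> n m l \<omega> = Y (r n m l) \<omega> / Y (p n (l div m)) \<omega>" for n m l \<omega>
  define E where "E n \<omega> = (\<Sum>k<n. 1 / Y (p n k) \<omega> * (Z (p n (Suc k)) \<omega> - Z (p n k) \<omega>))" for n \<omega>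
  \<comment> \<open>The union runs over all refinements, so the exceptional event depends on
    \<open>n\<close> and not on the \<open>m\<close> chosen later.\<close>
  define U where "U \<eta> n = (\<Union>m\<in>{0<..}. \<Union>l\<in>{..<n * m}. {\<omega> \<in> space M. \<eta> < \<bar>\<rho> n m l \<omega> - 1\<bar>})" for \<eta> n
  have t0: "0 \<le> t" using t by simp
  have YF: "Y s \<in> borel_measurable (F s)" if "s \<in> {0..T}" for s
    using Y that by (auto simp: continuous_adapted_def)
  have YM: "Y s \<in> borel_measurable M" if "s \<in> {0..T}" for s
    using YF[OF that] by (rule measurable_F_M)
  have bM: "b s \<in> borel_measurable M" if "s \<in> {0..T}" for s
    using B_component_measurable[OF that] by (simp add: b_def[abs_def])
  have ZM: "Z s \<in> borel_measurable M" if "s \<in> {0..T}" for s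
    using Z[OF that] by (simp add: has_ito_integral_def limit_of_sums_def)
  have p_mem: "p n k \<in> {0..t}" "p n k \<in> {0..T}" if "k \<le> n" "0 < n" for n k
    using partition_of_bounds[OF uniform_partition(1)[of t n] that(1)] that t by (auto simp: p_def)
  have r_part: "partition_of t (n * m) (r n m)" if "0 < n" "0 < m" for n m
    using uniform_partition(1)[of t "n * m"] that t by (simp add: r_def[abs_def])
  have r_mem: "r n m l \<in> {0..t}" "r n m l \<in> {0..T}" if "l \<le> n * m" "0 < n" "0 < m" for n m l
    using partition_of_bounds[OF r_part[OF that(2,3)] that(1)] t by auto
  have div: "l div m \<le> n" "p n (l div m) \<le> r n m l" "r n m l - p n (l div m) \<le> t / real n"
    if "l < n * m" "0 < n" for l n m
  proof -
    have m: "0 < m" using that by (cases m) auto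
    show "l div m \<le> n" using that(1) by (simp add: less_mult_imp_div_less less_imp_le)
    have "real (l div m) * real m \<le> real l" "real l \<le> (real (l div m) + 1) * real m"
    proof -
      have "l div m * m \<le> l" "l \<le> (l div m + 1) * m"
        using m by (simp_all add: dividend_less_div_times less_imp_le)
      then show "real (l div m) * real m \<le> real l" "real l \<le> (real (l div m) + 1) * real m"
        by (metis of_nat_le_iff of_nat_mult, metis of_nat_le_iff of_nat_mult of_nat_Suc Suc_eq_plus1 add.commute)
    qed
    then have "t * (real (l div m) * real m) \<le> t * real l" "t * real l \<le> t * ((real (l div m) + 1) * real m)"
      using t0 by (intro mult_left_mono; simp)+
    then have "t * (real (l div m) * real m) / (real n * real m) \<le> r n m l"
      "r n m l \<le> t * ((real (l div m) + 1) * real m) / (real n * real m)"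
      unfolding r_def by (intro divide_right_mono; simp)+
    moreover have "t * (real (l div m) * real m) / (real n * real m) = p n (l div m)"
      "t * ((real (l div m) + 1) * real m) / (real n * real m) = p n (l div m) + t / real n"
      using m by (simp_all add: p_def distrib_left add_divide_distrib)
    ultimately show "p n (l div m) \<le> r n m l" "r n m l - p n (l div m) \<le> t / real n"
      by linarith+
  qed
  have \<rho>F: "\<rho> n m l \<in> borel_measurable (F (r n m l))" if "l < n * m" "0 < n" for n m l
  proof -
    have "0 < m" using that by (cases m) auto
    then show ?thesis
      unfolding \<rho>_def[abs_def] using div[OF that] r_mem[of l n m] p_mem[of "l div m" n] that
      by (intro borel_measurable_divide measurable_F_mono[OF YF[of "p n (l div m)"]] YF) auto
  qed
  have UM: "U \<eta> n \<in> sets M" if "0 < n" for \<eta> n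
    unfolding U_def
  proof (intro sets.countable_UN'' countableI_type)
    fix m l assume "m \<in> {0<..}" "l \<in> {..<n * m}"
    then have [measurable]: "\<rho> n m l \<in> borel_measurable M"
      using \<rho>F[of l n m] that by (auto intro: measurable_F_M)
    show "{\<omega> \<in> space M. \<eta> < \<bar>\<rho> n m l \<omega> - 1\<bar>} \<in> sets M" by measurable
  qed
  have U_small: "\<forall>\<^sub>F n in sequentially. measure M (U \<eta> n) \<le> \<epsilon>" if "0 < \<eta>" "0 < \<epsilon>" for \<eta> \<epsilon>
  proof -
    \<comment> \<open>\<open>UM\<close> speaks of positive \<open>n\<close>; \<open>V\<close>
      extends the family to \<open>n = 0\<close> with measurability kept.\<close>
    define V where "V n = (if n = 0 then {} else U \<eta> n)" for n
    \<comment> \<open>Below 1, so that the event where the indicator exceeds \<delta> is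
      \<open>U \<eta> n\<close> itself.\<close>
    define \<delta> where "\<delta> = min \<epsilon> (1/2)"
    have "conv_prob M (\<lambda>n. indicator (V n)) (\<lambda>_. 0) sequentially"
    proof (rule conv_prob_pointwise)
      show "indicator (V n) \<in> borel_measurable M" for n
        using UM by (intro borel_measurable_indicator) (simp add: V_def)
      fix \<omega> assume \<omega>: "\<omega> \<in> space M"
      have "continuous_on {0..t} (\<lambda>s. Y s \<omega>)"
        using Y \<omega> t by (auto simp: continuous_adapted_def intro: continuous_on_subset)
      from ratio_eventually_close[OF this _ t0 \<open>0 < \<eta>\<close>] pos \<omega> t
      have "\<forall>\<^sub>F n in sequentially. \<forall>u\<in>{0..t}. \<forall>v\<in>{0..t}. \<bar>u - v\<bar> \<le> t / real n \<longrightarrow> \<bar>Y u \<omega> / Y v \<omega> - 1\<bar> \<le> \<eta>"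
        by simp
      then have "\<forall>\<^sub>F n in sequentially. indicator (V n) \<omega> = (0::real)"
      proof eventually_elim
        case (elim n)
        have "\<bar>\<rho> n m l \<omega> - 1\<bar> \<le> \<eta>" if "0 < n" "0 < m" "l < n * m" for m l
          using elim r_mem(1)[of l n m] p_mem(1)[of "l div m" n] div[of l n m] that by (simp add: \<rho>_def)
        then show ?case by (auto simp: V_def U_def indicator_def not_less)
      qed
      then show "(\<lambda>n. indicator (V n) \<omega>) \<longlonglongrightarrow> (0::real)" by (rule tendsto_eventually)
    qed simp
    moreover have \<delta>: "0 < \<delta>"
      using that by (simp add: \<delta>_def)
    ultimately have "\<forall>\<^sub>F n in sequentially. (indicator (V n) :: 'w \<Rightarrow> real) \<in> borel_measurable M \<and>
        measure M {\<omega> \<in> space M. \<delta> < \<bar>indicator (V n) \<omega> - 0 :: real\<bar>} \<le> \<delta>"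
      by (rule conv_probD)
    with eventually_gt_at_top[of 0] show ?thesis
    proof eventually_elim
      case (elim n)
      have "U \<eta> n \<subseteq> space M" using UM elim(1) by (intro sets.sets_into_space)
      then have "{\<omega> \<in> space M. \<delta> < \<bar>indicator (V n) \<omega> - 0 :: real\<bar>} = U \<eta> n"
        using elim(1) \<delta> by (auto simp: V_def \<delta>_def indicator_def of_bool_def split: if_splits)
      with elim show ?case by (simp add: \<delta>_def)
    qed
  qed
  have approx: "conv_prob M (\<lambda>m \<omega>. \<Sum>l<n * m. \<rho> n m l \<omega> * (b (r n m (Suc l)) \<omega> - b (r n m l) \<omega>)) (E n) sequentially"
    if n: "0 < n" for n
  proof -
    \<comment> \<open>For fixed \<open>n\<close> this is the approximation, on the refined grid, of
      the integral up to the coarse point \<open>p n k\<close>.\<close>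
    define Q where "Q m k \<omega> = (\<Sum>l<k * m. Y (r n m l) \<omega> * (b (r n m (Suc l)) \<omega> - b (r n m l) \<omega>))" for m k \<omega>
    have Q: "conv_prob M (\<lambda>m. Q m k) (Z (p n k)) sequentially" if k: "k \<le> n" for k
    proof -
      have "limit_of_sums M (p n k) (\<lambda>u v \<omega>. Y u \<omega> * (b v \<omega> - b u \<omega>)) (Z (p n k))"
        using Z[OF p_mem(2)[OF k n]] by (simp add: has_ito_integral_def b_def)
      then have "conv_prob M (\<lambda>(N, q) \<omega>. \<Sum>l<N. Y (q l) \<omega> * (b (q (Suc l)) \<omega> - b (q l) \<omega>)) (Z (p n k)) (fine_partitions (p n k))"
      proof (subst conv_prob_iff_limit_of_sums, goal_cases)
        case (1 N q)
        have "q l \<in> {0..T}" if "l \<le> N" for l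
          using partition_of_bounds[OF 1(2) that] p_mem(2)[OF k n] by auto
        then show ?case
          by (intro borel_measurable_sum borel_measurable_times borel_measurable_diff YM bM) auto
      qed
      from conv_prob_filterlim[OF this filterlim_refined_partition[OF t0 n, of k, folded p_def]]
      show ?thesis by (simp add: Q_def[abs_def] r_def)
    qed
    have "conv_prob M (\<lambda>m \<omega>. \<Sum>k<n. 1 / Y (p n k) \<omega> * (Q m (Suc k) \<omega> - Q m k \<omega>)) (E n) sequentially"
      unfolding E_def[abs_def]
      using p_mem[OF _ n] by (intro conv_prob_sum conv_prob_mult conv_prob_diff Q borel_measurable_divide YM borel_measurable_const) auto
    moreover have "(\<Sum>k<n. 1 / Y (p n k) \<omega> * (Q m (Suc k) \<omega> - Q m k \<omega>)) =
        (\<Sum>l<n * m. \<rho> n m l \<omega> * (b (r n m (Suc l)) \<omega> - b (r n m l) \<omega>))" for m \<omega>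
    proof -
      \<comment> \<open>On the block of fine steps belonging to \<open>k\<close> one has
        \<open>l div m = k\<close>, so dividing by \<open>Y\<close> at the coarse point produces
        exactly the ratios \<rho>.\<close>
      have "1 / Y (p n k) \<omega> * (Q m (Suc k) \<omega> - Q m k \<omega>) =
          (\<Sum>l\<in>{k * m..<k * m + m}. \<rho> n m l \<omega> * (b (r n m (Suc l)) \<omega> - b (r n m l) \<omega>))" for k
      proof -
        have "Q m (Suc k) \<omega> - Q m k \<omega> = (\<Sum>l\<in>{k * m..<k * m + m}. Y (r n m l) \<omega> * (b (r n m (Suc l)) \<omega> - b (r n m l) \<omega>))"
          using sum_diff_nat_ivl[of 0 "k * m" "k * m + m" "\<lambda>l. Y (r n m l) \<omega> * (b (r n m (Suc l)) \<omega> - b (r n m l) \<omega>)"]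
          by (simp add: Q_def atLeast0LessThan add.commute)
        moreover have "l div m = k" if "l \<in> {k * m..<k * m + m}" for l
          using that by (intro div_nat_eqI) (auto simp: mult.commute)
        ultimately show ?thesis
          by (auto simp: sum_distrib_left \<rho>_def intro!: sum.cong)
      qed
      then show ?thesis by (simp add: sum.nat_group)
    qed
    ultimately show ?thesis by simp
  qed
  show ?thesis
    unfolding conv_prob_def p_def[symmetric]
  proof (intro conjI allI impI)
    show "(\<lambda>\<omega>. B t \<omega> $ j - B 0 \<omega> $ j) \<in> borel_measurable M"
      using bM[of t] bM[of 0] t by (simp add: b_def[abs_def])
    fix \<epsilon> :: real assume \<epsilon>: "0 < \<epsilon>"
    \<comment> \<open>The probability is split into \<epsilon>/2 for replacing \<open>E n\<close> by
      a refined sum, \<epsilon>/4 for \<open>U\<close> and \<epsilon>/4 for the second moment bound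
      at level \<epsilon>/2. The denominator \<open>t + 1\<close> dominates the factor
      \<open>t\<close> and is never zero.\<close>
    define \<eta> where "\<eta> = sqrt (\<epsilon> / 4 * (\<epsilon> / 2)\<^sup>2 / (t + 1))"
    have \<eta>: "0 < \<eta>" using \<epsilon> t0 by (simp add: \<eta>_def)
    have "\<eta>\<^sup>2 * t \<le> \<epsilon> / 4 * (\<epsilon> / 2)\<^sup>2"
      using \<epsilon> t0 by (simp add: \<eta>_def divide_le_eq mult_left_mono)
    then have \<eta>2: "\<eta>\<^sup>2 * t / (\<epsilon> / 2)\<^sup>2 \<le> \<epsilon> / 4" using \<epsilon> by (simp add: divide_le_eq)
    have "\<forall>\<^sub>F n in sequentially. measure M (U \<eta> n) \<le> \<epsilon> / 4" using \<eta> \<epsilon> by (intro U_small) auto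
    with eventually_gt_at_top[of 0]
    show "\<forall>\<^sub>F n in sequentially. (\<lambda>\<omega>. \<Sum>k<n. 1 / Y (p n k) \<omega> * (Z (p n (Suc k)) \<omega> - Z (p n k) \<omega>)) \<in> borel_measurable M \<and>
      measure M {\<omega> \<in> space M. \<epsilon> < \<bar>(\<Sum>k<n. 1 / Y (p n k) \<omega> * (Z (p n (Suc k)) \<omega> - Z (p n k) \<omega>)) - (B t \<omega> $ j - B 0 \<omega> $ j)\<bar>} \<le> \<epsilon>"
    proof eventually_elim
      case (elim n)
      note n = elim(1)
      have EM [measurable]: "E n \<in> borel_measurable M"
        unfolding E_def[abs_def] using p_mem[OF _ n]
        by (intro borel_measurable_sum borel_measurable_times borel_measurable_diff borel_measurable_divide YM ZM borel_measurable_const) auto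
      define G where "G m \<omega> = (\<Sum>l<n * m. \<rho> n m l \<omega> * (b (r n m (Suc l)) \<omega> - b (r n m l) \<omega>))" for m \<omega>
      have "\<forall>\<^sub>F m in sequentially. G m \<in> borel_measurable M \<and> measure M {\<omega> \<in> space M. \<epsilon> / 2 < \<bar>G m \<omega> - E n \<omega>\<bar>} \<le> \<epsilon> / 2"
        unfolding G_def[abs_def] using \<epsilon> by (intro conv_probD[OF approx[OF n]]) simp
      with eventually_gt_at_top[of 0]
      have "\<forall>\<^sub>F m in sequentially. 0 < m \<and> G m \<in> borel_measurable M \<and> measure M {\<omega> \<in> space M. \<epsilon> / 2 < \<bar>G m \<omega> - E n \<omega>\<bar>} \<le> \<epsilon> / 2"
        by eventually_elim simp
      \<comment> \<open>One refinement is enough, since the estimate of \<open>U\<close> already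
        covers every \<open>m\<close>.\<close>
      from eventually_happens'[OF sequentially_bot this]
      obtain m where m: "0 < m" and [measurable]: "G m \<in> borel_measurable M"
        and Gm: "measure M {\<omega> \<in> space M. \<epsilon> / 2 < \<bar>G m \<omega> - E n \<omega>\<bar>} \<le> \<epsilon> / 2"
        by blast
      have ends: "r n m 0 = 0" "r n m (n * m) = t" using n m by (auto simp: r_def)
      have [measurable]: "(\<lambda>\<omega>. b t \<omega> - b 0 \<omega>) \<in> borel_measurable M" using bM t by (intro borel_measurable_diff) auto
      \<comment> \<open>The increments of \<open>b\<close> telescope, which turns the weights \<rho>
        into \<open>\<rho> - 1\<close>.\<close>
      have GB: "G m \<omega> - (b t \<omega> - b 0 \<omega>) = (\<Sum>l<n * m. (\<rho> n m l \<omega> - 1) * (b (r n m (Suc l)) \<omega> - b (r n m l) \<omega>))" for \<omega>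
        using sum_lessThan_telescope[of "\<lambda>l. b (r n m l) \<omega>" "n * m"]
        by (simp add: G_def left_diff_distrib sum_subtractf ends)
      have "measure M {\<omega> \<in> space M. \<epsilon> / 2 < \<bar>G m \<omega> - (b t \<omega> - b 0 \<omega>)\<bar>} \<le> measure M (U \<eta> n) + \<eta>\<^sup>2 * t / (\<epsilon> / 2)\<^sup>2"
        unfolding GB unfolding b_def
      proof (rule small_integrand_sum[OF r_part[OF n m] t])
        show "(\<lambda>\<omega>. \<rho> n m l \<omega> - 1) \<in> borel_measurable (F (r n m l))" if "l < n * m" for l
          using \<rho>F[OF that n] by simp
        show "\<bar>\<rho> n m l \<omega> - 1\<bar> \<le> \<eta>" if "l < n * m" "\<omega> \<in> space M - U \<eta> n" for l \<omega>
          using that m by (auto simp: U_def not_less)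
      qed (use UM[OF n] \<eta> \<epsilon> in auto)
      then have small: "measure M {\<omega> \<in> space M. \<epsilon> / 2 < \<bar>G m \<omega> - (b t \<omega> - b 0 \<omega>)\<bar>} \<le> \<epsilon> / 2"
        using \<eta>2 elim(2) by linarith
      have "measure M {\<omega> \<in> space M. \<epsilon> < \<bar>E n \<omega> - (b t \<omega> - b 0 \<omega>)\<bar>} \<le>
          measure M ({\<omega> \<in> space M. \<epsilon> / 2 < \<bar>G m \<omega> - E n \<omega>\<bar>} \<union> {\<omega> \<in> space M. \<epsilon> / 2 < \<bar>G m \<omega> - (b t \<omega> - b 0 \<omega>)\<bar>})"
        by (intro finite_measure_mono) (auto simp: abs_if split: if_splits)
      also have "\<dots> \<le> measure M {\<omega> \<in> space M. \<epsilon> / 2 < \<bar>G m \<omega> - E n \<omega>\<bar>} +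
          measure M {\<omega> \<in> space M. \<epsilon> / 2 < \<bar>G m \<omega> - (b t \<omega> - b 0 \<omega>)\<bar>}"
        by (intro measure_Un_le) auto
      also have "\<dots> \<le> \<epsilon>" using Gm small by simp
      finally show ?case using EM by (simp add: E_def[abs_def] b_def)
    qed
  qed
qed

text \<open>The sums of \<open>1 / Y\<close> against increments of \<open>Y\<close> on uniform grids
  have two limits: \<open>Rt\<close> by definition, and drift plus noise once the market equation is
  inserted. Limits in probability are almost surely unique.\<close>

lemma return_component_AE:
  fixes Y a R' :: "real \<Rightarrow> 'w \<Rightarrow> real" and \<sigma> :: "'m \<Rightarrow> real" and Z :: "real \<Rightarrow> 'm \<Rightarrow> 'w \<Rightarrow> real"
  assumes Y: "continuous_adapted M F T Y" and pos: "\<And>s \<omega>. s \<in> {0..T} \<Longrightarrow> \<omega> \<in> space M \<Longrightarrow> 0 < Y s \<omega>"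
    and a: "continuous_adapted M F T a" and t: "t \<in> {0..T}"
    and Z: "\<And>s j. s \<in> {0..T} \<Longrightarrow> has_ito_integral M Y (\<lambda>t \<omega>. B t \<omega> $ j) s (Z s j)"
    and sde: "\<And>s. s \<in> {0..T} \<Longrightarrow> AE \<omega> in M. Y s \<omega> = Y 0 \<omega> + (LINT u:{0..s}|lborel. Y u \<omega> * a u \<omega>)
            + (\<Sum>j\<in>UNIV. \<sigma> j * Z s j \<omega>)"
    and Rt: "has_ito_integral M (\<lambda>t \<omega>. 1 / Y t \<omega>) Y t Rt"
  shows "AE \<omega> in M. Rt \<omega> = integral {0..t} (\<lambda>u. a u \<omega>) + (\<Sum>j\<in>UNIV. \<sigma> j * (B t \<omega> $ j - B 0 \<omega> $ j))"
proof -
  define p where "p n k = t * real k / real n" for n k :: nat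
  define D where "D s \<omega> = integral {0..s} (\<lambda>u. Y u \<omega> * a u \<omega>)" for s \<omega>
  have t0: "0 \<le> t" using t by simp
  have p_mem: "p n k \<in> {0..T}" if "k \<le> n" "0 < n" for n k
    using partition_of_bounds[OF uniform_partition(1)[of t n] that(1)] that t by (auto simp: p_def)
  have YM: "Y s \<in> borel_measurable M" if "s \<in> {0..T}" for s
    using Y that by (intro measurable_F_M[of "Y s" s]) (auto simp: continuous_adapted_def)
  have Ya: "continuous_adapted M F T (\<lambda>u \<omega>. Y u \<omega> * a u \<omega>)"
    using Y a by (auto simp: continuous_adapted_def intro!: continuous_intros borel_measurable_times)
  have DM: "D s \<in> borel_measurable M" if "s \<in> {0..T}" for s
    using continuous_adapted_integral[OF Ya] that measurable_F_M[of "D s" s]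
    by (auto simp: continuous_finite_variation_def continuous_adapted_def D_def[abs_def])
  have AM: "(\<lambda>\<omega>. integral {0..t} (\<lambda>u. a u \<omega>)) \<in> borel_measurable M"
    using continuous_adapted_integral[OF a] t
    by (intro measurable_F_M[of _ t]) (auto simp: continuous_finite_variation_def continuous_adapted_def)
  have cont: "continuous_on {0..s} (\<lambda>u. f u \<omega>)"
    if "continuous_adapted M F T f" "s \<in> {0..T}" "\<omega> \<in> space M" for f :: "real \<Rightarrow> 'w \<Rightarrow> real" and s \<omega>
    using that by (auto simp: continuous_adapted_def intro: continuous_on_subset)
  have drift: "conv_prob M (\<lambda>n \<omega>. \<Sum>k<n. 1 / Y (p n k) \<omega> * (D (p n (Suc k)) \<omega> - D (p n k) \<omega>))
      (\<lambda>\<omega>. integral {0..t} (\<lambda>u. a u \<omega>)) sequentially"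
  proof (rule conv_prob_pointwise[OF _ AM])
    fix n
    show "(\<lambda>\<omega>. \<Sum>k<n. 1 / Y (p n k) \<omega> * (D (p n (Suc k)) \<omega> - D (p n k) \<omega>)) \<in> borel_measurable M"
      using p_mem by (intro borel_measurable_sum borel_measurable_times borel_measurable_diff
        borel_measurable_divide YM DM borel_measurable_const) auto
    fix \<omega> assume \<omega>: "\<omega> \<in> space M"
    show "(\<lambda>n. \<Sum>k<n. 1 / Y (p n k) \<omega> * (D (p n (Suc k)) \<omega> - D (p n k) \<omega>)) \<longlonglongrightarrow> integral {0..t} (\<lambda>u. a u \<omega>)"
      unfolding p_def D_def using pos \<omega> t by (intro drift_sum_tendsto cont[OF Y t \<omega>] cont[OF a t \<omega>]) auto
  qed
  have noise: "conv_prob M (\<lambda>n \<omega>. \<Sum>j\<in>UNIV. \<sigma> j * (\<Sum>k<n. 1 / Y (p n k) \<omega> * (Z (p n (Suc k)) j \<omega> - Z (p n k) j \<omega>)))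
      (\<lambda>\<omega>. \<Sum>j\<in>UNIV. \<sigma> j * (B t \<omega> $ j - B 0 \<omega> $ j)) sequentially"
    unfolding p_def by (intro conv_prob_sum conv_prob_cmult ito_integral_chain[OF Y pos t Z])
  have "conv_prob M (\<lambda>(n, p) \<omega>. \<Sum>k<n. 1 / Y (p k) \<omega> * (Y (p (Suc k)) \<omega> - Y (p k) \<omega>)) Rt (fine_partitions t)"
  proof (subst conv_prob_iff_limit_of_sums, goal_cases)
    case (1 n q)
    have "q l \<in> {0..T}" if "l \<le> n" for l
      using partition_of_bounds[OF 1 that] t by auto
    then show ?case
      by (intro borel_measurable_sum borel_measurable_times borel_measurable_diff
        borel_measurable_divide YM borel_measurable_const) auto
  qed (use Rt in \<open>simp add: has_ito_integral_def\<close>)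
  from conv_prob_filterlim[OF this filterlim_uniform_partition[OF t0]]
  have ret: "conv_prob M (\<lambda>n \<omega>. \<Sum>k<n. 1 / Y (p n k) \<omega> * (Y (p n (Suc k)) \<omega> - Y (p n k) \<omega>)) Rt sequentially"
    by (simp add: p_def)
  have "conv_prob M (\<lambda>n \<omega>. \<Sum>k<n. 1 / Y (p n k) \<omega> * (Y (p n (Suc k)) \<omega> - Y (p n k) \<omega>))
    (\<lambda>\<omega>. integral {0..t} (\<lambda>u. a u \<omega>) + (\<Sum>j\<in>UNIV. \<sigma> j * (B t \<omega> $ j - B 0 \<omega> $ j))) sequentially"
  proof (rule conv_prob_AE_cong[OF conv_prob_add[OF drift noise]])
    show "(\<lambda>\<omega>. integral {0..t} (\<lambda>u. a u \<omega>) + (\<Sum>j\<in>UNIV. \<sigma> j * (B t \<omega> $ j - B 0 \<omega> $ j))) \<in> borel_measurable M"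
      using conv_prob_measurable[OF conv_prob_add[OF drift noise]] .
    show "\<forall>\<^sub>F n in sequentially. (\<lambda>\<omega>. \<Sum>k<n. 1 / Y (p n k) \<omega> * (Y (p n (Suc k)) \<omega> - Y (p n k) \<omega>)) \<in> borel_measurable M \<and>
      (AE \<omega> in M. (\<Sum>k<n. 1 / Y (p n k) \<omega> * (Y (p n (Suc k)) \<omega> - Y (p n k) \<omega>)) =
        (\<Sum>k<n. 1 / Y (p n k) \<omega> * (D (p n (Suc k)) \<omega> - D (p n k) \<omega>)) +
        (\<Sum>j\<in>UNIV. \<sigma> j * (\<Sum>k<n. 1 / Y (p n k) \<omega> * (Z (p n (Suc k)) j \<omega> - Z (p n k) j \<omega>))))"
      using eventually_gt_at_top[of 0]
    proof eventually_elim
      case (elim n)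
      have meas: "(\<lambda>\<omega>. \<Sum>k<n. 1 / Y (p n k) \<omega> * (Y (p n (Suc k)) \<omega> - Y (p n k) \<omega>)) \<in> borel_measurable M"
        using p_mem elim
        by (intro borel_measurable_sum borel_measurable_times borel_measurable_diff
          borel_measurable_divide YM borel_measurable_const) auto
      \<comment> \<open>The exceptional null set depends on the time, but a grid has only finitely
        many points.\<close>
      have "AE \<omega> in M. \<forall>k\<in>{..n}. Y (p n k) \<omega> = Y 0 \<omega> + (LINT u:{0..p n k}|lborel. Y u \<omega> * a u \<omega>)
            + (\<Sum>j\<in>UNIV. \<sigma> j * Z (p n k) j \<omega>)"
        using p_mem elim by (intro AE_finite_allI sde) auto
      with AE_space[of M]
      have "AE \<omega> in M. (\<Sum>k<n. 1 / Y (p n k) \<omega> * (Y (p n (Suc k)) \<omega> - Y (p n k) \<omega>)) =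
        (\<Sum>k<n. 1 / Y (p n k) \<omega> * (D (p n (Suc k)) \<omega> - D (p n k) \<omega>)) +
        (\<Sum>j\<in>UNIV. \<sigma> j * (\<Sum>k<n. 1 / Y (p n k) \<omega> * (Z (p n (Suc k)) j \<omega> - Z (p n k) j \<omega>)))"
      proof eventually_elim
        case (elim \<omega>)
        have Yk: "Y (p n k) \<omega> = Y 0 \<omega> + D (p n k) \<omega> + (\<Sum>j\<in>UNIV. \<sigma> j * Z (p n k) j \<omega>)" if "k \<le> n" for k
        proof -
          have "(LINT u:{0..p n k}|lborel. Y u \<omega> * a u \<omega>) = D (p n k) \<omega>"
            unfolding D_def using cont[OF Ya p_mem[OF that \<open>0 < n\<close>] elim(1)]
            by (intro set_borel_integral_eq_integral borel_integrable_atLeastAtMost')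
          then show ?thesis using elim(2) that by simp
        qed
        have "(\<Sum>j\<in>UNIV. \<sigma> j * (\<Sum>k<n. 1 / Y (p n k) \<omega> * (Z (p n (Suc k)) j \<omega> - Z (p n k) j \<omega>))) =
            (\<Sum>k<n. 1 / Y (p n k) \<omega> * ((\<Sum>j\<in>UNIV. \<sigma> j * Z (p n (Suc k)) j \<omega>) - (\<Sum>j\<in>UNIV. \<sigma> j * Z (p n k) j \<omega>)))"
          unfolding sum_distrib_left sum_subtractf[symmetric]
          by (subst sum.swap) (simp add: algebra_simps)
        moreover have "(\<Sum>k<n. 1 / Y (p n k) \<omega> * (Y (p n (Suc k)) \<omega> - Y (p n k) \<omega>)) =
          (\<Sum>k<n. 1 / Y (p n k) \<omega> * (D (p n (Suc k)) \<omega> - D (p n k) \<omega>) + 1 / Y (p n k) \<omega> *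
            ((\<Sum>j\<in>UNIV. \<sigma> j * Z (p n (Suc k)) j \<omega>) - (\<Sum>j\<in>UNIV. \<sigma> j * Z (p n k) j \<omega>)))"
        proof (rule sum.cong[OF refl])
          fix k assume "k \<in> {..<n}"
          then have "Y (p n (Suc k)) \<omega> - Y (p n k) \<omega> = (D (p n (Suc k)) \<omega> - D (p n k) \<omega>) +
            ((\<Sum>j\<in>UNIV. \<sigma> j * Z (p n (Suc k)) j \<omega>) - (\<Sum>j\<in>UNIV. \<sigma> j * Z (p n k) j \<omega>))"
            using Yk[of k] Yk[of "Suc k"] by simp
          then show "1 / Y (p n k) \<omega> * (Y (p n (Suc k)) \<omega> - Y (p n k) \<omega>) =
            1 / Y (p n k) \<omega> * (D (p n (Suc k)) \<omega> - D (p n k) \<omega>) + 1 / Y (p n k) \<omega> *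
            ((\<Sum>j\<in>UNIV. \<sigma> j * Z (p n (Suc k)) j \<omega>) - (\<Sum>j\<in>UNIV. \<sigma> j * Z (p n k) j \<omega>))"
            by (simp only: distrib_left)
        qed
        ultimately show ?case by (simp only: sum.distrib)
      qed
      with meas show ?case by blast
    qed
  qed simp
  from conv_prob_AE_unique[OF ret this] show ?thesis by simp
qed

end

section \<open>Integrability with respect to the return process\<close>

text \<open>Lebesgue measure dominates both variations, with density \<alpha> for the drift and the
  constant \<Gamma> for the covariation, and continuous integrands are integrable on a compact
  interval.\<close>

lemma path_integrable_continuous:
  fixes h \<alpha> :: "real \<Rightarrow> real^'d" and \<Gamma> :: "real^'d^'d"
  assumes h: "\<And>i. continuous_on {0..T} (\<lambda>u. h u $ i)" and \<alpha>: "\<And>i. continuous_on {0..T} (\<lambda>u. \<alpha> u $ i)"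
  shows "path_integrable T h (\<lambda>t. \<chi> i. integral {0..t} (\<lambda>u. \<alpha> u $ i)) (\<lambda>t. t *\<^sub>R \<Gamma>)"
proof -
  \<comment> \<open>\<open>path_integrable\<close> asks for a finite measure on the Borel sets of
    the whole line, so Lebesgue measure is cut off to \<open>{0<..T}\<close>.\<close>
  define \<mu> where "\<mu> = density lborel (\<lambda>u. ennreal (indicator {0<..T} u))"
  have I: "set_integrable \<mu> {0<..T} f \<and> (\<forall>t\<in>{0..T}. integral {0..t} f = (LINT u:{0<..t}|\<mu>. f u))"
    if f: "continuous_on {0..T} f" for f :: "real \<Rightarrow> real"
  proof -
    have "set_integrable lborel {0..T} f" using f by (rule borel_integrable_atLeastAtMost')
    then have int: "set_integrable lborel {0<..t} f" if "t \<le> T" for t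
      by (rule set_integrable_subset) (use that in auto)
    then have m: "(\<lambda>u. indicator {0<..t} u *\<^sub>R f u) \<in> borel_measurable lborel" if "t \<le> T" for t
      using that by (auto simp: set_integrable_def)
    have ind: "(\<lambda>u. indicator {0<..T} u *\<^sub>R indicator {0<..t} u *\<^sub>R f u) = (\<lambda>u. indicator {0<..t} u *\<^sub>R f u)" if "t \<le> T" for t
      using that by (auto simp: indicator_def)
    have "set_integrable \<mu> {0<..T} f"
      using integrable_density[of "\<lambda>u. indicator {0<..T} u *\<^sub>R f u" lborel "indicator {0<..T}"] m[of T] int[of T]
      unfolding set_integrable_def \<mu>_def ind[OF order_refl] by simp
    moreover have "integral {0..t} f = (LINT u:{0<..t}|\<mu>. f u)" if t: "t \<in> {0..T}" for t
    proof -
      have "(LINT u:{0<..t}|\<mu>. f u) = (LINT u:{0<..t}|lborel. f u)"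
        using integral_density[of "\<lambda>u. indicator {0<..t} u *\<^sub>R f u" lborel "indicator {0<..T}"] m[of t] ind[of t] t
        unfolding set_lebesgue_integral_def \<mu>_def by simp
      also have "\<dots> = integral {0<..t} f"
        using int[of t] t by (intro set_borel_integral_eq_integral) auto
      also have "\<dots> = integral {0..t} f"
        by (rule integral_spike_set) (auto intro: negligible_subset[of "{0}"])
      finally show ?thesis by simp
    qed
    ultimately show ?thesis by blast
  qed
  have "emeasure \<mu> (space \<mu>) = (\<integral>\<^sup>+u. indicator {0<..T} u \<partial>lborel)"
    by (simp add: \<mu>_def emeasure_density ennreal_indicator)
  also have "\<dots> < \<infinity>" by (cases "0 \<le> T") auto
  finally have fin: "finite_measure \<mu>" by (intro finite_measureI) simp
  have \<Gamma>t: "(t *\<^sub>R \<Gamma>) $ i $ j = integral {0..t} (\<lambda>_. \<Gamma> $ i $ j)" if "t \<in> {0..T}" for t i j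
    using that by simp
  have "set_integrable \<mu> {0<..T} (\<lambda>u. h u \<bullet> \<alpha> u)"
    using I[of "\<lambda>u. h u \<bullet> \<alpha> u"] h \<alpha> by (simp add: inner_vec_def continuous_intros)
  moreover have "set_integrable \<mu> {0<..T} (\<lambda>u. h u \<bullet> (\<Gamma> *v h u))"
    using I[of "\<lambda>u. h u \<bullet> (\<Gamma> *v h u)"] h by (simp add: inner_vec_def matrix_vector_mult_def continuous_intros)
  ultimately show ?thesis
    unfolding path_integrable_def using fin I[OF \<alpha>] I[OF continuous_on_const] \<Gamma>t
    by (intro exI[of _ \<mu>] exI[of _ \<alpha>] exI[of _ "\<lambda>_. \<Gamma>"]) (simp add: \<mu>_def)
qed

text \<open>Turns an identity that holds almost surely at each time into one for all times
  simultaneously: the null sets of countably many rational times can be united, and continuity fills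
  in the rest.\<close>

lemma continuous_zero_on_Icc:
  fixes f :: "real \<Rightarrow> real"
  assumes "continuous_on {0..T} f" "0 < T" "\<And>t. t \<in> {0<..<T} \<inter> \<rat> \<Longrightarrow> f t = 0" "t \<in> {0..T}"
  shows "f t = 0"
proof -
  have "closure ({0<..<T} \<inter> \<rat>) = closure {0<..<T}"
    by (rule closure_open_Int_superset) (auto simp: Rats_closure_real)
  also have "\<dots> = {0..T}" using \<open>0 < T\<close> by simp
  finally have *: "closure ({0<..<T} \<inter> \<rat>) = {0..T}" .
  show ?thesis
    by (rule continuous_constant_on_closure[of "{0<..<T} \<inter> \<rat>"]) (use assms * in auto)
qed

context filtered_space
begin

lemma martingale_sum:
  assumes "\<And>j. martingale M F T (X j)"
  shows "martingale M F T (\<lambda>t \<omega>. \<Sum>j\<in>J. c j * X j t \<omega>)"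
  unfolding martingale_def
proof (intro conjI ballI)
  fix s assume s: "s \<in> {0..T}"
  show "(\<lambda>\<omega>. \<Sum>j\<in>J. c j * X j s \<omega>) \<in> borel_measurable (F s)"
    using assms s by (intro borel_measurable_sum borel_measurable_times) (auto simp: martingale_def)
  show "integrable M (\<lambda>\<omega>. \<Sum>j\<in>J. c j * X j s \<omega>)"
    using assms s by (intro Bochner_Integration.integrable_sum integrable_mult_right) (auto simp: martingale_def)
  fix t assume t: "t \<in> {s..T}"
  interpret finite_measure_subalgebra M "F s"
    by unfold_locales (rule subalg)
  have int: "integrable M (X j t)" for j using assms s t by (auto simp: martingale_def)
  have each: "AE \<omega> in M. real_cond_exp M (F s) (\<lambda>\<omega>. c j * X j t \<omega>) \<omega> = c j * X j s \<omega>" for j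
  proof -
    have "AE \<omega> in M. real_cond_exp M (F s) (X j t) \<omega> = X j s \<omega>"
      using assms s t by (auto simp: martingale_def)
    with real_cond_exp_cmult[OF int[of j], of "c j"] show ?thesis by eventually_elim simp
  qed
  have sum: "AE \<omega> in M. real_cond_exp M (F s) (\<lambda>\<omega>. \<Sum>j\<in>J. c j * X j t \<omega>) \<omega> =
      (\<Sum>j\<in>J. real_cond_exp M (F s) (\<lambda>\<omega>. c j * X j t \<omega>) \<omega>)"
    using int by (intro real_cond_exp_sum) simp
  show "AE \<omega> in M. real_cond_exp M (F s) (\<lambda>\<omega>. \<Sum>j\<in>J. c j * X j t \<omega>) \<omega> = (\<Sum>j\<in>J. c j * X j s \<omega>)"
  proof (cases "finite J")
    case True
    then have "AE \<omega> in M. \<forall>j\<in>J. real_cond_exp M (F s) (\<lambda>\<omega>. c j * X j t \<omega>) \<omega> = c j * X j s \<omega>"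
      using each by (intro AE_finite_allI)
    with sum show ?thesis by eventually_elim simp
  qed (use sum in simp)
qed

text \<open>\<open>is_signature\<close> records continuity for nonempty words only. The empty word
  is the constant 1 on the relevant times and outcomes, so it has to be transferred by
  congruence.\<close>

lemma signature_continuous_adapted:
  assumes "is_signature M F T Xh Sg"
  shows "continuous_adapted M F T (Sg I)"
proof (cases I rule: rev_cases)
  case Nil
  have Sg: "Sg [] t \<omega> = 1" if "t \<in> {0..T}" "\<omega> \<in> space M" for t \<omega>
    using assms that by (simp add: is_signature_def)
  have "Sg [] t \<in> borel_measurable (F t)" if "t \<in> {0..T}" for t
    using measurable_cong[of "F t" "Sg [] t" "\<lambda>_. 1" borel] Sg[OF that] by (simp add: space_F)
  moreover have "continuous_on {0..T} (\<lambda>t. Sg [] t \<omega>)" if "\<omega> \<in> space M" for \<omega>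
    using continuous_on_cong[of "{0..T}" "{0..T}" "\<lambda>t. Sg [] t \<omega>" "\<lambda>_. 1"] Sg[OF _ that] by simp
  ultimately show ?thesis by (simp add: Nil continuous_adapted_def)
qed (use assms in \<open>auto simp: is_signature_def\<close>)

lemma sig_linear_continuous_adapted:
  assumes "is_signature M F T Xh Sg"
  shows "continuous_adapted M F T (sig_linear Sg K l)"
  using signature_continuous_adapted[OF assms]
  unfolding continuous_adapted_def sig_linear_def
  by (auto intro!: borel_measurable_sum borel_measurable_times continuous_intros)

end

context brownian
begin

lemma linear_combination_local_martingale:
  "continuous_local_martingale M F T (\<lambda>t \<omega>. \<Sum>j\<in>UNIV. c j * (B t \<omega> $ j - B 0 \<omega> $ j))" (is "continuous_local_martingale M F T ?N")
  unfolding continuous_local_martingale_def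
\<comment> \<open>The process is a true martingale, so the constant time \<open>T\<close> localises
  it.\<close>
proof (intro conjI exI[of _ "\<lambda>_ _. T"])
  show "continuous_adapted M F T ?N"
    unfolding continuous_adapted_def using T_pos
    by (auto intro!: borel_measurable_sum borel_measurable_times borel_measurable_diff B_component_adapted
        continuous_intros B_continuous)
  have "martingale M F T ?N" by (intro martingale_sum component_martingale)
  then have "martingale M F T (\<lambda>t \<omega>. ?N (min t T) \<omega> - ?N 0 \<omega>)"
    unfolding martingale_def by (simp add: min_def)
  then show "\<forall>n::nat. martingale M F T (\<lambda>t \<omega>. ?N (min t T) \<omega> - ?N 0 \<omega>)" by blast
qed (use T_pos in \<open>auto intro: stopping_time_const\<close>)

text \<open>Bilinearity is used on the sums before the limit; by \<open>brownian_covariation\<close>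
  only the diagonal pairs of coordinates survive.\<close>

lemma linear_combination_covariation:
  assumes t: "t \<in> {0..T}"
  shows "has_covariation M (\<lambda>t \<omega>. \<Sum>j\<in>UNIV. c j * (B t \<omega> $ j - B 0 \<omega> $ j))
    (\<lambda>t \<omega>. \<Sum>j\<in>UNIV. d j * (B t \<omega> $ j - B 0 \<omega> $ j)) t (\<lambda>\<omega>. t * (\<Sum>j\<in>UNIV. c j * d j))"
proof -
  define V where "V x \<omega> = (case x of (n, p) \<Rightarrow> \<lambda>a b. \<Sum>k<n. (B (p (Suc k)) \<omega> $ a - B (p k) \<omega> $ a) * (B (p (Suc k)) \<omega> $ b - B (p k) \<omega> $ b))"
    for x :: "nat \<times> (nat \<Rightarrow> real)" and \<omega>
  have mem: "p k \<in> {0..T}" if "partition_of t n p" "k \<le> n" for n p k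
    using partition_of_bounds[OF that] t by auto
  have Vm: "(\<lambda>\<omega>. V (n, p) \<omega> a b) \<in> borel_measurable M" if "partition_of t n p" for n p a b
    using that by (auto simp: V_def intro!: borel_measurable_sum borel_measurable_times
        borel_measurable_diff B_component_measurable mem)
  have V: "conv_prob M (\<lambda>x \<omega>. V x \<omega> a b) (\<lambda>\<omega>. if a = b then t else 0) (fine_partitions t)" for a b
  proof -
    have "conv_prob M (\<lambda>(n, p) \<omega>. \<Sum>k<n. (B (p (Suc k)) \<omega> $ a - B (p k) \<omega> $ a) * (B (p (Suc k)) \<omega> $ b - B (p k) \<omega> $ b))
      (\<lambda>\<omega>. if a = b then t else 0) (fine_partitions t)"
      using brownian_covariation[OF t, of a b] unfolding has_covariation_def
      by (subst conv_prob_iff_limit_of_sums)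
         (auto intro!: borel_measurable_sum borel_measurable_times borel_measurable_diff B_component_measurable mem)
    then show ?thesis by (simp add: V_def case_prod_unfold)
  qed
  have sum: "conv_prob M (\<lambda>x \<omega>. \<Sum>a\<in>UNIV. \<Sum>b\<in>UNIV. (c a * d b) * V x \<omega> a b)
      (\<lambda>\<omega>. \<Sum>a\<in>UNIV. \<Sum>b\<in>UNIV. (c a * d b) * (if a = b then t else 0)) (fine_partitions t)"
    by (intro conv_prob_sum conv_prob_cmult V)
  have lim: "(\<Sum>a\<in>UNIV. \<Sum>b\<in>UNIV. (c a * d b) * (if a = b then t else 0)) = t * (\<Sum>j\<in>UNIV. c j * d j)"
    by (simp add: if_distrib[of "\<lambda>x. _ * x"] sum_distrib_left mult_ac cong: if_cong)
  have incr: "(\<Sum>j\<in>UNIV. e j * (B v \<omega> $ j - B 0 \<omega> $ j)) - (\<Sum>j\<in>UNIV. e j * (B u \<omega> $ j - B 0 \<omega> $ j)) =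
      (\<Sum>j\<in>UNIV. e j * (B v \<omega> $ j - B u \<omega> $ j))" for e :: "'m \<Rightarrow> real" and u v \<omega>
    by (simp add: sum_subtractf[symmetric] algebra_simps)
  have expand: "(\<Sum>k<n. (\<Sum>j\<in>UNIV. c j * (B (p (Suc k)) \<omega> $ j - B (p k) \<omega> $ j)) * (\<Sum>j\<in>UNIV. d j * (B (p (Suc k)) \<omega> $ j - B (p k) \<omega> $ j))) =
      (\<Sum>a\<in>UNIV. \<Sum>b\<in>UNIV. (c a * d b) * V (n, p) \<omega> a b)" for n p \<omega>
  proof -
    have "(\<Sum>k<n. (\<Sum>j\<in>UNIV. c j * (B (p (Suc k)) \<omega> $ j - B (p k) \<omega> $ j)) * (\<Sum>j\<in>UNIV. d j * (B (p (Suc k)) \<omega> $ j - B (p k) \<omega> $ j))) =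
      (\<Sum>k<n. \<Sum>a\<in>UNIV. \<Sum>b\<in>UNIV. (c a * d b) * ((B (p (Suc k)) \<omega> $ a - B (p k) \<omega> $ a) * (B (p (Suc k)) \<omega> $ b - B (p k) \<omega> $ b)))"
      by (simp only: sum_product mult_ac)
    also have "\<dots> = (\<Sum>a\<in>UNIV. \<Sum>k<n. \<Sum>b\<in>UNIV. (c a * d b) * ((B (p (Suc k)) \<omega> $ a - B (p k) \<omega> $ a) * (B (p (Suc k)) \<omega> $ b - B (p k) \<omega> $ b)))"
      by (rule sum.swap)
    also have "\<dots> = (\<Sum>a\<in>UNIV. \<Sum>b\<in>UNIV. \<Sum>k<n. (c a * d b) * ((B (p (Suc k)) \<omega> $ a - B (p k) \<omega> $ a) * (B (p (Suc k)) \<omega> $ b - B (p k) \<omega> $ b)))"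
      by (intro sum.cong refl sum.swap)
    finally show ?thesis by (simp add: V_def sum_distrib_left)
  qed
  show ?thesis
    unfolding has_covariation_def
    using sum lim
    by (subst conv_prob_iff_limit_of_sums[symmetric])
       (auto simp: incr expand case_prod_unfold intro!: borel_measurable_sum borel_measurable_times Vm)
qed

text \<open>The witnesses are \<open>N = Sig (B - B 0)\<close>, the pathwise integral
  \<open>A\<close> of \<open>a\<close>, and \<open>t\<close> times
  \<open>Sig ** transpose Sig\<close> for the covariation, so integrability reduces to
  \<open>path_integrable_continuous\<close> on every path.\<close>

lemma integrable_wrt_return:
  fixes S R a H :: "real \<Rightarrow> 'w \<Rightarrow> real^'d" and Sig :: "real^'m^'d"
  assumes S: "\<And>i. continuous_adapted M F T (\<lambda>t \<omega>. S t \<omega> $ i)"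
    and pos: "\<And>i s \<omega>. s \<in> {0..T} \<Longrightarrow> \<omega> \<in> space M \<Longrightarrow> 0 < S s \<omega> $ i"
    and a: "\<And>i. continuous_adapted M F T (\<lambda>t \<omega>. a t \<omega> $ i)"
    and sde: "solves_market_sde M T a Sig B S"
    and R: "return_process M F T S R"
    and H: "\<And>i. continuous_adapted M F T (\<lambda>t \<omega>. H t \<omega> $ i)"
  shows "integrable_wrt M F T H R"
proof -
  define N :: "real \<Rightarrow> 'w \<Rightarrow> real^'d" where "N t \<omega> = (\<chi> i. \<Sum>j\<in>UNIV. Sig $ i $ j * (B t \<omega> $ j - B 0 \<omega> $ j))" for t \<omega>
  define A :: "real \<Rightarrow> 'w \<Rightarrow> real^'d" where "A t \<omega> = (\<chi> i. integral {0..t} (\<lambda>u. a u \<omega> $ i))" for t \<omega>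
  have Rc: "continuous_adapted M F T (\<lambda>t \<omega>. R t \<omega> $ i)" for i
    using R by (intro continuous_adapted_component) (simp add: return_process_def)
  have N: "continuous_local_martingale M F T (\<lambda>t \<omega>. N t \<omega> $ i)" for i
    using linear_combination_local_martingale[of "\<lambda>j. Sig $ i $ j"] by (simp add: N_def)
  have A: "continuous_finite_variation M F T (\<lambda>t \<omega>. A t \<omega> $ i)" for i
    using continuous_adapted_integral[OF a] by (simp add: A_def)
  have Rt: "AE \<omega> in M. R t \<omega> $ i = A t \<omega> $ i + N t \<omega> $ i" if t: "t \<in> {0..T}" for t i
  proof -
    have "\<forall>s\<in>{0..T}. \<exists>Z :: 'm \<Rightarrow> 'w \<Rightarrow> real. (\<forall>j. has_ito_integral M (\<lambda>t \<omega>. S t \<omega> $ i) (\<lambda>t \<omega>. B t \<omega> $ j) s (Z j)) \<and>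
        (AE \<omega> in M. S s \<omega> $ i = S 0 \<omega> $ i + (LINT u:{0..s}|lborel. S u \<omega> $ i * a u \<omega> $ i)
            + (\<Sum>j\<in>UNIV. Sig $ i $ j * Z j \<omega>))"
      using sde by (simp add: solves_market_sde_def)
    then obtain Z :: "real \<Rightarrow> 'm \<Rightarrow> 'w \<Rightarrow> real" where
      Z: "\<And>s j. s \<in> {0..T} \<Longrightarrow> has_ito_integral M (\<lambda>t \<omega>. S t \<omega> $ i) (\<lambda>t \<omega>. B t \<omega> $ j) s (Z s j)"
        "\<And>s. s \<in> {0..T} \<Longrightarrow> AE \<omega> in M. S s \<omega> $ i = S 0 \<omega> $ i + (LINT u:{0..s}|lborel. S u \<omega> $ i * a u \<omega> $ i)
            + (\<Sum>j\<in>UNIV. Sig $ i $ j * Z s j \<omega>)"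
      by (subst (asm) bchoice_iff) blast
    have "has_ito_integral M (\<lambda>t \<omega>. 1 / S t \<omega> $ i) (\<lambda>t \<omega>. S t \<omega> $ i) t (\<lambda>\<omega>. R t \<omega> $ i)"
      using R t by (simp add: return_process_def)
    from return_component_AE[OF S pos a t Z this] show ?thesis by (simp add: A_def N_def)
  qed
  have R: "AE \<omega> in M. \<forall>t\<in>{0..T}. R t \<omega> $ i = R 0 \<omega> $ i + N t \<omega> $ i + A t \<omega> $ i" for i
  proof -
    have "AE \<omega> in M. \<forall>t\<in>{0<..<T} \<inter> \<rat>. R t \<omega> $ i = A t \<omega> $ i + N t \<omega> $ i"
      using Rt by (subst AE_ball_countable) (auto simp: countable_rat)
    \<comment> \<open>The identity at time 0, where both parts vanish. It reconciles
      \<open>Rt\<close>, which has no initial value, with the form of the decomposition.\<close>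
    moreover have "AE \<omega> in M. R 0 \<omega> $ i = 0"
      using Rt[of 0 i] T_pos by (simp add: A_def N_def)
    moreover note AE_space[of M]
    ultimately show ?thesis
    proof eventually_elim
      case (elim \<omega>)
      have "continuous_on {0..T} (\<lambda>t. R t \<omega> $ i - (A t \<omega> $ i + N t \<omega> $ i))"
        using Rc[of i] A[of i] N[of i] elim(3)
        by (intro continuous_on_diff continuous_on_add)
           (auto simp: continuous_finite_variation_def continuous_local_martingale_def continuous_adapted_def)
      from continuous_zero_on_Icc[OF this T_pos] elim show ?case by force
    qed
  qed
  have dec: "semimartingale_decomposition M F T (\<lambda>t \<omega>. R t \<omega> $ i) (\<lambda>t \<omega>. N t \<omega> $ i) (\<lambda>t \<omega>. A t \<omega> $ i)" for i
    unfolding semimartingale_decomposition_def using N A R by (simp add: N_def A_def)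
  let ?C = "\<lambda>t \<omega>. t *\<^sub>R (Sig ** transpose Sig)"
  have C: "continuous_finite_variation M F T (\<lambda>t \<omega>. ?C t \<omega> $ i $ j)" for i j
  proof -
    define \<kappa> where "\<kappa> = (Sig ** transpose Sig) $ i $ j"
    have "finite_variation T (\<lambda>t. t * \<kappa>)"
      by (rule lipschitz_finite_variation[where K="\<bar>\<kappa>\<bar>"])
         (simp add: left_diff_distrib[symmetric] abs_mult mult.commute)
    then show ?thesis
      by (auto simp: continuous_finite_variation_def continuous_adapted_def \<kappa>_def intro!: continuous_intros)
  qed
  have cov: "has_covariation M (\<lambda>t \<omega>. N t \<omega> $ i) (\<lambda>t \<omega>. N t \<omega> $ j) t (\<lambda>\<omega>. ?C t \<omega> $ i $ j)" if "t \<in> {0..T}" for t i j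
    using linear_combination_covariation[OF that, of "\<lambda>k. Sig $ i $ k" "\<lambda>k. Sig $ j $ k"]
    by (simp add: N_def matrix_matrix_mult_def transpose_def)
  have path: "AE \<omega> in M. path_integrable T (\<lambda>t. H t \<omega>) (\<lambda>t. A t \<omega>) (\<lambda>t. ?C t \<omega>)"
  proof (rule AE_I2)
    fix \<omega> assume "\<omega> \<in> space M"
    then show "path_integrable T (\<lambda>t. H t \<omega>) (\<lambda>t. A t \<omega>) (\<lambda>t. ?C t \<omega>)"
      unfolding A_def using H a by (intro path_integrable_continuous) (auto simp: continuous_adapted_def)
  qed
  show ?thesis
    unfolding integrable_wrt_def using continuous_adapted_predictable[OF H] dec C cov path
    by (intro conjI allI exI[of _ N] exI[of _ A] exI[of _ ?C] ballI) auto
qed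

end

section \<open>The growth-optimal portfolio\<close>

lemma matrix_times_transpose_inner:
  fixes S :: "real^'m^'d"
  shows "x \<bullet> ((S ** transpose S) *v y) = (transpose S *v x) \<bullet> (transpose S *v y)"
  by (simp add: matrix_vector_mul_assoc[symmetric] dot_lmul_matrix)

text \<open>Lagrange multipliers: a maximiser satisfies
  \<open>A *v x = a - \<mu> *\<^sub>R e\<close> with the all-ones vector \<open>e\<close>, so it is
  affine in \<open>a\<close>, and \<open>P\<close> and \<open>q\<close> depend on \<open>S\<close>
  alone. Completing the square shows that this point is the unique maximiser.\<close>

lemma constrained_quadratic_maximizer:
  fixes S :: "real^'m^'d"
  assumes inv: "invertible (S ** transpose S)"
  defines "g \<equiv> \<lambda>a x. x \<bullet> a - (1/2) * (x \<bullet> ((S ** transpose S) *v x))"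
  obtains P :: "real^'d^'d" and q :: "real^'d" where
    "\<And>a. (\<Sum>i\<in>UNIV. (P *v a + q) $ i) = 1"
    "\<And>a x. (\<Sum>i\<in>UNIV. x $ i) = 1 \<Longrightarrow> g a x \<le> g a (P *v a + q)"
    "\<And>a x. (\<Sum>i\<in>UNIV. x $ i) = 1 \<Longrightarrow> g a x = g a (P *v a + q) \<Longrightarrow> x = P *v a + q"
proof -
  define A where "A = S ** transpose S"
  define Q where "Q = matrix_inv A"
  define e :: "real^'d" where "e = 1"
  define u where "u = Q *v e"
  \<comment> \<open>The coefficient of the multiplier in the constraint. It is nonzero because it
    equals the squared length of \<open>transpose S *v u\<close>, and \<open>transpose S\<close> is
    injective.\<close>
  define c where "c = e \<bullet> u"
  have "A ** Q = mat 1"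
    using inv unfolding A_def Q_def invertible_def matrix_inv_def by (rule someI2_ex) auto
  then have AQ: "A *v (Q *v x) = x" for x
    by (simp add: matrix_vector_mul_assoc)
  have A0: "x = 0" if "A *v x = 0" for x
    using inv that unfolding A_def[symmetric] by (metis invertible_def matrix_left_invertible_ker)
  have e_inner: "e \<bullet> x = (\<Sum>i\<in>UNIV. x $ i)" for x
    by (simp add: inner_vec_def e_def)
  have e0: "e \<noteq> 0" by (simp add: e_def)
  have S0: "x = 0" if "transpose S *v x = 0" for x
    using that A0[of x] by (simp add: A_def matrix_vector_mul_assoc[symmetric])
  have "c = (transpose S *v u) \<bullet> (transpose S *v u)"
    using matrix_times_transpose_inner[of u S u] AQ[of e] by (simp add: c_def u_def A_def inner_commute)
  moreover have "u \<noteq> 0" using AQ[of e] e0 by (auto simp: u_def)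
  ultimately have c: "c \<noteq> 0" using S0[of u] by auto
  \<comment> \<open>The factor of \<open>u\<close> is the multiplier, chosen so that the entries of
    \<open>f a\<close> sum to 1.\<close>
  define f where "f a = Q *v a - ((e \<bullet> (Q *v a) - 1) / c) *\<^sub>R u" for a
  \<comment> \<open>A rank one correction of the inverse: the subtracted matrix sends
    \<open>a\<close> to \<open>u\<close> scaled by \<open>e \<bullet> (Q *v a)\<close> over
    \<open>c\<close>.\<close>
  define P where "P = Q - (1 / c) *\<^sub>R (\<chi> i j. u $ i * (e v* Q) $ j)"
  have f_affine: "f a = P *v a + (1 / c) *\<^sub>R u" for a
  proof -
    have "(\<chi> i j. u $ i * (e v* Q) $ j) *v a = ((e v* Q) \<bullet> a) *\<^sub>R u"
      by (simp add: vec_eq_iff matrix_vector_mult_def inner_vec_def sum_distrib_left mult_ac)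
    then show ?thesis
      by (simp add: f_def P_def matrix_vector_mult_diff_rdistrib scaleR_matrix_vector_assoc[symmetric]
          dot_lmul_matrix diff_divide_distrib scaleR_diff_left)
  qed
  have f_sum: "e \<bullet> f a = 1" for a
    using c by (simp add: f_def inner_diff_right c_def[symmetric])
  have gap: "g a x = g a (f a) - (1/2) * ((transpose S *v (x - f a)) \<bullet> (transpose S *v (x - f a)))"
    if "e \<bullet> x = 1" for a x
  proof -
    define d where "d = x - f a"
    define \<mu> where "\<mu> = (e \<bullet> (Q *v a) - 1) / c"
    have ed: "e \<bullet> d = 0" using that f_sum[of a] by (simp add: d_def inner_diff_right)
    have Af: "A *v f a = a - \<mu> *\<^sub>R e"
      using AQ[of a] AQ[of e]
      by (simp add: f_def \<mu>_def[symmetric] u_def matrix_vector_mult_diff_distrib matrix_vector_mult_scaleR)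
    have x: "x = f a + d" by (simp add: d_def)
    have sym: "f a \<bullet> (A *v d) = d \<bullet> (A *v f a)"
      using matrix_times_transpose_inner[of "f a" S d] matrix_times_transpose_inner[of d S "f a"]
      by (simp add: A_def inner_commute)
    have "g a x = g a (f a) + d \<bullet> a - d \<bullet> (A *v f a) - (1/2) * (d \<bullet> (A *v d))"
      unfolding g_def A_def[symmetric] x
      by (simp add: matrix_vector_right_distrib inner_add_left inner_add_right sym algebra_simps)
    \<comment> \<open>\<open>A *v f a\<close> differs from \<open>a\<close> by a multiple of
      \<open>e\<close>, and \<open>d\<close> is orthogonal to \<open>e\<close> since both points
      satisfy the constraint. The linear term of the expansion therefore cancels.\<close>
    also have "d \<bullet> (A *v f a) = d \<bullet> a"
      using ed by (simp add: Af inner_diff_right inner_commute)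
    finally show ?thesis
      using matrix_times_transpose_inner[of d S d] by (simp add: d_def A_def)
  qed
  show ?thesis
  proof (rule that[of P "(1 / c) *\<^sub>R u"], unfold f_affine[symmetric])
    show "(\<Sum>i\<in>UNIV. f a $ i) = 1" for a
      using f_sum by (simp add: e_inner)
    show "g a x \<le> g a (f a)" if "(\<Sum>i\<in>UNIV. x $ i) = 1" for a x
      using gap[of x a] that by (simp add: e_inner)
    show "x = f a" if "(\<Sum>i\<in>UNIV. x $ i) = 1" "g a x = g a (f a)" for a x
      using gap[of x a] that S0[of "x - f a"] by (simp add: e_inner)
  qed
qed

section \<open>Affine images of linear functions on the signature\<close>

text \<open>The additive constant becomes the coefficient of the empty word, which is among the
  words of length at most \<open>K\<close> for every \<open>K\<close>. The degree of the drift is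
  thus kept.\<close>

lemma sig_linear_affine:
  fixes Sg :: "'l::finite list \<Rightarrow> real \<Rightarrow> 'w \<Rightarrow> real"
  shows "sig_linear Sg K (\<lambda>I. (\<Sum>j\<in>J. p j * \<alpha> j I) + (if I = [] then q else 0)) t \<omega> =
    (\<Sum>j\<in>J. p j * sig_linear Sg K (\<alpha> j) t \<omega>) + q * Sg [] t \<omega>"
proof -
  have fin: "finite {I :: 'l list. length I \<le> K}"
    using finite_lists_length_le[of "UNIV :: 'l set" K] by simp
  have "(\<Sum>I | length I \<le> K. (if I = [] then q else 0) * Sg I t \<omega>) = q * Sg [] t \<omega>"
    using sum.delta[OF fin, of "[]" "\<lambda>I. q * Sg I t \<omega>"]
    by (simp add: if_distrib[of "\<lambda>x. x * _"] cong: if_cong)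
  moreover have "(\<Sum>I | length I \<le> K. (\<Sum>j\<in>J. p j * \<alpha> j I) * Sg I t \<omega>) = (\<Sum>j\<in>J. p j * sig_linear Sg K (\<alpha> j) t \<omega>)"
    unfolding sig_linear_def sum_distrib_right sum_distrib_left
    by (subst sum.swap) (simp add: mult.assoc)
  ultimately show ?thesis by (simp add: sig_linear_def distrib_right sum.distrib)
qed

lemma sig_linear_scale: "sig_linear Sg K l t \<omega> / c = sig_linear Sg K (\<lambda>I. l I / c) t \<omega>"
  by (simp add: sig_linear_def sum_divide_distrib)

theorem theorem4p8:
  fixes M :: "'w measure" and F :: "real \<Rightarrow> 'w measure" and T :: real
    and \<phi> :: "real \<Rightarrow> real"
    and X :: "real \<Rightarrow> 'w \<Rightarrow> real^'n"
    and Sg :: "'n option list \<Rightarrow> real \<Rightarrow> 'w \<Rightarrow> real"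
    and S R :: "real \<Rightarrow> 'w \<Rightarrow> real^'d"
    and B :: "real \<Rightarrow> 'w \<Rightarrow> real^'m"
    and Sig :: "real^'m^'d"
    and K :: nat and \<alpha> :: "'d \<Rightarrow> 'n option list \<Rightarrow> real"
  assumes "filtered_prob_space M F T"
    and "continuous_on {0..T} \<phi>" and "strict_mono_on {0..T} \<phi>"
    and "\<forall>j. continuous_semimartingale M F T (\<lambda>t \<omega>. X t \<omega> $ j)"
    and "is_signature M F T (time_augmented \<phi> X) Sg"
    and "\<forall>i. continuous_semimartingale M F T (\<lambda>t \<omega>. S t \<omega> $ i)"
    and "\<forall>i. \<forall>t\<in>{0..T}. \<forall>\<omega>\<in>space M. 0 < S t \<omega> $ i"
    and "brownian_motion M F T B"
    and "CARD('d) \<le> CARD('m)"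
    and "invertible (Sig ** transpose Sig)"
    and "solves_market_sde M T (sig_drift Sg K \<alpha>) Sig B S"
    and "return_process M F T S R"
  shows "\<exists>\<pi>. growth_optimal M F T R (sig_drift Sg K \<alpha>) Sig \<pi> \<and>
      (\<forall>\<rho>. growth_optimal M F T R (sig_drift Sg K \<alpha>) Sig \<rho> \<longrightarrow>
         (AE (t, \<omega>) in dt_prod M T. \<rho> t \<omega> = \<pi> t \<omega>)) \<and>
      (\<forall>\<tau>. auxiliary_portfolio M F T R \<tau> \<longrightarrow> sig_portfolio_II M F T R Sg \<tau> \<pi>) \<and>
      (\<forall>c :: real^'d. auxiliary_portfolio M F T R (\<lambda>t \<omega>. c) \<and> (\<forall>i. c $ i \<noteq> 0) \<longrightarrow>
         sig_portfolio_I M F T R Sg (\<lambda>t \<omega>. c) \<pi>)"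
proof -
  interpret prob_space M
    using assms(1) by (simp add: filtered_prob_space_def)
  interpret brownian M F T B
    using assms by unfold_locales
  obtain P :: "real^'d^'d" and q :: "real^'d" where
    opt_sum: "\<And>a. (\<Sum>i\<in>UNIV. (P *v a + q) $ i) = 1" and
    opt_le: "\<And>a x. (\<Sum>i\<in>UNIV. x $ i) = 1 \<Longrightarrow>
      x \<bullet> a - (1/2) * (x \<bullet> ((Sig ** transpose Sig) *v x)) \<le>
      (P *v a + q) \<bullet> a - (1/2) * ((P *v a + q) \<bullet> ((Sig ** transpose Sig) *v (P *v a + q)))" and
    opt_unique: "\<And>a x. (\<Sum>i\<in>UNIV. x $ i) = 1 \<Longrightarrow>
      x \<bullet> a - (1/2) * (x \<bullet> ((Sig ** transpose Sig) *v x)) =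
      (P *v a + q) \<bullet> a - (1/2) * ((P *v a + q) \<bullet> ((Sig ** transpose Sig) *v (P *v a + q))) \<Longrightarrow> x = P *v a + q"
    using constrained_quadratic_maximizer[OF assms(10)] by metis
  define l where "l i I = (\<Sum>j\<in>UNIV. P $ i $ j * \<alpha> j I) + (if I = [] then q $ i else 0)" for i I
  define \<pi> :: "real \<Rightarrow> 'w \<Rightarrow> real^'d" where "\<pi> t \<omega> = (\<chi> i. sig_linear Sg K (l i) t \<omega>)" for t \<omega>
  let ?a = "sig_drift Sg K \<alpha>"
  \<comment> \<open>As a process, \<pi> is a linear function on the signature at all arguments. It
    agrees with the maximiser only where the empty word has the value 1.\<close>
  have \<pi>_eq: "\<pi> t \<omega> = P *v ?a t \<omega> + q" if "t \<in> {0..T}" "\<omega> \<in> space M" for t \<omega>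
  proof -
    have "Sg [] t \<omega> = 1" using assms(5) that by (simp add: is_signature_def)
    then show ?thesis
      by (simp add: vec_eq_iff \<pi>_def l_def[abs_def] sig_linear_affine sig_drift_def matrix_vector_mult_def)
  qed
  have \<pi>_sum: "(\<Sum>i\<in>UNIV. \<pi> t \<omega> $ i) = 1" if "t \<in> {0..T}" "\<omega> \<in> space M" for t \<omega>
    using opt_sum \<pi>_eq[OF that] by simp
  have "integrable_wrt M F T \<pi> R"
  proof (rule integrable_wrt_return[OF _ _ _ assms(11,12)])
    show "continuous_adapted M F T (\<lambda>t \<omega>. S t \<omega> $ i)" for i
      using assms(6) by (simp add: continuous_semimartingale_def)
    show "continuous_adapted M F T (\<lambda>t \<omega>. ?a t \<omega> $ i)" "continuous_adapted M F T (\<lambda>t \<omega>. \<pi> t \<omega> $ i)" for i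
      using sig_linear_continuous_adapted[OF assms(5)] by (simp_all add: sig_drift_def \<pi>_def)
  qed (use assms(7) in auto)
  then have portfolio: "portfolio M F T R \<pi>"
    using \<pi>_sum by (simp add: portfolio_def)
  have dt_space: "t \<in> {0..T}" "\<omega> \<in> space M" if "(t, \<omega>) \<in> space (dt_prod M T)" for t \<omega>
    using that by (auto simp: dt_prod_def space_pair_measure space_restrict_space)
  \<comment> \<open>The comparison takes place at each point of the product space, because the
    budget constraint of a portfolio holds there without exception.\<close>
  have le: "growth_rate ?a Sig \<rho> t \<omega> \<le> growth_rate ?a Sig \<pi> t \<omega>"
    and uniq: "growth_rate ?a Sig \<rho> t \<omega> = growth_rate ?a Sig \<pi> t \<omega> \<Longrightarrow> \<rho> t \<omega> = \<pi> t \<omega>"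
    if "portfolio M F T R \<rho>" "(t, \<omega>) \<in> space (dt_prod M T)" for \<rho> t \<omega>
    using that dt_space[OF that(2)] opt_le[of "\<rho> t \<omega>" "?a t \<omega>"] opt_unique[of "\<rho> t \<omega>" "?a t \<omega>"]
    by (simp_all add: growth_rate_def \<pi>_eq portfolio_def)
  have optimal: "growth_optimal M F T R ?a Sig \<pi>"
    unfolding growth_optimal_def using portfolio le by (auto intro!: AE_I2)
  have unique: "AE (t, \<omega>) in dt_prod M T. \<rho> t \<omega> = \<pi> t \<omega>" if "growth_optimal M F T R ?a Sig \<rho>" for \<rho>
  proof -
    \<comment> \<open>A second optimal portfolio must beat \<pi> almost everywhere. With
      \<open>le\<close> this becomes equality of growth rates, to which strict concavity, in the
      form of \<open>uniq\<close>, applies.\<close>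
    have "AE x in dt_prod M T. case x of (t, \<omega>) \<Rightarrow> growth_rate ?a Sig \<pi> t \<omega> \<le> growth_rate ?a Sig \<rho> t \<omega>"
      using that portfolio by (simp add: growth_optimal_def)
    with AE_space[of "dt_prod M T"] show ?thesis
    proof eventually_elim
      case (elim x)
      obtain t \<omega> where x: "x = (t, \<omega>)" by (cases x)
      have "portfolio M F T R \<rho>" using that by (simp add: growth_optimal_def)
      from le[OF this, of t \<omega>] uniq[OF this, of t \<omega>] show ?case using elim by (simp add: x)
    qed
  qed
  have II: "sig_portfolio_II M F T R Sg \<tau> \<pi>" for \<tau>
    unfolding sig_portfolio_II_def
  proof (intro conjI portfolio exI[of _ "\<lambda>i. sig_linear Sg K (l i)"] allI ballI)
    show "linear_on_signature Sg (sig_linear Sg K (l i))" for i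
      unfolding linear_on_signature_def by blast
    show "\<pi> t \<omega> $ i = sig_linear Sg K (l i) t \<omega> + \<tau> t \<omega> $ i * (1 - (\<Sum>j\<in>UNIV. sig_linear Sg K (l j) t \<omega>))"
      if "t \<in> {0..T}" "\<omega> \<in> space M" for t \<omega> i
      using \<pi>_sum[OF that] by (simp add: \<pi>_def)
  qed
  \<comment> \<open>Where \<open>c $ i = 0\<close>, type I forces the weight \<open>i\<close> to
    vanish, which an optimal weight need not do; hence the nonzero entries. The weighted sum inside
    the bracket is the total of \<pi>, so it cancels the 1.\<close>
  have I: "sig_portfolio_I M F T R Sg (\<lambda>t \<omega>. c) \<pi>" if c: "\<And>i. c $ i \<noteq> 0" for c
    unfolding sig_portfolio_I_def
  proof (intro conjI portfolio exI[of _ "\<lambda>i. sig_linear Sg K (\<lambda>I. l i I / c $ i)"] allI ballI)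
    show "linear_on_signature Sg (sig_linear Sg K (\<lambda>I. l i I / c $ i))" for i
      unfolding linear_on_signature_def by blast
    show "\<pi> t \<omega> $ i = c $ i * (sig_linear Sg K (\<lambda>I. l i I / c $ i) t \<omega> + 1 -
        (\<Sum>j\<in>UNIV. c $ j * sig_linear Sg K (\<lambda>I. l j I / c $ j) t \<omega>))"
      if "t \<in> {0..T}" "\<omega> \<in> space M" for t \<omega> i
      using \<pi>_sum[OF that] c by (simp add: \<pi>_def sig_linear_scale[symmetric])
  qed
  show ?thesis using optimal unique II I by blast
qed

end
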